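(* Let $(b^*,u^* )$ be a uniformly $\tau$-overtaking optimal process for the problem of minimizing $l(b)+\int_0^\infty f_0(x,u,t)\,dt$ subject to $\dot x=f(x,u,t)$, $u(t)\in U(t)$, $x(0)=b\in\mathcal C$, and let $(\psi^*,\lambda^* )$ be some $\tau$-limiting solution of the PMP system associated with $(x^*,u^* )$. Suppose that the (finite) limit $$I_*=\lim_{n\to\infty,\ \xi\to b^*}I(\xi;\tau_n)\in\mathbb X$$ exists. Then, up to a positive factor, $(\psi^*,\lambda^* )$ is the unique $\tau$-limiting solution, and (after normalization by a positive factor) it is given by $$\lambda^*=1,\qquad \psi^*(0)=-I_*\in\partial_L l(b^* )+N_L^{\mathcal C}(b^* ),$$ $$\psi^*(T)=\Big(-I_*+\int_0^T\frac{\partial f_0}{\partial x}(x^*(t),u^*(t),t)\,A(b^*;t)\,dt\Big)A^{-1}(b^*;T)\qquad\forall T\ge0.$$ Moreover, if $I_*=\lim_{t\to\infty,\ \xi\to b^*}I(\xi;t)$ (i.e. $I_*$ is independent of $\tau$), then $$\psi^*(T)=-\int_T^\infty\frac{\partial f_0}{\partial x}(x^*(t),u^*(t),t)\,A(b^*;t)\,dt\;A^{-1}(b^*;T)\qquad\forall T\ge0,$$ where the improper integral is understood in the Riemann sense (as $\lim_{S\to\infty}\int_T^S$). In particular, $$-\int_0^\infty\frac{\partial f_0}{\partial x}(x^*(t),u^*(t),t)\,A(b^*;t)\,dt\in\partial_L l(b^* )+N_L^{\mathcal C}(b^* ).$$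
   Context: Setting. $\mathbb T=[0,\infty)$, $\mathbb X=\mathbb R^m$, $\mathbb U$ is a finite-dimensional Euclidean space; $f:\mathbb X\times\mathbb U\times\mathbb T\to\mathbb X$, $f_0:\mathbb X\times\mathbb U\times\mathbb T\to\mathbb R$, $l:\mathbb X\to\mathbb R$. $U$ maps each $t\in\mathbb T$ to a closed subset $U(t)$ of $\mathbb U$ and has Borel graph. The set $\mathfrak U$ of admissible controls consists of the measurable functions $u:\mathbb T\to\mathbb U$, bounded on every compact time interval, with $u(t)\in U(t)$ for a.a. $t$. Assumptions: $\mathcal C\subset\mathbb X$ is closed; $l$ is locally Lipschitz; $f$ is Borel measurable in $(t,u)$ and continuously differentiable in $x$; for each $u\in\mathfrak U$ the map $(t,x)\mapsto f(x,u(t),t)$ satisfies the sublinear growth condition ($\|f(x,u(t),t)\|\le L_u(t)(1+\|x\|)$ with $L_u$ locally integrable); $f_0$ is measurable in $(t,u)$, continuously differentiable in $x$ and lower semicontinuous in $u$; $\partial f/\partial x$, $\partial f_0/\partial x$ are measurable in $(t,u)$ and locally Lipschitz in $x$. It is also understood that along admissible controls the right-hand sides are Carathéodory and that $f,f_0,\partial f/\partial x,\partial f_0/\partial x$ are, on bounded sets of $(x,u)$, bounded by locally integrable functions of $t$ and Lipschitz in $x$ with locally integrable constants. $\tau=(\tau_n)$ is an unboundedly increasing sequence of positive times. For $b\in\mathbb X$, $u\in\mathfrak U$, $x(b,u;\cdot)$ is the unique solution on $\mathbb T$ of $\dot x=f(x,u(t),t)$, $x(0)=b$; $J(b,u;T)=\int_0^T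 f_0(x(b,u;t),u(t),t)\,dt$; $x^*=x(b^*,u^*;\cdot)$. Optimality. $(b^*,u^* )\in\mathcal C\times\mathfrak U$ is uniformly $\tau$-overtaking optimal if $\liminf_{n\to\infty}\big(l(b^* )+J(b^*,u^*;\tau_n)-\inf_{(b,u)\in\mathcal C\times\mathfrak U}(l(b)+J(b,u;\tau_n))\big)\ge0$. PMP system. $H(x,u,\psi,\lambda,t)=\psi f(x,u,t)-\lambda f_0(x,u,t)$, $\lambda\ge0$ ($\psi f$ is the scalar product; $\psi$ is a row vector). A pair $(\psi,\lambda)$, $\lambda\ge 0$ constant, is a solution of the PMP system associated with $(x^*,u^* )$ if $-\dot\psi(t)=\frac{\partial H}{\partial x}(x^*(t),u^*(t),\psi(t),\lambda,t)$ and $\sup_{v\in U(t)}H(x^*(t),v,\psi(t),\lambda,t)=H(x^*(t),u^*(t),\psi(t),\lambda,t)$ for a.e. $t\ge0$. It is nontrivial if $(\psi,\lambda)\neq(0,0)$. A nontrivial solution $(\psi^*,\lambda^* )$ is $\tau$-limiting if there are a subsequence $\tau'\subset\tau$ and triples $(x_n,\psi_n,\lambda_n)$ with constant $\lambda_n\ge0$, solving $\dot x=f(x,u^*(t),t)$, $-\dot\psi=\frac{\partial H}{\partial x}(x,u^*(t),\psi,\lambda_n,t)$, with $\psi_n(\tau'_n)=0$, which converge pointwise on $\mathbb T$ to $(x^*,\psi^*,\lambda^* )$. Matrix $A$ and vector $I$. For $\xi\in\mathbb X$, $A(\xi;\cdot)$ is the $m\times m$ matrix solution of $\frac{d}{dt}A(\xi;t)=\frac{\partial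 f}{\partial x}(x(\xi,u^*;t),u^*(t),t)A(\xi;t)$, $A(\xi;0)=$ identity, and $I(\xi;T)=\int_0^T\frac{\partial f_0}{\partial x}(x(\xi,u^*;t),u^*(t),t)\,A(\xi;t)\,dt$. Nonsmooth notions. $\zeta$ is a proximal subgradient of $g$ at $b$ ($\zeta\in\partial_Pg(b)$) if for some $\sigma\ge0$ and neighborhood $\Omega$ of $b$, $g(\xi)\ge g(b)+\zeta(\xi-b)-\sigma\|\xi-b\|^2$ for all $\xi\in\Omega$. The limiting subdifferential $\partial_Lg(b)$ is the set of limits of $\zeta_n\in\partial_Pg(b_n)$ with $b_n\to b$ (for $g$ continuous). $N_P^{\mathcal C}(b)$ is the set of $\zeta$ such that for some $\sigma\ge0$, $\zeta(\xi-b)\le\sigma\|\xi-b\|^2$ for all $\xi\in\mathcal C$; $N_L^{\mathcal C}(b)$ is the set of limits of $\zeta_n\in N_P^{\mathcal C}(b_n)$ with $b_n\in\mathcal C$, $b_n\to b$.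
   Formalization: Uniform τ-overtaking optimality is read with the sign corrected, as liminf(inf(l+J) − (l(b* )+J(b*,u*;τ_n))) ≥ 0; the printed condition holds for every admissible process, and the claim then fails (f=f_0=0, l(b)=b, C=R). *)

theory Defs
  imports "HOL-Analysis.Analysis" "HOL-Library.Set_Algebras"
begin

section \<open>Partial derivatives in the state\<close>

definition gradient :: "(real^'m \<Rightarrow> real) \<Rightarrow> real^'m \<Rightarrow> real^'m" where
  "gradient g x = (\<chi> i. frechet_derivative g (at x) (axis i 1))"

definition D_f :: "(real^'m \<Rightarrow> 'u \<Rightarrow> real \<Rightarrow> real^'m) \<Rightarrow> real^'m \<Rightarrow> 'u \<Rightarrow> real \<Rightarrow> real^'m^'m" where
  "D_f f x v t = jacobian (\<lambda>y. f y v t) (at x)"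

text \<open>Gradients and costates are row vectors; they act on matrices from the left through
  \<^term>\<open>(v*)\<close>.\<close>

definition D_f0 :: "(real^'m \<Rightarrow> 'u \<Rightarrow> real \<Rightarrow> real) \<Rightarrow> real^'m \<Rightarrow> 'u \<Rightarrow> real \<Rightarrow> real^'m" where
  "D_f0 f0 x v t = gradient (\<lambda>y. f0 y v t) x"


section \<open>Regularity notions\<close>

definition locally_lipschitz :: "('a::metric_space \<Rightarrow> 'b::metric_space) \<Rightarrow> bool" where
  "locally_lipschitz g \<longleftrightarrow> (\<forall>x. \<exists>r>0. \<exists>L. L-lipschitz_on (cball x r) g)"

definition lower_semicontinuous :: "('a::topological_space \<Rightarrow> real) \<Rightarrow> bool" where
  "lower_semicontinuous g \<longleftrightarrow> (\<forall>v c. c < g v \<longrightarrow> (\<forall>\<^sub>F w in at v. c < g w))"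

definition locally_integrable :: "(real \<Rightarrow> 'a::euclidean_space) \<Rightarrow> bool" where
  "locally_integrable k \<longleftrightarrow> (\<forall>T\<ge>0. set_integrable lebesgue {0..T} k)"

definition caratheodory ::
  "('a::topological_space \<Rightarrow> real \<Rightarrow> 'b::topological_space) \<Rightarrow> bool" where
  "caratheodory g \<longleftrightarrow>
     (\<forall>x. (\<lambda>t. g x t) \<in> borel_measurable (lebesgue_on {0..})) \<and>
     (AE t in lebesgue_on {0..}. continuous_on UNIV (\<lambda>x. g x t))"

definition locally_integrably_lipschitz ::
  "('x::real_normed_vector \<Rightarrow> 'u::real_normed_vector \<Rightarrow> real \<Rightarrow> 'b::real_normed_vector) \<Rightarrow> bool" where
  "locally_integrably_lipschitz g \<longleftrightarrow>
     (\<forall>B. bounded B \<longrightarrow> (\<exists>k. locally_integrable k \<and>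
        (AE t in lebesgue_on {0..}.
           (\<forall>(x, v)\<in>B. norm (g x v t) \<le> k t) \<and>
           (\<forall>x y v. (x, v) \<in> B \<longrightarrow> (y, v) \<in> B \<longrightarrow>
              norm (g x v t - g y v t) \<le> k t * norm (x - y)))))"


section \<open>The control problem\<close>

definition admissible_controls :: "(real \<Rightarrow> 'u::euclidean_space set) \<Rightarrow> (real \<Rightarrow> 'u) set" where
  "admissible_controls U =
     {u. u \<in> borel_measurable (lebesgue_on {0..}) \<and>
         (\<forall>T\<ge>0. bounded (u ` {0..T})) \<and>
         (AE t in lebesgue_on {0..}. u t \<in> U t)}"

text \<open>Time ranges over \<open>[0,\<infinity>)\<close>; values at negative times are irrelevant. Where the measurability
  in \<open>(t,v)\<close> is not required to be Borel, Lebesgue measurability on \<open>[0,\<infinity>) \<times> 'u\<close> is assumed;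
  measurability along admissible controls is then provided by \<open>carath_*\<close>.\<close>

locale control_problem =
  fixes C :: "(real^'m) set"
    and l :: "real^'m \<Rightarrow> real"
    and f :: "real^'m \<Rightarrow> 'u::euclidean_space \<Rightarrow> real \<Rightarrow> real^'m"
    and f0 :: "real^'m \<Rightarrow> 'u \<Rightarrow> real \<Rightarrow> real"
    and U :: "real \<Rightarrow> 'u set"
  assumes closed_U: "\<And>t. t \<ge> 0 \<Longrightarrow> closed (U t)"
    and borel_graph_U: "{(t, v). t \<ge> 0 \<and> v \<in> U t} \<in> sets borel"
    and closed_C: "closed C"
    and lipschitz_l: "locally_lipschitz l"
    and f_borel: "\<And>x. (\<lambda>(t, v). f x v t) \<in> borel_measurable (restrict_space borel ({0..} \<times> UNIV))"
    and f_differentiable: "\<And>x v t. t \<ge> 0 \<Longrightarrow> (\<lambda>y. f y v t) differentiable (at x)"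
    and f_C1: "\<And>v t. t \<ge> 0 \<Longrightarrow> continuous_on UNIV (\<lambda>x. D_f f x v t)"
    and f_growth: "\<And>u. u \<in> admissible_controls U \<Longrightarrow>
          \<exists>L. locally_integrable L \<and>
              (AE t in lebesgue_on {0..}. \<forall>x. norm (f x (u t) t) \<le> L t * (1 + norm x))"
    and f0_measurable: "\<And>x. (\<lambda>(t, v). f0 x v t) \<in> borel_measurable (lebesgue_on ({0..} \<times> UNIV))"
    and f0_differentiable: "\<And>x v t. t \<ge> 0 \<Longrightarrow> (\<lambda>y. f0 y v t) differentiable (at x)"
    and f0_C1: "\<And>v t. t \<ge> 0 \<Longrightarrow> continuous_on UNIV (\<lambda>x. D_f0 f0 x v t)"
    and f0_lsc: "\<And>x t. t \<ge> 0 \<Longrightarrow> lower_semicontinuous (\<lambda>v. f0 x v t)"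
    and D_f_measurable:
          "\<And>x. (\<lambda>(t, v). D_f f x v t) \<in> borel_measurable (lebesgue_on ({0..} \<times> UNIV))"
    and D_f0_measurable:
          "\<And>x. (\<lambda>(t, v). D_f0 f0 x v t) \<in> borel_measurable (lebesgue_on ({0..} \<times> UNIV))"
    and D_f_lipschitz: "\<And>v t. t \<ge> 0 \<Longrightarrow> locally_lipschitz (\<lambda>x. D_f f x v t)"
    and D_f0_lipschitz: "\<And>v t. t \<ge> 0 \<Longrightarrow> locally_lipschitz (\<lambda>x. D_f0 f0 x v t)"
    and carath_f: "\<And>u. u \<in> admissible_controls U \<Longrightarrow> caratheodory (\<lambda>x t. f x (u t) t)"
    and carath_f0: "\<And>u. u \<in> admissible_controls U \<Longrightarrow> caratheodory (\<lambda>x t. f0 x (u t) t)"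
    and carath_D_f: "\<And>u. u \<in> admissible_controls U \<Longrightarrow> caratheodory (\<lambda>x t. D_f f x (u t) t)"
    and carath_D_f0: "\<And>u. u \<in> admissible_controls U \<Longrightarrow> caratheodory (\<lambda>x t. D_f0 f0 x (u t) t)"
    and bounds_f: "locally_integrably_lipschitz f"
    and bounds_f0: "locally_integrably_lipschitz f0"
    and bounds_D_f: "locally_integrably_lipschitz (D_f f)"
    and bounds_D_f0: "locally_integrably_lipschitz (D_f0 f0)"


section \<open>Solutions of differential equations and the cost\<close>

definition absolutely_continuous_on :: "real \<Rightarrow> real \<Rightarrow> (real \<Rightarrow> 'a::real_normed_vector) \<Rightarrow> bool" where
  "absolutely_continuous_on a b x \<longleftrightarrow>
     (\<forall>\<epsilon>>0. \<exists>\<delta>>0. \<forall>P. finite P \<longrightarrow>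
        (\<forall>(s, t)\<in>P. a \<le> s \<and> s \<le> t \<and> t \<le> b) \<longrightarrow>
        disjoint_family_on (\<lambda>(s, t). {s<..<t}) P \<longrightarrow>
        (\<Sum>(s, t)\<in>P. t - s) < \<delta> \<longrightarrow> (\<Sum>(s, t)\<in>P. norm (x t - x s)) < \<epsilon>)"

text \<open>Caratheodory solutions of \<open>x' = g(t, x)\<close> on \<open>[0,\<infinity>)\<close>.\<close>

definition solves :: "(real \<Rightarrow> 'a::real_normed_vector \<Rightarrow> 'a) \<Rightarrow> (real \<Rightarrow> 'a) \<Rightarrow> bool" where
  "solves g x \<longleftrightarrow>
     (\<forall>T\<ge>0. absolutely_continuous_on 0 T x) \<and>
     (AE t in lebesgue_on {0..}. (x has_vector_derivative g t (x t)) (at t within {0..}))"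

text \<open>The choice operator selects one representative: solutions are unique only on \<open>[0,\<infinity>)\<close>.\<close>

definition traj ::
  "(real^'m \<Rightarrow> 'u \<Rightarrow> real \<Rightarrow> real^'m) \<Rightarrow> real^'m \<Rightarrow> (real \<Rightarrow> 'u) \<Rightarrow> real \<Rightarrow> real^'m" where
  "traj f b u = (SOME x. x 0 = b \<and> solves (\<lambda>t y. f y (u t) t) x)"

definition cost ::
  "(real^'m \<Rightarrow> 'u \<Rightarrow> real \<Rightarrow> real^'m) \<Rightarrow> (real^'m \<Rightarrow> 'u \<Rightarrow> real \<Rightarrow> real) \<Rightarrow>
   real^'m \<Rightarrow> (real \<Rightarrow> 'u) \<Rightarrow> real \<Rightarrow> real" where
  "cost f f0 b u T = (LINT t:{0..T}|lebesgue. f0 (traj f b u t) (u t) t)"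

text \<open>For each horizon, the optimal value minus the attained value is nonpositive, so optimality
  says that this difference tends to \<open>0\<close>. (With the opposite sign the condition would hold for
  every admissible process.) The infimum is taken in the extended reals.\<close>

definition uniformly_overtaking_optimal ::
  "(real^'m) set \<Rightarrow> (real^'m \<Rightarrow> real) \<Rightarrow> (real^'m \<Rightarrow> 'u::euclidean_space \<Rightarrow> real \<Rightarrow> real^'m) \<Rightarrow>
   (real^'m \<Rightarrow> 'u \<Rightarrow> real \<Rightarrow> real) \<Rightarrow> (real \<Rightarrow> 'u set) \<Rightarrow> (nat \<Rightarrow> real) \<Rightarrow>
   real^'m \<Rightarrow> (real \<Rightarrow> 'u) \<Rightarrow> bool" where
  "uniformly_overtaking_optimal C l f f0 U \<tau> bs us \<longleftrightarrow>
     bs \<in> C \<and> us \<in> admissible_controls U \<and>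
     0 \<le> liminf (\<lambda>n. (INF (b, u) \<in> C \<times> admissible_controls U. ereal (l b + cost f f0 b u (\<tau> n)))
                       - ereal (l bs + cost f f0 bs us (\<tau> n)))"


section \<open>The system of the Pontryagin maximum principle\<close>

definition hamiltonian ::
  "(real^'m \<Rightarrow> 'u \<Rightarrow> real \<Rightarrow> real^'m) \<Rightarrow> (real^'m \<Rightarrow> 'u \<Rightarrow> real \<Rightarrow> real) \<Rightarrow>
   real^'m \<Rightarrow> 'u \<Rightarrow> real^'m \<Rightarrow> real \<Rightarrow> real \<Rightarrow> real" where
  "hamiltonian f f0 x v \<psi> lam t = \<psi> \<bullet> f x v t - lam * f0 x v t"

definition solves_adjoint ::
  "(real^'m \<Rightarrow> 'u \<Rightarrow> real \<Rightarrow> real^'m) \<Rightarrow> (real^'m \<Rightarrow> 'u \<Rightarrow> real \<Rightarrow> real) \<Rightarrow>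
   (real \<Rightarrow> real^'m) \<Rightarrow> (real \<Rightarrow> 'u) \<Rightarrow> (real \<Rightarrow> real^'m) \<Rightarrow> real \<Rightarrow> bool" where
  "solves_adjoint f f0 x u \<psi> lam \<longleftrightarrow>
     solves (\<lambda>t p. - gradient (\<lambda>y. hamiltonian f f0 y (u t) p lam t) (x t)) \<psi>"

definition pmp_solution ::
  "(real^'m \<Rightarrow> 'u \<Rightarrow> real \<Rightarrow> real^'m) \<Rightarrow> (real^'m \<Rightarrow> 'u \<Rightarrow> real \<Rightarrow> real) \<Rightarrow> (real \<Rightarrow> 'u set) \<Rightarrow>
   (real \<Rightarrow> real^'m) \<Rightarrow> (real \<Rightarrow> 'u) \<Rightarrow> (real \<Rightarrow> real^'m) \<Rightarrow> real \<Rightarrow> bool" where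
  "pmp_solution f f0 U x u \<psi> lam \<longleftrightarrow>
     lam \<ge> 0 \<and> solves_adjoint f f0 x u \<psi> lam \<and>
     (AE t in lebesgue_on {0..}.
        (SUP v\<in>U t. ereal (hamiltonian f f0 (x t) v (\<psi> t) lam t))
          = ereal (hamiltonian f f0 (x t) (u t) (\<psi> t) lam t))"

definition limiting_solution ::
  "(real^'m \<Rightarrow> 'u \<Rightarrow> real \<Rightarrow> real^'m) \<Rightarrow> (real^'m \<Rightarrow> 'u \<Rightarrow> real \<Rightarrow> real) \<Rightarrow> (real \<Rightarrow> 'u set) \<Rightarrow>
   (nat \<Rightarrow> real) \<Rightarrow> (real \<Rightarrow> real^'m) \<Rightarrow> (real \<Rightarrow> 'u) \<Rightarrow> (real \<Rightarrow> real^'m) \<Rightarrow> real \<Rightarrow> bool" where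
  "limiting_solution f f0 U \<tau> xs us \<psi> lam \<longleftrightarrow>
     pmp_solution f f0 U xs us \<psi> lam \<and>
     (lam \<noteq> 0 \<or> (\<exists>t\<ge>0. \<psi> t \<noteq> 0)) \<and>
     (\<exists>(r :: nat \<Rightarrow> nat) x p q. strict_mono r \<and>
        (\<forall>n. q n \<ge> 0 \<and> solves (\<lambda>t y. f y (us t) t) (x n) \<and>
             solves_adjoint f f0 (x n) us (p n) (q n) \<and> p n (\<tau> (r n)) = 0) \<and>
        (\<forall>t\<ge>0. (\<lambda>n. x n t) \<longlonglongrightarrow> xs t) \<and>
        (\<forall>t\<ge>0. (\<lambda>n. p n t) \<longlonglongrightarrow> \<psi> t) \<and>
        q \<longlonglongrightarrow> lam)"


section \<open>The matrix \<open>A\<close> and the vector \<open>I\<close>\<close>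

definition A_mat ::
  "(real^'m \<Rightarrow> 'u \<Rightarrow> real \<Rightarrow> real^'m) \<Rightarrow> (real \<Rightarrow> 'u) \<Rightarrow> real^'m \<Rightarrow> real \<Rightarrow> real^'m^'m" where
  "A_mat f us \<xi> =
     (SOME A. A 0 = mat 1 \<and> solves (\<lambda>t M. D_f f (traj f \<xi> us t) (us t) t ** M) A)"

definition I_integrand ::
  "(real^'m \<Rightarrow> 'u \<Rightarrow> real \<Rightarrow> real^'m) \<Rightarrow> (real^'m \<Rightarrow> 'u \<Rightarrow> real \<Rightarrow> real) \<Rightarrow> (real \<Rightarrow> 'u) \<Rightarrow>
   real^'m \<Rightarrow> real \<Rightarrow> real^'m" where
  "I_integrand f f0 us \<xi> t = D_f0 f0 (traj f \<xi> us t) (us t) t v* A_mat f us \<xi> t"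

definition I_vec ::
  "(real^'m \<Rightarrow> 'u \<Rightarrow> real \<Rightarrow> real^'m) \<Rightarrow> (real^'m \<Rightarrow> 'u \<Rightarrow> real \<Rightarrow> real) \<Rightarrow> (real \<Rightarrow> 'u) \<Rightarrow>
   real^'m \<Rightarrow> real \<Rightarrow> real^'m" where
  "I_vec f f0 us \<xi> T = (LINT t:{0..T}|lebesgue. I_integrand f f0 us \<xi> t)"

definition has_improper_integral :: "(real \<Rightarrow> 'a::euclidean_space) \<Rightarrow> real \<Rightarrow> 'a \<Rightarrow> bool" where
  "has_improper_integral g T W \<longleftrightarrow> ((\<lambda>S. LINT t:{T..S}|lebesgue. g t) \<longlongrightarrow> W) at_top"


section \<open>Nonsmooth notions\<close>

definition proximal_subdifferential :: "('a::real_inner \<Rightarrow> real) \<Rightarrow> 'a \<Rightarrow> 'a set" where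
  "proximal_subdifferential g b =
     {\<zeta>. \<exists>\<sigma>\<ge>0. \<forall>\<^sub>F \<xi> in nhds b. g \<xi> \<ge> g b + \<zeta> \<bullet> (\<xi> - b) - \<sigma> * (norm (\<xi> - b))\<^sup>2}"

definition limiting_subdifferential :: "('a::real_inner \<Rightarrow> real) \<Rightarrow> 'a \<Rightarrow> 'a set" where
  "limiting_subdifferential g b =
     {\<zeta>. \<exists>z c. (\<forall>n. z n \<in> proximal_subdifferential g (c n)) \<and> c \<longlonglongrightarrow> b \<and> z \<longlonglongrightarrow> \<zeta>}"

definition proximal_normal_cone :: "'a::real_inner set \<Rightarrow> 'a \<Rightarrow> 'a set" where
  "proximal_normal_cone C b =
     {\<zeta>. \<exists>\<sigma>\<ge>0. \<forall>\<xi>\<in>C. \<zeta> \<bullet> (\<xi> - b) \<le> \<sigma> * (norm (\<xi> - b))\<^sup>2}"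

definition limiting_normal_cone :: "'a::real_inner set \<Rightarrow> 'a \<Rightarrow> 'a set" where
  "limiting_normal_cone C b =
     {\<zeta>. \<exists>z c. (\<forall>n. c n \<in> C \<and> z n \<in> proximal_normal_cone C (c n)) \<and> c \<longlonglongrightarrow> b \<and> z \<longlonglongrightarrow> \<zeta>}"

end

theory Submission
  imports Defs
begin

text \<open>
  Only the initial state is varied, while the control stays at its optimal value. The basic fact is
  that the cost up to time T is then differentiable in the initial state with gradient I(.;T), and
  that the remainder is quadratic, uniformly on a ball (\<open>cost_quadratic_estimate\<close>). It is used twice.

  \<^item> For the costates. If a costate p with multiplier lam solves the adjoint equation along the
    trajectory from \<open>\<xi>\<close>, then p(t) A(\<open>\<xi>\<close>;t) = p(0) + lam I(\<open>\<xi>\<close>;t) (\<open>adjoint_identity\<close>). For the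
    approximating triples the terminal condition turns this into p(0) = - lam I(\<open>\<xi>\<close>;T) at the
    horizon T, and in the limit every limiting solution satisfies \<open>\<psi>\<close>(0) = - lam Is. The same identity for the
    limit recovers \<open>\<psi>\<close>(T) from lam by inverting A. So lam determines everything linearly; lam = 0 would
    give the trivial solution, hence lam is positive and the solution is unique up to a positive factor
    (\<open>limiting_solution_formula\<close>).

  \<^item> For the transversality condition. Uniform optimality implies that bs minimises l plus the cost up to
    \<open>\<tau>\<close> n over C up to an error tending to 0. A penalisation argument (\<open>approximate_fermat_rule\<close>) then
    gives, close to bs, a proximal subgradient of l and a proximal normal of C whose sum nearly cancels
    the gradient I(y;\<open>\<tau>\<close> n), and compactness yields - Is as a sum of limiting objects (\<open>transversality\<close>).

  The limit defining Is is taken over punctured neighbourhoods of bs. It extends to full neighbourhoods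
  since I(.;T) is continuous, which follows from the quadratic estimate by a comparison of three points
  (\<open>quadratic_expansion_gradient_lipschitz\<close>).

  The underlying theory of Caratheodory equations rests on the fundamental theorem of calculus for
  absolutely continuous functions in both directions (\<open>absolutely_continuous_has_integral\<close> and
  \<open>integral_has_vector_derivative_ae\<close>), on Gronwall's inequality, and on existence through a contraction
  in a weighted norm followed by truncation (\<open>caratheodory_existence\<close>).
\<close>

section \<open>The fundamental theorem of calculus for absolutely continuous functions\<close>

lemma AE_lebesgue_on_iff_negligible:
  assumes "S \<in> sets lebesgue"
  shows "(AE t in lebesgue_on S. P t) \<longleftrightarrow> (\<exists>N. negligible N \<and> (\<forall>t\<in>S. t \<notin> N \<longrightarrow> P t))"
proof -
  have "(AE t in lebesgue_on S. P t) \<longleftrightarrow> (AE t in lebesgue. t \<in> S \<longrightarrow> P t)"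
    using assms by (subst AE_restrict_space_iff) auto
  also have "\<dots> \<longleftrightarrow> (\<exists>N. negligible N \<and> (\<forall>t\<in>S. t \<notin> N \<longrightarrow> P t))"
    unfolding eventually_ae_filter negligible_iff_null_sets
    by (auto 4 4)
  finally show ?thesis .
qed

definition short_intervals :: "real \<Rightarrow> real \<Rightarrow> real \<Rightarrow> (real \<times> real) set \<Rightarrow> bool" where
  "short_intervals a b \<delta> P \<longleftrightarrow> finite P \<and> (\<forall>(s, t)\<in>P. a \<le> s \<and> s \<le> t \<and> t \<le> b) \<and>
     disjoint_family_on (\<lambda>(s, t). {s<..<t}) P \<and> (\<Sum>(s, t)\<in>P. t - s) < \<delta>"

lemma absolutely_continuous_on_iff:
  "absolutely_continuous_on a b x \<longleftrightarrow>
     (\<forall>e>0. \<exists>\<delta>>0. \<forall>P. short_intervals a b \<delta> P \<longrightarrow> (\<Sum>(s, t)\<in>P. norm (x t - x s)) < e)"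
  unfolding absolutely_continuous_on_def short_intervals_def by (simp only: imp_conjL)

lemma absolutely_continuous_onE:
  assumes "absolutely_continuous_on a b x" "e > 0"
  obtains \<delta> where "\<delta> > 0"
    "\<And>P. short_intervals a b \<delta> P \<Longrightarrow> (\<Sum>(s, t)\<in>P. norm (x t - x s)) < e"
  using assms unfolding absolutely_continuous_on_iff by blast

lemma sum_lengths_le_measure:
  fixes P :: "(real \<times> real) set"
  assumes "finite P" and P: "\<And>s t. (s, t) \<in> P \<Longrightarrow> s \<le> t \<and> {s<..<t} \<subseteq> G"
    and disj: "disjoint_family_on (\<lambda>(s, t). {s<..<t}) P" and G: "G \<in> lmeasurable"
  shows "(\<Sum>(s, t)\<in>P. t - s) \<le> measure lebesgue G"
proof -
  have "(\<Sum>(s, t)\<in>P. t - s) = (\<Sum>p\<in>P. measure lebesgue (case p of (s, t) \<Rightarrow> {s<..<t}))"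
    using P by (intro sum.cong) auto
  also have "\<dots> = measure lebesgue (\<Union>p\<in>P. case p of (s, t) \<Rightarrow> {s<..<t})"
    using disj \<open>finite P\<close>
    by (intro measure_UNION'[symmetric])
       (auto simp: disjoint_family_on_def pairwise_def disjnt_def split: prod.splits)
  also have "\<dots> \<le> measure lebesgue G"
    using P G \<open>finite P\<close> by (intro measure_mono_fmeasurable) (auto split: prod.splits intro!: sets.finite_UN)
  finally show ?thesis .
qed

text \<open>
  A null set can be covered by an open set of small measure. If all tagged intervals lie inside such
  a cover, their total length is small, so absolute continuity bounds the increments over them. The
  intervals have to be passed on as a set of pairs of endpoints; two tags can share an interval only
  if it is degenerate, and then the increment vanishes.
\<close>

lemma sum_increments_tagged_lt:
  fixes x :: "real \<Rightarrow> 'a::real_normed_vector"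
  assumes ac: "\<And>P. short_intervals a b \<delta> P \<Longrightarrow> (\<Sum>(s, t)\<in>P. norm (x t - x s)) < e"
    and q: "q tagged_partial_division_of {a..b}"
    and G: "G \<in> lmeasurable" "measure lebesgue G < \<delta>" "\<And>t K. (t, K) \<in> q \<Longrightarrow> K \<subseteq> G"
  shows "(\<Sum>(t, K)\<in>q. norm (x (Sup K) - x (Inf K))) < e"
proof -
  note qD = tagged_partial_division_ofD[OF q]
  have K: "\<exists>u v. u \<le> v \<and> K = {u..v} \<and> a \<le> u \<and> v \<le> b" if "(t, K) \<in> q" for t K
    using qD(2,3,4)[OF that] by fastforce
  define h where "h = (\<lambda>tK :: real \<times> real set. (Inf (snd tK), Sup (snd tK)))"
  define P where "P = h ` q"
  have "(\<Sum>p\<in>P. norm (x (snd p) - x (fst p))) = (\<Sum>z\<in>q. norm (x (snd (h z)) - x (fst (h z))))"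
    unfolding P_def
  proof (rule sum.reindex_nontrivial[OF qD(1), unfolded o_def])
    fix z w assume zw: "z \<in> q" "w \<in> q" "z \<noteq> w" "h z = h w"
    obtain t K t' K' where [simp]: "z = (t, K)" "w = (t', K')" by (cases z, cases w) auto
    obtain u v where uv: "u \<le> v" "K = {u..v}" using K[of t K] zw by auto
    obtain u' v' where uv': "u' \<le> v'" "K' = {u'..v'}" using K[of t' K'] zw by auto
    have "u = u'" "v = v'" using zw uv uv' by (auto simp: h_def)
    with qD(5)[of t K t' K'] zw uv uv' have "u = v" by (auto)
    then show "norm (x (snd (h z)) - x (fst (h z))) = 0" using uv by (simp add: h_def)
  qed
  moreover have "(\<Sum>(s, t)\<in>P. norm (x t - x s)) < e"
  proof (rule ac, unfold short_intervals_def, intro conjI)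
    show fin: "finite P" using qD(1) by (simp add: P_def)
    show "\<forall>(s, t)\<in>P. a \<le> s \<and> s \<le> t \<and> t \<le> b" using K by (fastforce simp: P_def h_def)
    show disj: "disjoint_family_on (\<lambda>(s, t). {s<..<t}) P"
      unfolding disjoint_family_on_def
    proof (intro ballI impI)
      fix p p' assume pp: "p \<in> P" "p' \<in> P" and ne': "p \<noteq> p'"
      obtain s t s' t' where pst: "p = (s, t)" "p' = (s', t')" by (metis surj_pair)
      have *: "(s, t) \<in> P" "(s', t') \<in> P" and ne: "(s, t) \<noteq> (s', t')" using pp ne' pst by auto
      from * obtain z w where zw: "z \<in> q" "w \<in> q" "h z = (s, t)" "h w = (s', t')"
        by (force simp: P_def)
      obtain r K r' K' where [simp]: "z = (r, K)" "w = (r', K')" by (cases z, cases w) auto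
      obtain u v where uv: "u \<le> v" "K = {u..v}" using K[of r K] zw by auto
      obtain u' v' where uv': "u' \<le> v'" "K' = {u'..v'}" using K[of r' K'] zw by auto
      have e: "s = u" "t = v" "s' = u'" "t' = v'" using zw uv uv' by (auto simp: h_def)
      have "interior K \<inter> interior K' = {}" using zw ne by (intro qD(5)) auto
      then show "(case p of (s, t) \<Rightarrow> {s<..<t}) \<inter> (case p' of (s, t) \<Rightarrow> {s<..<t}) = {}"
        using e uv uv' pst by (simp add: interior_atLeastAtMost_real)
    qed
    have "(\<Sum>(s, t)\<in>P. t - s) \<le> measure lebesgue G"
    proof (rule sum_lengths_le_measure[OF fin _ disj G(1)])
      fix s t assume "(s, t) \<in> P"
      then obtain r K where "(r, K) \<in> q" "h (r, K) = (s, t)" by (force simp: P_def)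
      with K[of r K] G(3)[of r K] show "s \<le> t \<and> {s<..<t} \<subseteq> G" by (force simp: h_def)
    qed
    with G(2) show "(\<Sum>(s, t)\<in>P. t - s) < \<delta>" by simp
  qed
  ultimately show ?thesis by (simp add: h_def case_prod_unfold)
qed

text \<open>
  The gauge treats the two kinds of tags separately. At a point of differentiability the increment
  over a small interval is close to the derivative times the length; at a point of the exceptional
  null set the interval is forced into an open cover of small measure, where absolute continuity
  makes the increments negligible.
\<close>

theorem absolutely_continuous_has_integral:
  fixes x :: "real \<Rightarrow> 'a::euclidean_space"
  assumes "a \<le> b" and ac: "absolutely_continuous_on a b x" and N: "negligible N"
    and der: "\<And>t. \<lbrakk>t \<in> {a..b}; t \<notin> N\<rbrakk> \<Longrightarrow> (x has_vector_derivative g t) (at t within {a..b})"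
  shows "(g has_integral (x b - x a)) {a..b}"
proof -
  define g' where "g' = (\<lambda>t. if t \<in> N then 0 else g t)"
  have "(g' has_integral (x b - x a)) {a..b}"
    unfolding has_integral_real
  proof (intro allI impI)
    fix e :: real assume "e > 0"
    define e1 where "e1 = e / (2 * (b - a + 1))"
    have "e1 > 0" using \<open>e > 0\<close> \<open>a \<le> b\<close> by (simp add: e1_def)
    have e1: "e1 * (b - a) < e / 2"
      using \<open>e > 0\<close> \<open>a \<le> b\<close> by (simp add: e1_def field_simps)
    have "e / 2 > 0" using \<open>e > 0\<close> by simp
    from absolutely_continuous_onE[OF ac this]
    obtain \<delta> where "\<delta> > 0"
      and \<delta>: "\<And>P. short_intervals a b \<delta> P \<Longrightarrow> (\<Sum>(s, t)\<in>P. norm (x t - x s)) < e / 2"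
      by blast
    (* the open cover of the exceptional set in which the tags in N will be confined *)
    have "N \<in> sets lebesgue" using N by (simp add: negligible_imp_sets)
    then obtain G where G: "open G" "N \<subseteq> G" "G - N \<in> lmeasurable"
        "emeasure lebesgue (G - N) < ennreal \<delta>"
      using sets_lebesgue_outer_open \<open>\<delta> > 0\<close> by blast
    have Glm: "G \<in> lmeasurable"
      using G(3) N by (metis G(2) Diff_partition fmeasurable.Un negligible_imp_measurable)
    have "measure lebesgue G = measure lebesgue (G - N)"
      using N Glm by (metis fmeasurableD measure_Diff_null_set negligible_iff_null_sets)
    also have "\<dots> < \<delta>"
      using G(3,4) \<open>\<delta> > 0\<close> by (simp add: emeasure_eq_measure2 ennreal_less_iff)
    finally have Gm: "measure lebesgue G < \<delta>" .
    have "\<forall>t. \<exists>d>0. t \<in> {a..b} - N \<longrightarrow>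
         (\<forall>y\<in>{a..b}. norm (y-t) < d \<longrightarrow> norm (x y - x t - (y-t) *\<^sub>R g t) \<le> e1 * norm (y-t))"
      using der[unfolded has_vector_derivative_def has_derivative_within_alt] \<open>e1 > 0\<close> by (metis DiffE zero_less_one)
    then obtain d where d: "\<And>t. 0 < d t"
                 "\<And>t y. \<lbrakk>t \<in> {a..b}; t \<notin> N; y \<in> {a..b}; norm (y-t) < d t\<rbrakk>
                        \<Longrightarrow> norm (x y - x t - (y-t) *\<^sub>R g t) \<le> e1 * norm (y-t)"
      by (metis DiffI)
    define \<gamma> where "\<gamma> = (\<lambda>t. if t \<in> N then G else ball t (d t))"
    have "gauge \<gamma>" using G d(1) by (auto simp: gauge_def \<gamma>_def)
    moreover have "norm ((\<Sum>(t, K)\<in>p. measure lborel K *\<^sub>R g' t) - (x b - x a)) < e"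
      if p: "p tagged_division_of {a..b}" "\<gamma> fine p" for p
    proof -
      note pD = tagged_division_ofD[OF p(1)]
      have K: "\<exists>u v. u \<le> v \<and> K = {u..v} \<and> a \<le> u \<and> v \<le> b \<and> t \<in> {u..v}" if "(t, K) \<in> p" for t K
        using pD(2,3,4)[OF that] by fastforce
      define q where "q = {z \<in> p. fst z \<in> N}"
      have q: "q tagged_partial_division_of {a..b}"
        using p(1) by (auto simp: q_def tagged_division_of_def intro: tagged_partial_division_subset)
      have bad: "(\<Sum>(t, K)\<in>q. norm (x (Sup K) - x (Inf K))) < e / 2"
      proof (rule sum_increments_tagged_lt[OF \<delta> q Glm Gm])
        fix t K assume "(t, K) \<in> q"
        then have "t \<in> N" "K \<subseteq> \<gamma> t" using p(2) by (auto simp: q_def fine_def)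
        then show "K \<subseteq> G" by (simp add: \<gamma>_def)
      qed
      have good: "norm (measure lborel K *\<^sub>R g' t - (x (Sup K) - x (Inf K))) \<le> e1 * (Sup K - Inf K)"
        if tK: "(t, K) \<in> p" "t \<notin> N" for t K
      proof -
        obtain u v where uv: "u \<le> v" "K = {u..v}" "a \<le> u" "v \<le> b" "t \<in> {u..v}" using K tK by blast
        have "K \<subseteq> \<gamma> t" using p(2) tK by (auto simp: fine_def)
        then have sub: "{u..v} \<subseteq> ball t (d t)" using tK(2) uv(2) by (simp add: \<gamma>_def)
        have "u \<in> ball t (d t)" "v \<in> ball t (d t)" using sub uv(1) by auto
        then have near: "norm (u - t) < d t" "norm (v - t) < d t" by (auto simp: dist_real_def)
        have 1: "norm (x u - x t - (u-t) *\<^sub>R g t) \<le> e1 * norm (u-t)"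
          by (rule d(2)) (use uv tK near in auto)
        have 2: "norm (x v - x t - (v-t) *\<^sub>R g t) \<le> e1 * norm (v-t)"
          by (rule d(2)) (use uv tK near in auto)
        have "measure lborel K *\<^sub>R g' t - (x (Sup K) - x (Inf K))
            = (x u - x t - (u-t) *\<^sub>R g t) - (x v - x t - (v-t) *\<^sub>R g t)"
          using uv tK by (simp add: g'_def algebra_simps)
        also have "norm \<dots> \<le> e1 * norm (u-t) + e1 * norm (v-t)"
          by (rule order_trans[OF norm_triangle_ineq4 add_mono[OF 1 2]])
        also have "\<dots> = e1 * (Sup K - Inf K)" using uv by (simp add: algebra_simps)
        finally show ?thesis .
      qed
      have fin: "finite p" using pD(1) .
      have "(\<Sum>(t, K)\<in>p. measure lborel K *\<^sub>R g' t) - (x b - x a)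
          = (\<Sum>(t, K)\<in>p. measure lborel K *\<^sub>R g' t - (x (Sup K) - x (Inf K)))"
        using additive_tagged_division_1[OF \<open>a \<le> b\<close> p(1), of x]
        by (simp add: case_prod_unfold sum_subtractf)
      also have "\<dots> = (\<Sum>(t, K)\<in>p - q. measure lborel K *\<^sub>R g' t - (x (Sup K) - x (Inf K)))
          + (\<Sum>(t, K)\<in>q. measure lborel K *\<^sub>R g' t - (x (Sup K) - x (Inf K)))"
        using fin by (intro sum.subset_diff) (auto simp: q_def)
      also have "norm \<dots> \<le> e1 * (b - a) + (\<Sum>(t, K)\<in>q. norm (x (Sup K) - x (Inf K)))"
      proof (intro norm_triangle_mono)
        have "norm (\<Sum>(t, K)\<in>p - q. measure lborel K *\<^sub>R g' t - (x (Sup K) - x (Inf K)))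
          \<le> (\<Sum>(t, K)\<in>p - q. e1 * (Sup K - Inf K))"
          by (intro sum_norm_le) (auto simp: q_def intro!: good)
        also have "\<dots> \<le> (\<Sum>(t, K)\<in>p. e1 * (Sup K - Inf K))"
          using fin \<open>e1 > 0\<close> by (intro sum_mono2) (auto simp: q_def dest!: K)
        also have "\<dots> = e1 * (b - a)"
          using additive_tagged_division_1[OF \<open>a \<le> b\<close> p(1), of "\<lambda>y. y"]
          by (simp add: case_prod_unfold flip: sum_distrib_left)
        finally show "norm (\<Sum>(t, K)\<in>p - q. measure lborel K *\<^sub>R g' t - (x (Sup K) - x (Inf K)))
            \<le> e1 * (b - a)" .
        show "norm (\<Sum>(t, K)\<in>q. measure lborel K *\<^sub>R g' t - (x (Sup K) - x (Inf K)))
            \<le> (\<Sum>(t, K)\<in>q. norm (x (Sup K) - x (Inf K)))"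
          by (intro sum_norm_le) (auto simp: q_def g'_def norm_minus_commute)
      qed
      also have "\<dots> < e" using bad e1 by simp
      finally show ?thesis .
    qed
    ultimately show "\<exists>\<gamma>. gauge \<gamma> \<and> (\<forall>\<D>. \<D> tagged_division_of {a..b} \<and> \<gamma> fine \<D> \<longrightarrow>
        norm ((\<Sum>(t, K)\<in>\<D>. measure lborel K *\<^sub>R g' t) - (x b - x a)) < e)"
      by (intro exI[of _ \<gamma>]) simp
  qed
  then show ?thesis
    by (rule has_integral_spike[OF N, rotated]) (auto simp: g'_def)
qed

section \<open>Differentiation of indefinite integrals\<close>

lemma integral_increment:
  fixes g :: "real \<Rightarrow> 'a::banach"
  assumes "g integrable_on {a..b}" "a \<le> s" "s \<le> t" "t \<le> b"
  shows "integral {a..t} g - integral {a..s} g = integral {s..t} g"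
proof -
  have "g integrable_on {a..t}"
    by (rule integrable_on_subinterval[OF assms(1)]) (use assms in auto)
  from Henstock_Kurzweil_Integration.integral_combine[OF assms(2,3) this] show ?thesis
    by (simp add: algebra_simps)
qed

text \<open>
  By Henstock's lemma the quantities |g(t) |K| - integral of g over K| add up to almost nothing over
  a fine family of disjoint tagged intervals K. Every bad point t is the endpoint of arbitrarily
  short intervals on which this quantity exceeds c |K|. Vitali's covering theorem extracts from them a
  disjoint family that covers almost all bad points, and its total length is then small.
\<close>

lemma negligible_bad_difference_quotients:
  fixes g :: "real \<Rightarrow> 'a::euclidean_space"
  assumes g: "g integrable_on {a..b}" and "c > 0"
  defines "F \<equiv> \<lambda>t. integral {a..t} g"
  shows "negligible {t \<in> {a<..<b}. \<forall>d>0. \<exists>s\<in>{a<..<b}. s \<noteq> t \<and> \<bar>s - t\<bar> < d \<and>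
            norm (F s - F t - (s - t) *\<^sub>R g t) > c * \<bar>s - t\<bar>}" (is "negligible ?B")
  unfolding negligible_outer_le
proof (intro allI impI)
  fix e :: real assume "e > 0"
  then have "e * c > 0" using \<open>c > 0\<close> by simp
  then obtain \<gamma> where \<gamma>: "gauge \<gamma>"
    and hen: "\<And>p. \<lbrakk>p tagged_partial_division_of (cbox a b); \<gamma> fine p\<rbrakk> \<Longrightarrow>
             (\<Sum>(x,k)\<in>p. norm(measure lborel k *\<^sub>R g x - integral k g)) < e * c"
    using Henstock_lemma[of g a b "e * c"] g by (auto simp: box_real)
  (* an interval with endpoints t and s, viewed as a closed ball of the line, for Vitali's theorem *)
  define cen where "cen = (\<lambda>(t, s). (t + s) / 2 :: real)"
  define rad where "rad = (\<lambda>(t, s). \<bar>s - t\<bar> / 2 :: real)"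
  define I where "I = {(t, s). t \<in> {a<..<b} \<and> s \<in> {a<..<b} \<and> s \<noteq> t \<and> {min t s..max t s} \<subseteq> \<gamma> t \<and>
      norm (F s - F t - (s - t) *\<^sub>R g t) > c * \<bar>s - t\<bar>}"
  have cb: "cball (cen (t, s)) (rad (t, s)) = {min t s..max t s}" for t s
    by (cases "t \<le> s") (auto simp: cen_def rad_def cball_eq_atLeastAtMost field_simps)
  have "\<exists>i. i \<in> I \<and> t \<in> cball (cen i) (rad i) \<and> rad i < d" if t: "t \<in> ?B" and "d > 0" for t d
  proof -
    obtain r where r: "r > 0" "ball t r \<subseteq> \<gamma> t" using \<gamma> by (metis gaugeD openE)
    have "min r d > 0" using r \<open>d > 0\<close> by simp
    with t obtain s where s: "s \<in> {a<..<b}" "s \<noteq> t" "\<bar>s - t\<bar> < min r d"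
        "norm (F s - F t - (s - t) *\<^sub>R g t) > c * \<bar>s - t\<bar>"
      by blast
    have "{min t s..max t s} \<subseteq> ball t r" using s by (auto simp: dist_real_def)
    then have "(t, s) \<in> I" using s t r by (auto simp: I_def)
    moreover have "t \<in> cball (cen (t, s)) (rad (t, s))" unfolding cb by auto
    moreover have "rad (t, s) < d" using s(3) by (auto simp: rad_def)
    ultimately show ?thesis by blast
  qed
  note cover = this
  have rpos: "0 < rad i" if "i \<in> I" for i using that by (auto simp: I_def rad_def)
  obtain D where D: "countable D" "D \<subseteq> I"
     "pairwise (\<lambda>i j. disjnt (cball (cen i) (rad i)) (cball (cen j) (rad j))) D"
     "negligible (?B - (\<Union>i \<in> D. cball (cen i) (rad i)))"
    by (rule Vitali_covering_theorem_cballs[of I rad ?B cen])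
       (erule rpos, erule (1) cover, (rule that; assumption))
  have bound: "measure lebesgue (\<Union>i\<in>J. cball (cen i) (rad i)) \<le> e" if J: "J \<subseteq> D" "finite J" for J
  proof -
    define K where "K = (\<lambda>(t, s). {min t s..max t s :: real})"
    define p where "p = (\<lambda>i. (fst i, K i)) ` J"
    have Kcb: "cball (cen i) (rad i) = K i" for i by (cases i) (simp add: K_def cb)
    have disj: "K i \<inter> K j = {}" if "i \<in> J" "j \<in> J" "i \<noteq> j" for i j
      using pairwiseD[OF D(3), of i j] that J by (auto simp: Kcb disjnt_def)
    have ne: "K i \<noteq> {}" for i by (cases i) (simp add: K_def)
    have inj: "inj_on (\<lambda>i. (fst i, K i)) J"
      unfolding inj_on_def using disj ne by (metis Int_absorb prod.inject)
    have p: "p tagged_partial_division_of cbox a b"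
    proof -
      have 1: "\<exists>t s. i = (t, s) \<and> t \<in> {a<..<b} \<and> s \<in> {a<..<b}" if "i \<in> J" for i
        using that J D(2) by (force simp: I_def)
      have 2: "fst i \<in> K i" "K i \<subseteq> cbox a b" "\<exists>u v. K i = cbox u v" if "i \<in> J" for i
        using 1[OF that] by (auto simp: K_def box_real)
      have 3: "interior (K i) \<inter> interior (K j) = {}" if "i \<in> J" "j \<in> J" "i \<noteq> j" for i j
        using disj[OF that] interior_subset by blast
      show ?thesis unfolding tagged_partial_division_of_def
      proof (intro conjI allI impI)
        show "finite p" using J(2) by (simp add: p_def)
        show "x \<in> k" "k \<subseteq> cbox a b" "\<exists>u v. k = cbox u v" if xk: "(x, k) \<in> p" for x k
        proof -
          from xk obtain i where "i \<in> J" "x = fst i" "k = K i" unfolding p_def by blast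
          with 2[of i] show "x \<in> k" "k \<subseteq> cbox a b" "\<exists>u v. k = cbox u v" by blast+
        qed
        show "interior k \<inter> interior k' = {}"
          if "(x, k) \<in> p \<and> (x', k') \<in> p \<and> (x, k) \<noteq> (x', k')" for x k x' k'
        proof -
          from that obtain i j where "i \<in> J" "j \<in> J" "(x, k) = (fst i, K i)" "(x', k') = (fst j, K j)"
            unfolding p_def by blast
          with that 3[of i j] show ?thesis by (cases "i = j") auto
        qed
      qed
    qed
    have fine: "\<gamma> fine p"
      unfolding fine_def p_def using J(1) D(2) by (force simp: I_def K_def)
    have "(\<Sum>i\<in>J. c * measure lebesgue (K i)) \<le> (\<Sum>i\<in>J. norm (measure lborel (K i) *\<^sub>R g (fst i) - integral (K i) g))"
    proof (rule sum_mono)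
      fix i assume "i \<in> J"
      then obtain t s where i: "i = (t, s)" and I: "(t, s) \<in> I" using J D(2) by (cases i) auto
      have ts: "a < t" "t < b" "a < s" "s < b" "c * \<bar>s - t\<bar> < norm (F s - F t - (s - t) *\<^sub>R g t)"
        using I by (auto simp: I_def)
      have "norm (measure lborel (K i) *\<^sub>R g (fst i) - integral (K i) g) = norm (F s - F t - (s - t) *\<^sub>R g t)"
      proof (cases "t \<le> s")
        case True
        then have "integral (K i) g = F s - F t"
          using integral_increment[OF g, of t s] ts by (simp add: i K_def F_def)
        then show ?thesis using True by (simp add: i K_def norm_minus_commute)
      next
        case False
        then have "integral (K i) g = F t - F s"
          using integral_increment[OF g, of s t] ts by (simp add: i K_def F_def)
        moreover have m: "measure lborel (K i) = t - s" using False by (simp add: i K_def)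
        ultimately have "measure lborel (K i) *\<^sub>R g (fst i) - integral (K i) g = F s - F t - (s - t) *\<^sub>R g t"
          unfolding m by (simp add: i algebra_simps)
        then show ?thesis by simp
      qed
      moreover have "measure lebesgue (K i) = \<bar>s - t\<bar>" by (cases "t \<le> s") (simp_all add: i K_def)
      ultimately show "c * measure lebesgue (K i) \<le> norm (measure lborel (K i) *\<^sub>R g (fst i) - integral (K i) g)"
        using ts(5) by simp
    qed
    also have "\<dots> = (\<Sum>(x,k)\<in>p. norm (measure lborel k *\<^sub>R g x - integral k g))"
      unfolding p_def by (subst sum.reindex[OF inj]) simp
    also have "\<dots> < e * c" by (rule hen[OF p fine])
    finally have "(\<Sum>i\<in>J. measure lebesgue (K i)) < e"
      using \<open>c > 0\<close> by (simp add: mult.commute flip: sum_distrib_left)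
    moreover have "measure lebesgue (\<Union>i\<in>J. K i) \<le> (\<Sum>i\<in>J. measure lebesgue (K i))"
      using J(2) by (intro measure_UNION_le) (auto simp: K_def split: prod.splits)
    ultimately show ?thesis by (simp add: Kcb)
  qed
  have lm: "(\<Union>i\<in>D. cball (cen i) (rad i)) \<in> lmeasurable"
    by (rule fmeasurable_UN_bound[OF D(1) _ bound]) auto
  have le: "measure lebesgue (\<Union>i\<in>D. cball (cen i) (rad i)) \<le> e"
    by (rule measure_UN_bound[OF D(1) _ bound]) auto
  let ?R = "?B - (\<Union>i \<in> D. cball (cen i) (rad i))"
  let ?T = "?R \<union> (\<Union>i\<in>D. cball (cen i) (rad i))"
  have R: "?R \<in> null_sets lebesgue" using D(4) by (simp add: negligible_iff_null_sets)
  have "?T \<in> lmeasurable" using lm R by (intro fmeasurable.Un) (auto simp: null_sets_def fmeasurable_def)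
  moreover have "measure lebesgue ?T \<le> e"
    using measure_Un_null_set[OF fmeasurableD[OF lm] R] le by (subst Un_commute) (simp del: Un_Diff_cancel)
  ultimately show "\<exists>T. ?B \<subseteq> T \<and> T \<in> lmeasurable \<and> measure lebesgue T \<le> e"
    by (intro exI[of _ ?T]) blast
qed

theorem integral_has_vector_derivative_ae:
  fixes g :: "real \<Rightarrow> 'a::euclidean_space"
  assumes g: "g integrable_on {a..b}"
  shows "\<exists>N. negligible N \<and> (\<forall>t\<in>{a..b} - N.
           ((\<lambda>t. integral {a..t} g) has_vector_derivative g t) (at t within {a..b}))"
proof -
  define F where "F = (\<lambda>t. integral {a..t} g)"
  define B where "B = (\<lambda>j::nat. {t \<in> {a<..<b}. \<forall>d>0. \<exists>s\<in>{a<..<b}. s \<noteq> t \<and> \<bar>s - t\<bar> < d \<and>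
            norm (F s - F t - (s - t) *\<^sub>R g t) > inverse (real (Suc j)) * \<bar>s - t\<bar>})"
  define N where "N = (\<Union>j. B j) \<union> {a, b}"
  have "negligible (B j)" for j
    unfolding B_def F_def by (rule negligible_bad_difference_quotients[OF g]) simp
  then have "negligible N" unfolding N_def by (intro negligible_Un negligible_countable_Union) auto
  moreover have "(F has_vector_derivative g t) (at t within {a..b})" if t: "t \<in> {a..b} - N" for t
    unfolding has_vector_derivative_def has_derivative_within_alt
  proof (intro conjI allI impI)
    show "bounded_linear (\<lambda>x. x *\<^sub>R g t)" by (rule bounded_linear_scaleR_left)
    fix e :: real assume "e > 0"
    then obtain j where j: "inverse (real (Suc j)) < e" using reals_Archimedean by blast
    have tab: "a < t" "t < b" and "t \<notin> B j" using t by (auto simp: N_def)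
    then obtain d where d: "d > 0" "\<And>s. \<lbrakk>s \<in> {a<..<b}; s \<noteq> t; \<bar>s - t\<bar> < d\<rbrakk> \<Longrightarrow>
        norm (F s - F t - (s - t) *\<^sub>R g t) \<le> inverse (real (Suc j)) * \<bar>s - t\<bar>"
      unfolding B_def mem_Collect_eq not_less[symmetric] using greaterThanLessThan_iff by blast
    define d' where "d' = min d (min (t - a) (b - t))"
    have "d' > 0" using d tab by (simp add: d'_def)
    moreover have "norm (F y - F t - (y - t) *\<^sub>R g t) \<le> e * norm (y - t)"
      if "y \<in> {a..b}" "norm (y - t) < d'" for y
    proof (cases "y = t")
      case False
      have "norm (F y - F t - (y - t) *\<^sub>R g t) \<le> inverse (real (Suc j)) * \<bar>y - t\<bar>"
        by (rule d(2)) (use that False in \<open>auto simp: d'_def\<close>)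
      also have "\<dots> \<le> e * norm (y - t)" using j by (intro mult_mono) (auto simp: less_imp_le[OF \<open>e > 0\<close>])
      finally show ?thesis .
    qed auto
    ultimately show "\<exists>d>0. \<forall>y\<in>{a..b}. norm (y - t) < d \<longrightarrow>
         norm (F y - F t - (y - t) *\<^sub>R g t) \<le> e * norm (y - t)" by blast
  qed
  ultimately show ?thesis unfolding F_def by blast
qed

text \<open>
  Truncation at height n splits an integrable function into a bounded part and an excess with small
  integral; this is what makes the indefinite integral absolutely continuous.
\<close>

lemma small_integral_of_excess:
  fixes h :: "real \<Rightarrow> real"
  assumes h: "set_integrable lebesgue S h" and "e > 0"
  shows "\<exists>n::nat. (LINT x:S|lebesgue. max 0 (h x - real n)) < e"
proof -
  have "(\<lambda>n::nat. LINT x|lebesgue. indicator S x *\<^sub>R max 0 (indicator S x *\<^sub>R h x - real n)) \<longlonglongrightarrow> integral\<^sup>L lebesgue (\<lambda>x::real. 0::real)"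
  proof (rule Bochner_Integration.integral_dominated_convergence
      [where M=lebesgue and w="\<lambda>x. norm (indicator S x *\<^sub>R h x)"])
    have m: "(\<lambda>x. indicator S x *\<^sub>R h x) \<in> borel_measurable lebesgue"
      using h unfolding set_integrable_def by (rule borel_measurable_integrable)
    have eq: "(\<lambda>x. indicator S x *\<^sub>R max 0 (indicator S x *\<^sub>R h x - real i)) =
        (\<lambda>x. max 0 (indicator S x *\<^sub>R h x - real i))" for i
      by (auto simp: indicator_def)
    show "(\<lambda>x. indicator S x *\<^sub>R max 0 (indicator S x *\<^sub>R h x - real i)) \<in> borel_measurable lebesgue" for i
      unfolding eq using m by (intro borel_measurable_max borel_measurable_diff) auto
    show "integrable lebesgue (\<lambda>x. norm (indicator S x *\<^sub>R h x))"
      using h unfolding set_integrable_def by (rule integrable_norm)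
    show "AE x in lebesgue. (\<lambda>i. indicator S x *\<^sub>R max 0 (indicator S x *\<^sub>R h x - real i)) \<longlonglongrightarrow> 0"
    proof (rule AE_I2)
      fix x
      obtain N :: nat where N: "h x \<le> real N" using real_arch_simple by blast
      have "\<forall>\<^sub>F i in sequentially. indicator S x *\<^sub>R max 0 (indicator S x *\<^sub>R h x - real i) = 0"
        using N by (intro eventually_sequentiallyI[of N]) (auto simp: indicator_def)
      then show "(\<lambda>i. indicator S x *\<^sub>R max 0 (indicator S x *\<^sub>R h x - real i)) \<longlonglongrightarrow> 0"
        by (rule tendsto_eventually)
    qed
  qed (auto simp: indicator_def)
  moreover have "(LINT x:S|lebesgue. max 0 (h x - real n)) =
      (LINT x|lebesgue. indicator S x *\<^sub>R max 0 (indicator S x *\<^sub>R h x - real n))" for n :: nat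
    unfolding set_lebesgue_integral_def
    by (rule Bochner_Integration.integral_cong) (auto simp: indicator_def)
  ultimately have "(\<lambda>n::nat. LINT x:S|lebesgue. max 0 (h x - real n)) \<longlonglongrightarrow> 0"
    by simp
  from eventually_happens'[OF sequentially_bot order_tendstoD(2)[OF this \<open>e > 0\<close>]] show ?thesis .
qed

theorem absolutely_continuous_on_integral:
  fixes g :: "real \<Rightarrow> 'a::euclidean_space"
  assumes g: "set_integrable lebesgue {a..b} g"
  shows "absolutely_continuous_on a b (\<lambda>t. integral {a..t} g)"
  unfolding absolutely_continuous_on_iff
proof (intro allI impI)
  fix e :: real assume "e > 0"
  define h where "h = (\<lambda>x. norm (g x))"
  have h: "set_integrable lebesgue {a..b} h" unfolding h_def using g by (rule set_integrable_norm)
  obtain n :: nat where n: "(LINT x:{a..b}|lebesgue. max 0 (h x - real n)) < e / 2"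
    using small_integral_of_excess[OF h, of "e / 2"] \<open>e > 0\<close> by auto
  define w where "w = (\<lambda>x. max 0 (h x - real n))"
  have w: "set_integrable lebesgue {a..b} w"
  proof (rule set_integrable_bound[OF h])
    have "h \<in> borel_measurable (lebesgue_on {a..b})"
      using set_lebesgue_integral_eq_integral(1)[OF h] by (rule integrable_imp_measurable)
    then have "w \<in> borel_measurable (lebesgue_on {a..b})"
      unfolding w_def by (intro borel_measurable_max borel_measurable_diff) auto
    then show "set_borel_measurable lebesgue {a..b} w"
      by (simp add: set_borel_measurable_def borel_measurable_restrict_space_iff)
    show "AE x in lebesgue. x \<in> {a..b} \<longrightarrow> norm (w x) \<le> norm (h x)"
      by (rule AE_I2) (auto simp: w_def h_def)
  qed
  note gi = set_lebesgue_integral_eq_integral(1)[OF g]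
  note hi = set_lebesgue_integral_eq_integral(1)[OF h]
  note wi = set_lebesgue_integral_eq_integral(1)[OF w]
  define \<delta> where "\<delta> = e / (2 * (real n + 1))"
  have "\<delta> > 0" using \<open>e > 0\<close> by (simp add: \<delta>_def)
  moreover have "(\<Sum>(s, t)\<in>P. norm (integral {a..t} g - integral {a..s} g)) < e"
    if short: "short_intervals a b \<delta> P" for P
  proof -
    have P: "finite P" "\<forall>(s, t)\<in>P. a \<le> s \<and> s \<le> t \<and> t \<le> b"
      "disjoint_family_on (\<lambda>(s, t). {s<..<t}) P" "(\<Sum>(s, t)\<in>P. t - s) < \<delta>"
      using short by (auto simp: short_intervals_def)
    have step: "norm (integral {a..t} g - integral {a..s} g)
        \<le> real n * (t - s) + (LINT x:{s<..<t}|lebesgue. w x)" if "(s, t) \<in> P" for s t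
    proof -
      have st: "a \<le> s" "s \<le> t" "t \<le> b" using P(2) that by auto
      have sub: "{s..t} \<subseteq> {a..b}" using st by auto
      have "norm (integral {a..t} g - integral {a..s} g) = norm (integral {s..t} g)"
        using integral_increment[OF gi st] by simp
      also have "\<dots> \<le> integral {s..t} (\<lambda>x. real n + w x)"
        using sub by (intro integral_norm_bound_integral integrable_on_subinterval[OF gi]
            integrable_add integrable_on_subinterval[OF wi]) (auto simp: w_def h_def)
      also have "\<dots> = real n * (t - s) + integral {s..t} w"
        using sub st by (subst Henstock_Kurzweil_Integration.integral_add)
           (auto intro!: integrable_on_subinterval[OF wi])
      also have "integral {s..t} w = integral {s<..<t} w"
        using integral_open_interval_real[of s t w] by simp
      also have "\<dots> = (LINT x:{s<..<t}|lebesgue. w x)"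
        using sub by (intro set_lebesgue_integral_eq_integral(2)[symmetric] set_integrable_subset[OF w]) auto
      finally show ?thesis .
    qed
    have "(\<Sum>(s, t)\<in>P. norm (integral {a..t} g - integral {a..s} g))
        \<le> (\<Sum>(s, t)\<in>P. real n * (t - s) + (LINT x:{s<..<t}|lebesgue. w x))"
      using step by (intro sum_mono) auto
    also have "\<dots> = real n * (\<Sum>(s, t)\<in>P. t - s) + (\<Sum>(s, t)\<in>P. LINT x:{s<..<t}|lebesgue. w x)"
      by (simp add: case_prod_unfold sum.distrib sum_distrib_left)
    also have "(\<Sum>(s, t)\<in>P. LINT x:{s<..<t}|lebesgue. w x)
        = (\<Sum>p\<in>P. LINT x:(case p of (s, t) \<Rightarrow> {s<..<t})|lebesgue. w x)"
      by (intro sum.cong) auto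
    also have "\<dots> = (LINT x:(\<Union>p\<in>P. case p of (s, t) \<Rightarrow> {s<..<t})|lebesgue. w x)"
      using P by (intro set_integral_finite_Union[symmetric] set_integrable_subset[OF w])
         (auto split: prod.splits)
    also have "\<dots> \<le> (LINT x:{a..b}|lebesgue. w x)"
    proof -
      have sub: "(\<Union>p\<in>P. case p of (s, t) \<Rightarrow> {s<..<t}) \<subseteq> {a..b}" using P(2) by fastforce
      have "set_integrable lebesgue (\<Union>p\<in>P. case p of (s, t) \<Rightarrow> {s<..<t}) w"
        using P(1) sub by (intro set_integrable_subset[OF w] sets.finite_UN) (auto split: prod.splits)
      from set_lebesgue_integral_eq_integral[OF this] set_lebesgue_integral_eq_integral[OF w] sub
      show ?thesis by (auto intro!: integral_subset_le simp: w_def)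
    qed
    also have "real n * (\<Sum>(s, t)\<in>P. t - s) \<le> real n * \<delta>"
      using P(4) by (intro mult_left_mono) auto
    also have "\<dots> \<le> e / 2" using \<open>e > 0\<close> by (simp add: \<delta>_def field_simps)
    finally show ?thesis using n by (simp add: w_def)
  qed
  ultimately show "\<exists>\<delta>>0. \<forall>P. short_intervals a b \<delta> P \<longrightarrow>
        (\<Sum>(s, t)\<in>P. norm (integral {a..t} g - integral {a..s} g)) < e"
    by (intro exI[of _ \<delta>]) auto
qed

section \<open>Calculus of absolutely continuous functions and Gronwall estimates\<close>

lemma locally_integrable_set_integrable:
  assumes "locally_integrable k" "0 \<le> s"
  shows "set_integrable lebesgue {s..t} k"
proof (cases "s \<le> t")
  case True
  then have "set_integrable lebesgue {0..t} k" using assms by (simp add: locally_integrable_def)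
  then show ?thesis by (rule set_integrable_subset) (use assms in auto)
qed (simp add: set_integrable_def)

lemma locally_integrable_integrable_on:
  "locally_integrable k \<Longrightarrow> 0 \<le> s \<Longrightarrow> k integrable_on {s..t}"
  by (intro set_lebesgue_integral_eq_integral(1) locally_integrable_set_integrable)

lemma absolutely_continuous_on_subinterval:
  assumes "absolutely_continuous_on a b x" "a \<le> c" "d \<le> b"
  shows "absolutely_continuous_on c d x"
  unfolding absolutely_continuous_on_iff
proof (intro allI impI)
  fix e :: real assume "e > 0"
  from absolutely_continuous_onE[OF assms(1) this]
  obtain \<delta> where "\<delta> > 0" and \<delta>: "\<And>P. short_intervals a b \<delta> P \<Longrightarrow> (\<Sum>(s, t)\<in>P. norm (x t - x s)) < e"
    by blast
  show "\<exists>\<delta>>0. \<forall>P. short_intervals c d \<delta> P \<longrightarrow> (\<Sum>(s, t)\<in>P. norm (x t - x s)) < e"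
    using assms(2,3) \<open>\<delta> > 0\<close>
    by (intro exI[of _ \<delta>] conjI allI impI \<delta>) (auto simp: short_intervals_def)
qed

lemma absolutely_continuous_on_imp_continuous_on:
  assumes "absolutely_continuous_on a b x"
  shows "continuous_on {a..b} x"
  unfolding continuous_on_iff
proof (intro ballI allI impI)
  fix t e :: real assume t: "t \<in> {a..b}" and "e > 0"
  from absolutely_continuous_onE[OF assms \<open>e > 0\<close>]
  obtain \<delta> where "\<delta> > 0" and \<delta>: "\<And>P. short_intervals a b \<delta> P \<Longrightarrow> (\<Sum>(s, t)\<in>P. norm (x t - x s)) < e"
    by blast
  have "dist (x s) (x t) < e" if "s \<in> {a..b}" "dist s t < \<delta>" for s
    using \<delta>[of "{(min s t, max s t)}"] that t
    by (cases "s \<le> t") (auto simp: short_intervals_def disjoint_family_on_def dist_norm norm_minus_commute)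
  then show "\<exists>d>0. \<forall>s\<in>{a..b}. dist s t < d \<longrightarrow> dist (x s) (x t) < e"
    using \<open>\<delta> > 0\<close> by blast
qed

lemma absolutely_continuous_on_bounded:
  assumes "absolutely_continuous_on a b x"
  obtains B where "B > 0" "\<And>t. t \<in> {a..b} \<Longrightarrow> norm (x t) \<le> B"
proof -
  have "bounded (x ` {a..b})"
    using absolutely_continuous_on_imp_continuous_on[OF assms] compact_continuous_image
    by (blast intro: compact_imp_bounded)
  then show ?thesis using that unfolding bounded_pos by auto
qed

text \<open>
  All closure properties of absolute continuity below are instances: sums, products and compositions
  with locally Lipschitz functions have increments that are dominated by those of their constituents.
\<close>

lemma absolutely_continuous_on_dominated:
  fixes x :: "real \<Rightarrow> 'a::real_normed_vector" and y :: "real \<Rightarrow> 'b::real_normed_vector"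
    and z :: "real \<Rightarrow> 'c::real_normed_vector"
  assumes y: "absolutely_continuous_on a b y" and z: "absolutely_continuous_on a b z"
    and le: "\<And>s t. \<lbrakk>a \<le> s; s \<le> t; t \<le> b\<rbrakk> \<Longrightarrow>
        norm (x t - x s) \<le> c * norm (y t - y s) + c * norm (z t - z s)"
  shows "absolutely_continuous_on a b x"
  unfolding absolutely_continuous_on_iff
proof (intro allI impI)
  fix e :: real assume "e > 0"
  define e' where "e' = e / (2 * (\<bar>c\<bar> + 1))"
  have "e' > 0" using \<open>e > 0\<close> by (simp add: e'_def)
  from absolutely_continuous_onE[OF y \<open>e' > 0\<close>]
  obtain \<delta>1 where "\<delta>1 > 0" and \<delta>1: "\<And>P. short_intervals a b \<delta>1 P \<Longrightarrow> (\<Sum>(s, t)\<in>P. norm (y t - y s)) < e'"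
    by blast
  from absolutely_continuous_onE[OF z \<open>e' > 0\<close>]
  obtain \<delta>2 where "\<delta>2 > 0" and \<delta>2: "\<And>P. short_intervals a b \<delta>2 P \<Longrightarrow> (\<Sum>(s, t)\<in>P. norm (z t - z s)) < e'"
    by blast
  have "(\<Sum>(s, t)\<in>P. norm (x t - x s)) < e"
    if "short_intervals a b (min \<delta>1 \<delta>2) P" for P
  proof -
    have P: "short_intervals a b \<delta>1 P" "short_intervals a b \<delta>2 P"
      using that by (auto simp: short_intervals_def)
    have "(\<Sum>(s, t)\<in>P. norm (x t - x s))
        \<le> (\<Sum>(s, t)\<in>P. \<bar>c\<bar> * norm (y t - y s) + \<bar>c\<bar> * norm (z t - z s))"
    proof (rule sum_mono, clarify)
      fix s t assume "(s, t) \<in> P"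
      then have "norm (x t - x s) \<le> c * norm (y t - y s) + c * norm (z t - z s)"
        using P(1) le unfolding short_intervals_def by blast
      also have "\<dots> \<le> \<bar>c\<bar> * norm (y t - y s) + \<bar>c\<bar> * norm (z t - z s)"
        by (intro add_mono mult_right_mono) auto
      finally show "norm (x t - x s) \<le> \<bar>c\<bar> * norm (y t - y s) + \<bar>c\<bar> * norm (z t - z s)" .
    qed
    also have "\<dots> = \<bar>c\<bar> * (\<Sum>(s, t)\<in>P. norm (y t - y s)) + \<bar>c\<bar> * (\<Sum>(s, t)\<in>P. norm (z t - z s))"
      by (simp add: case_prod_unfold sum.distrib sum_distrib_left)
    also have "\<dots> \<le> \<bar>c\<bar> * e' + \<bar>c\<bar> * e'"
      using \<delta>1[OF P(1)] \<delta>2[OF P(2)] by (intro add_mono mult_left_mono) auto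
    also have "\<dots> < 2 * (\<bar>c\<bar> + 1) * e'" using \<open>e' > 0\<close> by (simp add: algebra_simps)
    also have "\<dots> = e" by (simp add: e'_def)
    finally show ?thesis .
  qed
  then show "\<exists>\<delta>>0. \<forall>P. short_intervals a b \<delta> P \<longrightarrow> (\<Sum>(s, t)\<in>P. norm (x t - x s)) < e"
    using \<open>\<delta>1 > 0\<close> \<open>\<delta>2 > 0\<close> by (intro exI[of _ "min \<delta>1 \<delta>2"]) auto
qed

lemma absolutely_continuous_on_diff:
  assumes "absolutely_continuous_on a b x" "absolutely_continuous_on a b y"
  shows "absolutely_continuous_on a b (\<lambda>t. x t - y t)"
proof (rule absolutely_continuous_on_dominated[OF assms, where c = 1])
  fix s t
  have "(x t - y t) - (x s - y s) = (x t - x s) - (y t - y s)" by simp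
  then show "norm ((x t - y t) - (x s - y s)) \<le> 1 * norm (x t - x s) + 1 * norm (y t - y s)"
    using norm_triangle_ineq4 by (metis mult_1)
qed

lemma (in bounded_linear) absolutely_continuous_on:
  assumes "absolutely_continuous_on a b x"
  shows "absolutely_continuous_on a b (\<lambda>t. f (x t))"
proof -
  obtain K where K: "\<And>v. norm (f v) \<le> norm v * K" using bounded by blast
  show ?thesis
  proof (rule absolutely_continuous_on_dominated[OF assms assms, where c = "K / 2"])
    show "norm (f (x t) - f (x s)) \<le> K / 2 * norm (x t - x s) + K / 2 * norm (x t - x s)" for s t
      using K[of "x t - x s"] by (simp add: diff mult.commute)
  qed
qed

lemma (in bounded_bilinear) absolutely_continuous_on:
  assumes x: "absolutely_continuous_on a b x" and y: "absolutely_continuous_on a b y"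
  shows "absolutely_continuous_on a b (\<lambda>t. prod (x t) (y t))"
proof -
  obtain K where K: "K > 0" "\<And>v w. norm (prod v w) \<le> norm v * norm w * K" using pos_bounded by blast
  obtain B where B: "B > 0" "\<And>t. t \<in> {a..b} \<Longrightarrow> norm (x t) \<le> B"
    using absolutely_continuous_on_bounded[OF x] by blast
  obtain D where D: "D > 0" "\<And>t. t \<in> {a..b} \<Longrightarrow> norm (y t) \<le> D"
    using absolutely_continuous_on_bounded[OF y] by blast
  show ?thesis
  proof (rule absolutely_continuous_on_dominated[OF x y, where c = "K * (B + D)"])
    fix s t assume st: "a \<le> s" "s \<le> t" "t \<le> b"
    have "prod (x t) (y t) - prod (x s) (y s) = prod (x t - x s) (y t) + prod (x s) (y t - y s)"
      by (simp add: diff_left diff_right)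
    also have "norm \<dots> \<le> norm (x t - x s) * norm (y t) * K + norm (x s) * norm (y t - y s) * K"
      by (intro norm_triangle_mono K)
    also have "\<dots> \<le> norm (x t - x s) * (B + D) * K + (B + D) * norm (y t - y s) * K"
    proof -
      have "norm (y t) \<le> D" "norm (x s) \<le> B" using D(2)[of t] B(2)[of s] st by auto
      then have "norm (y t) \<le> B + D" "norm (x s) \<le> B + D" using B(1) D(1) by auto
      then show ?thesis using K(1) by (intro add_mono mult_right_mono mult_left_mono) auto
    qed
    also have "\<dots> = K * (B + D) * norm (x t - x s) + K * (B + D) * norm (y t - y s)"
      by (simp add: algebra_simps)
    finally show "norm (prod (x t) (y t) - prod (x s) (y s))
        \<le> K * (B + D) * norm (x t - x s) + K * (B + D) * norm (y t - y s)" .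
  qed
qed

lemma absolutely_continuous_on_exp:
  fixes \<phi> :: "real \<Rightarrow> real"
  assumes "absolutely_continuous_on a b \<phi>"
  shows "absolutely_continuous_on a b (\<lambda>t. exp (\<phi> t))"
proof -
  obtain B where B: "B > 0" "\<And>t. t \<in> {a..b} \<Longrightarrow> norm (\<phi> t) \<le> B"
    using absolutely_continuous_on_bounded[OF assms] by blast
  have mono: "exp p - exp q \<le> exp B * (p - q)" if "q \<le> p" "p \<le> B" for p q :: real
  proof -
    have "exp p * (1 - exp (q - p)) \<le> exp B * (p - q)"
    proof (intro mult_mono)
      show "1 - exp (q - p) \<le> p - q" using exp_ge_add_one_self[of "q - p"] by linarith
    qed (use that in auto)
    then show ?thesis by (simp add: algebra_simps flip: exp_add)
  qed
  show ?thesis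
  proof (rule absolutely_continuous_on_dominated[OF assms assms, where c = "exp B / 2"])
    fix s t assume "a \<le> s" "s \<le> t" "t \<le> b"
    then have "\<phi> s \<le> B" "\<phi> t \<le> B" using B(2)[of s] B(2)[of t] by auto
    then show "norm (exp (\<phi> t) - exp (\<phi> s)) \<le> exp B / 2 * norm (\<phi> t - \<phi> s) + exp B / 2 * norm (\<phi> t - \<phi> s)"
      using mono[of "\<phi> s" "\<phi> t"] mono[of "\<phi> t" "\<phi> s"] by (cases "\<phi> s \<le> \<phi> t") (auto simp: abs_if)
  qed
qed

lemma set_integrable_mult_continuous:
  fixes k u :: "real \<Rightarrow> real"
  assumes "set_integrable lebesgue {a..b} k" "continuous_on {a..b} u"
  shows "set_integrable lebesgue {a..b} (\<lambda>t. k t * u t)"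
proof -
  have "(\<lambda>t. u t * k t) absolutely_integrable_on {a..b}"
  proof (rule absolutely_integrable_bounded_measurable_product_real)
    show "u \<in> borel_measurable (lebesgue_on {a..b})"
      using assms(2) by (rule continuous_imp_measurable_on_sets_lebesgue) auto
    show "bounded (u ` {a..b})"
      using assms(2) by (intro compact_imp_bounded compact_continuous_image) auto
  qed (use assms in auto)
  then show ?thesis by (simp add: mult.commute)
qed

lemma integral_norm_bound_ae:
  fixes h :: "'n::euclidean_space \<Rightarrow> 'a::banach"
  assumes h: "h integrable_on S" and g: "g integrable_on S" and N: "negligible N"
    and le: "\<And>x. x \<in> S - N \<Longrightarrow> norm (h x) \<le> g x"
  shows "norm (integral S h) \<le> integral S g"
proof -
  define h' where "h' = (\<lambda>x. if x \<in> N then 0 else h x)"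
  define g' where "g' = (\<lambda>x. if x \<in> N then 0 else g x)"
  have "norm (integral S h') \<le> integral S g'"
  proof (rule Henstock_Kurzweil_Integration.integral_norm_bound_integral)
    show "h' integrable_on S" by (rule integrable_spike[OF h N]) (auto simp: h'_def)
    show "g' integrable_on S" by (rule integrable_spike[OF g N]) (auto simp: g'_def)
  qed (use le in \<open>auto simp: h'_def g'_def\<close>)
  moreover have "integral S h' = integral S h" by (rule integral_spike[OF N]) (auto simp: h'_def)
  moreover have "integral S g' = integral S g" by (rule integral_spike[OF N]) (auto simp: g'_def)
  ultimately show ?thesis by simp
qed

text \<open>
  Let v be the integral on the right-hand side and K the integral of k. Then (c + v) exp(-K) is
  absolutely continuous with derivative k (u - (c + v)) exp(-K) almost everywhere. The hypothesis
  makes this nonpositive, so the function does not exceed its initial value c.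
\<close>

lemma gronwall_integral:
  fixes u k :: "real \<Rightarrow> real"
  assumes k: "locally_integrable k" "\<And>t. 0 \<le> k t"
    and u: "continuous_on {0..T} u"
    and le: "\<And>t. t \<in> {0..T} \<Longrightarrow> u t \<le> c + integral {0..t} (\<lambda>s. k s * u s)"
    and t: "t \<in> {0..T}"
  shows "u t \<le> c * exp (integral {0..t} k)"
proof -
  have ki: "set_integrable lebesgue {0..T} k" by (rule locally_integrable_set_integrable[OF k(1)]) simp
  have kui: "set_integrable lebesgue {0..T} (\<lambda>s. k s * u s)"
    by (rule set_integrable_mult_continuous[OF ki u])
  define v where "v = (\<lambda>t. integral {0..t} (\<lambda>s. k s * u s))"
  define K where "K = (\<lambda>t. integral {0..t} k)"
  obtain N1 where N1: "negligible N1" "\<And>t. t \<in> {0..T} - N1 \<Longrightarrow>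
      (v has_vector_derivative k t * u t) (at t within {0..T})"
    using integral_has_vector_derivative_ae[OF set_lebesgue_integral_eq_integral(1)[OF kui]]
    unfolding v_def by blast
  obtain N2 where N2: "negligible N2" "\<And>t. t \<in> {0..T} - N2 \<Longrightarrow>
      (K has_vector_derivative k t) (at t within {0..T})"
    using integral_has_vector_derivative_ae[OF set_lebesgue_integral_eq_integral(1)[OF ki]]
    unfolding K_def by blast
  define w where "w = (\<lambda>t. (c + v t) * exp (- K t))"
  have acv: "absolutely_continuous_on 0 T v" unfolding v_def by (rule absolutely_continuous_on_integral[OF kui])
  have acK: "absolutely_continuous_on 0 T K" unfolding K_def by (rule absolutely_continuous_on_integral[OF ki])
  have acv': "absolutely_continuous_on 0 T (\<lambda>t. c + v t)"
    by (rule absolutely_continuous_on_dominated[OF acv acv, where c = 1]) auto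
  have acK': "absolutely_continuous_on 0 T (\<lambda>t. - K t)"
    by (rule absolutely_continuous_on_dominated[OF acK acK, where c = 1]) (auto simp: abs_minus_commute)
  have "absolutely_continuous_on 0 T w" unfolding w_def
    by (intro bounded_bilinear.absolutely_continuous_on[OF bounded_bilinear_mult]
        absolutely_continuous_on_exp acv' acK')
  then have acw: "absolutely_continuous_on 0 t w"
    by (rule absolutely_continuous_on_subinterval) (use t in auto)
  have "((\<lambda>s. k s * (u s - (c + v s)) * exp (- K s)) has_integral w t - w 0) {0..t}"
  proof (rule absolutely_continuous_has_integral[OF _ acw negligible_Un[OF N1(1) N2(1)]])
    fix s assume s: "s \<in> {0..t}" "s \<notin> N1 \<union> N2"
    have "(w has_vector_derivative ((c + v s) * (- k s * exp (- K s)) + k s * u s * exp (- K s))) (at s within {0..T})"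
      unfolding w_def
      using N1(2)[of s] N2(2)[of s] s t
      by (intro has_vector_derivative_mult)
         (auto intro!: derivative_eq_intros simp: has_real_derivative_iff_has_vector_derivative[symmetric])
    then have "(w has_vector_derivative k s * (u s - (c + v s)) * exp (- K s)) (at s within {0..T})"
      by (simp add: algebra_simps)
    then show "(w has_vector_derivative k s * (u s - (c + v s)) * exp (- K s)) (at s within {0..t})"
      by (rule has_vector_derivative_within_subset) (use t in auto)
  qed (use t in auto)
  then have "w t - w 0 \<le> 0"
  proof (rule has_integral_le[OF _ has_integral_0])
    fix s assume "s \<in> {0..t}"
    then have "u s \<le> c + v s" using le[of s] t by (simp add: v_def)
    then show "k s * (u s - (c + v s)) * exp (- K s) \<le> 0"
      using k(2)[of s] by (simp add: mult_nonneg_nonpos mult_nonpos_nonneg)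
  qed
  then have "(c + v t) * exp (- K t) \<le> c" by (simp add: w_def v_def K_def)
  then have "c + v t \<le> c * exp (K t)" by (simp add: exp_minus field_simps)
  then show ?thesis using le[OF t] by (simp add: v_def K_def)
qed

text \<open>
  This form is applied to differences of solutions, to solutions themselves and to the remainder of
  the linearised flow; the inhomogeneity m is what makes it fit the last two cases.
\<close>

theorem gronwall_differential:
  fixes e :: "real \<Rightarrow> 'a::euclidean_space"
  assumes ac: "absolutely_continuous_on 0 T e"
    and k: "locally_integrable k" "\<And>t. 0 \<le> k t" and m: "locally_integrable m" "\<And>t. 0 \<le> m t"
    and N: "negligible N"
    and der: "\<And>t. \<lbrakk>t \<in> {0..T}; t \<notin> N\<rbrakk> \<Longrightarrow> (e has_vector_derivative d t) (at t within {0..T})"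
    and le: "\<And>t. \<lbrakk>t \<in> {0..T}; t \<notin> N\<rbrakk> \<Longrightarrow> norm (d t) \<le> k t * norm (e t) + m t"
    and t: "t \<in> {0..T}"
  shows "norm (e t) \<le> (norm (e 0) + integral {0..T} m) * exp (integral {0..T} k)"
proof -
  have cont: "continuous_on {0..T} (\<lambda>t. norm (e t))"
    by (intro continuous_intros absolutely_continuous_on_imp_continuous_on[OF ac])
  have ki: "set_integrable lebesgue {0..T} (\<lambda>s. k s * norm (e s))"
    by (intro set_integrable_mult_continuous locally_integrable_set_integrable[OF k(1)] cont) simp
  have bound: "norm (e t) \<le> (norm (e 0) + integral {0..T} m) + integral {0..t} (\<lambda>s. k s * norm (e s))"
    if t: "t \<in> {0..T}" for t
  proof -
    have ki': "(\<lambda>s. k s * norm (e s)) integrable_on {0..t}"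
      by (rule integrable_on_subinterval[OF set_lebesgue_integral_eq_integral(1)[OF ki]]) (use t in auto)
    have mi: "m integrable_on {0..t}" using m(1) by (rule locally_integrable_integrable_on) simp
    have mT: "m integrable_on {0..T}" using m(1) by (rule locally_integrable_integrable_on) simp
    have "(d has_integral e t - e 0) {0..t}"
    proof (rule absolutely_continuous_has_integral[OF _ _ N])
      show "absolutely_continuous_on 0 t e"
        using ac by (rule absolutely_continuous_on_subinterval) (use t in auto)
      show "(e has_vector_derivative d s) (at s within {0..t})" if "s \<in> {0..t}" "s \<notin> N" for s
        using der[of s] by (rule has_vector_derivative_within_subset) (use t that in auto)
    qed (use t in auto)
    then have d: "d integrable_on {0..t}" "integral {0..t} d = e t - e 0"
      by (auto simp: integral_unique has_integral_integrable)
    have "norm (integral {0..t} d) \<le> integral {0..t} (\<lambda>s. k s * norm (e s) + m s)"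
      by (rule integral_norm_bound_ae[OF d(1) integrable_add[OF ki' mi] N]) (use le t in auto)
    also have "\<dots> = integral {0..t} (\<lambda>s. k s * norm (e s)) + integral {0..t} m"
      using ki' mi by (rule Henstock_Kurzweil_Integration.integral_add)
    also have "integral {0..t} m \<le> integral {0..T} m"
      using mi mT t m(2) by (intro integral_subset_le) auto
    finally have "norm (e t - e 0) \<le> integral {0..t} (\<lambda>s. k s * norm (e s)) + integral {0..T} m"
      by (simp add: d(2))
    moreover have "norm (e t) \<le> norm (e 0) + norm (e t - e 0)"
      using norm_triangle_ineq[of "e 0" "e t - e 0"] by simp
    ultimately show ?thesis by simp
  qed
  have kT: "k integrable_on {0..T}" and kt: "k integrable_on {0..t}"
    using k(1) by (auto intro: locally_integrable_integrable_on)
  have "norm (e t) \<le> (norm (e 0) + integral {0..T} m) * exp (integral {0..t} k)"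
    by (rule gronwall_integral[OF k cont bound t])
  also have "\<dots> \<le> (norm (e 0) + integral {0..T} m) * exp (integral {0..T} k)"
    using t k(2) m(2) kT kt
    by (intro mult_left_mono add_nonneg_nonneg integral_subset_le Henstock_Kurzweil_Integration.integral_nonneg)
       (auto intro!: integral_subset_le Henstock_Kurzweil_Integration.integral_nonneg locally_integrable_integrable_on[OF m(1)])
  finally show ?thesis .
qed

section \<open>Existence of Caratheodory solutions\<close>

lemma solves_absolutely_continuous_on:
  "solves g x \<Longrightarrow> 0 \<le> T \<Longrightarrow> absolutely_continuous_on 0 T x"
  by (simp add: solves_def)

lemma solves_continuous_on:
  assumes "solves g x" shows "continuous_on {0..} x"
proof -
  have "continuous (at t within {0..}) x" if t: "t \<ge> 0" for t
  proof -
    have "continuous_on {0..t + 1} x"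
      using assms t by (intro absolutely_continuous_on_imp_continuous_on solves_absolutely_continuous_on) auto
    then have "continuous (at t within {0..t + 1}) x"
      using t by (auto simp: continuous_on_eq_continuous_within)
    moreover have "at t within {0..t + 1} = at t within {0..}"
      using t by (intro at_within_nhd[of _ "{..<t + 1}"]) auto
    ultimately show ?thesis by simp
  qed
  then show ?thesis by (simp add: continuous_on_eq_continuous_within)
qed

lemma solves_derivative:
  assumes "solves g x"
  obtains N where "negligible N"
    "\<And>t T. \<lbrakk>t \<in> {0..T}; t \<notin> N\<rbrakk> \<Longrightarrow> (x has_vector_derivative g t (x t)) (at t within {0..T})"
proof -
  have "{0::real..} \<in> sets lebesgue" by simp
  then obtain N where "negligible N"
    and N: "\<And>t. t \<in> {0..} \<Longrightarrow> t \<notin> N \<Longrightarrow> (x has_vector_derivative g t (x t)) (at t within {0..})"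
    using assms unfolding solves_def by (subst (asm) AE_lebesgue_on_iff_negligible) auto
  then show ?thesis
    by (intro that[of N] has_vector_derivative_within_subset[OF N]) auto
qed

lemma solvesI_integral_equation:
  fixes x :: "real \<Rightarrow> 'a::euclidean_space"
  assumes int: "locally_integrable (\<lambda>t. g t (x t))"
    and eq: "\<And>t. t \<ge> 0 \<Longrightarrow> x t = x 0 + integral {0..t} (\<lambda>s. g s (x s))"
  shows "solves g x"
  unfolding solves_def
proof (intro conjI allI impI)
  define F where "F = (\<lambda>t. integral {0..t} (\<lambda>s. g s (x s)))"
  have gi: "set_integrable lebesgue {0..T} (\<lambda>t. g t (x t))" for T
    using int by (rule locally_integrable_set_integrable) simp
  show "absolutely_continuous_on 0 T x" if "T \<ge> 0" for T
  proof -
    have F: "absolutely_continuous_on 0 T F" unfolding F_def by (rule absolutely_continuous_on_integral[OF gi])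
    show ?thesis
    proof (rule absolutely_continuous_on_dominated[OF F F, where c = 1])
      fix s t :: real assume "0 \<le> s" "s \<le> t"
      then have "x t - x s = F t - F s" using eq[of s] eq[of t] by (simp add: F_def)
      then show "norm (x t - x s) \<le> 1 * norm (F t - F s) + 1 * norm (F t - F s)" by simp
    qed
  qed
  have "\<exists>N. negligible N \<and> (\<forall>t\<in>{0..real n} - N. (F has_vector_derivative g t (x t)) (at t within {0..real n}))" for n
    unfolding F_def by (rule integral_has_vector_derivative_ae[OF set_lebesgue_integral_eq_integral(1)[OF gi]])
  then obtain N where N: "\<And>n. negligible (N n)"
    "\<And>n t. t \<in> {0..real n} - N n \<Longrightarrow> (F has_vector_derivative g t (x t)) (at t within {0..real n})"
    by metis
  have N': "negligible (\<Union>n. N n)" using N(1) by (intro negligible_countable_Union) auto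
  have "(x has_vector_derivative g t (x t)) (at t within {0..})"
    if t: "t \<in> {0..}" "t \<notin> (\<Union>n. N n)" for t :: real
  proof -
    obtain n where n: "t < real n" using reals_Archimedean2 by blast
    then have "(F has_vector_derivative g t (x t)) (at t within {0..real n})" using N(2)[of t n] t by auto
    moreover have "at t within {0..real n} = at t within {0..}"
      using t n by (intro at_within_nhd[of _ "{..<real n}"]) auto
    ultimately have "((\<lambda>t. x 0 + F t) has_vector_derivative 0 + g t (x t)) (at t within {0..})"
      by (intro has_vector_derivative_add has_vector_derivative_const) simp
    then have "((\<lambda>t. x 0 + F t) has_vector_derivative g t (x t)) (at t within {0..})" by simp
    then show ?thesis
    proof (rule has_vector_derivative_transform_within[where d = 1])
      show "x 0 + F s = x s" if "s \<in> {0..}" for s using eq[of s] that by (simp add: F_def)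
    qed (use t in auto)
  qed
  with N' show "AE t in lebesgue_on {0..}. (x has_vector_derivative g t (x t)) (at t within {0..})"
    by (subst AE_lebesgue_on_iff_negligible) auto
qed

lemma measurable_lebesgue_on_spike:
  fixes f g :: "'a::euclidean_space \<Rightarrow> 'b::euclidean_space"
  assumes f: "f \<in> borel_measurable (lebesgue_on S)" and S: "S \<in> sets lebesgue"
    and N: "negligible N" and eq: "\<And>x. x \<in> S - N \<Longrightarrow> f x = g x"
  shows "g \<in> borel_measurable (lebesgue_on S)"
proof -
  have "(\<lambda>x. indicator S x *\<^sub>R f x) \<in> borel_measurable lebesgue"
    using f S by (simp add: borel_measurable_restrict_space_iff)
  moreover have "AE x in lebesgue. indicator S x *\<^sub>R f x = indicator S x *\<^sub>R g x"
    unfolding eventually_ae_filter using N eq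
    by (intro bexI[of _ N]) (auto simp: negligible_iff_null_sets indicator_def split: if_splits)
  ultimately have "(\<lambda>x. indicator S x *\<^sub>R g x) \<in> borel_measurable lebesgue" by (rule borel_measurable_AE)
  then show ?thesis using S by (simp add: borel_measurable_restrict_space_iff)
qed

text \<open>
  The path y is approximated by paths that are constant on a grid of mesh 1/(n+1). Along these the
  composition is a countable patchwork of measurable functions of t, and continuity in the state lets
  the mesh tend to zero.
\<close>

lemma caratheodory_composition_measurable:
  fixes g :: "'a::metric_space \<Rightarrow> real \<Rightarrow> 'b::euclidean_space"
  assumes g: "caratheodory g" and y: "continuous_on {0..} y"
  shows "(\<lambda>t. g (y t) t) \<in> borel_measurable (lebesgue_on {0..})"
proof -
  let ?M = "lebesgue_on {0::real..}"
  have S: "{0::real..} \<in> sets lebesgue" by simp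
  have meas: "(\<lambda>t. g x t) \<in> borel_measurable ?M" for x using g by (simp add: caratheodory_def)
  from g have "AE t in ?M. continuous_on UNIV (\<lambda>x. g x t)" by (simp add: caratheodory_def)
  then obtain N where N: "negligible N" "\<And>t. t \<in> {0..} - N \<Longrightarrow> continuous_on UNIV (\<lambda>x. g x t)"
    by (subst (asm) AE_lebesgue_on_iff_negligible[OF S]) auto
  define q where "q = (\<lambda>n t. real_of_int \<lfloor>t * real (Suc n)\<rfloor> / real (Suc n))"
  have q_lim: "(\<lambda>n. q n t) \<longlonglongrightarrow> t" for t
  proof (rule LIMSEQ_I)
    fix e :: real assume "e > 0"
    then obtain n0 where n0: "inverse (real (Suc n0)) < e" using reals_Archimedean by blast
    have "norm (q n t - t) < e" if "n \<ge> n0" for n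
    proof -
      have "\<bar>real_of_int \<lfloor>t * real (Suc n)\<rfloor> - t * real (Suc n)\<bar> \<le> 1" by linarith
      then have "\<bar>real_of_int \<lfloor>t * real (Suc n)\<rfloor> - t * real (Suc n)\<bar> / real (Suc n) \<le> 1 / real (Suc n)"
        by (intro divide_right_mono) auto
      moreover have "q n t - t = (real_of_int \<lfloor>t * real (Suc n)\<rfloor> - t * real (Suc n)) / real (Suc n)"
        by (simp add: q_def diff_divide_distrib del: of_nat_Suc)
      ultimately have "norm (q n t - t) \<le> 1 / real (Suc n)"
        by (simp add: abs_divide del: of_nat_Suc)
      also have "\<dots> \<le> inverse (real (Suc n0))" using that by (simp add: divide_simps)
      finally show ?thesis using n0 by simp
    qed
    then show "\<exists>no. \<forall>n\<ge>no. norm (q n t - t) < e" by blast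
  qed
  have nn: "q n t \<ge> 0" if "t \<ge> 0" for n t using that by (simp add: q_def)
  define h where "h = (\<lambda>n t. g (y (q n t)) t)"
  have h: "h n \<in> borel_measurable ?M" for n
  proof -
    have "(\<lambda>t. (\<lambda>i t. g (y (real_of_int i / real (Suc n))) t) \<lfloor>t * real (Suc n)\<rfloor> t) \<in> borel_measurable ?M"
    proof (rule measurable_compose_countable[where f = "\<lambda>i t. g (y (real_of_int i / real (Suc n))) t"])
      show "(\<lambda>t. g (y (real_of_int i / real (Suc n))) t) \<in> borel_measurable ?M" for i by (rule meas)
      have "(\<lambda>t. t * real (Suc n)) \<in> borel_measurable ?M"
        by (intro measurable_restrict_space1 measurable_completion) (auto intro!: borel_measurable_times simp del: of_nat_Suc)
      from measurable_compose[OF this measurable_real_floor]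
      show "(\<lambda>t. \<lfloor>t * real (Suc n)\<rfloor>) \<in> measurable ?M (count_space UNIV)" .
    qed
    then show ?thesis by (simp add: h_def q_def)
  qed
  have "(\<lambda>t. indicator (- N) t *\<^sub>R g (y t) t) \<in> borel_measurable ?M"
  proof (rule borel_measurable_LIMSEQ_metric)
    have "- N \<in> sets lebesgue" using N(1) by (simp add: negligible_imp_sets Compl_in_sets_lebesgue)
    then have "indicator (- N) \<in> borel_measurable lebesgue" by (rule borel_measurable_indicator)
    then have "(indicator (- N) :: real \<Rightarrow> real) \<in> borel_measurable ?M" by (rule measurable_restrict_space1)
    then show "(\<lambda>t. indicator (- N) t *\<^sub>R h n t) \<in> borel_measurable ?M" for n
      using h by (rule borel_measurable_scaleR)
    show "(\<lambda>n. indicator (- N) t *\<^sub>R h n t) \<longlonglongrightarrow> indicator (- N) t *\<^sub>R g (y t) t"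
      if "t \<in> space ?M" for t
    proof (cases "t \<in> N")
      case False
      have t: "t \<ge> 0" using that by simp
      have "(\<lambda>n. y (q n t)) \<longlonglongrightarrow> y t"
        by (rule continuous_on_tendsto_compose[OF y q_lim]) (use nn t in auto)
      then have "(\<lambda>n. g (y (q n t)) t) \<longlonglongrightarrow> g (y t) t"
        by (intro continuous_on_tendsto_compose[where f = "\<lambda>x. g x t" and s = UNIV] N(2))
          (use t False in auto)
      then show ?thesis by (intro tendsto_scaleR tendsto_const) (simp add: h_def)
    qed auto
  qed
  then show ?thesis by (rule measurable_lebesgue_on_spike[OF _ S N(1)]) auto
qed

text \<open>
  With this weight the integral operator of a Lipschitz equation becomes a contraction on the whole
  half-line at once; the factor 2 in the exponent produces the contraction constant 1/2.
\<close>

lemma has_integral_exponential_weight: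
  fixes k :: "real \<Rightarrow> real"
  assumes k: "locally_integrable k" and "T \<ge> 0"
  shows "((\<lambda>s. 2 * k s * exp (2 * integral {0..s} k)) has_integral exp (2 * integral {0..T} k) - 1) {0..T}"
proof -
  define K where "K = (\<lambda>t. integral {0..t} k)"
  have ki: "set_integrable lebesgue {0..T} k" by (rule locally_integrable_set_integrable[OF k]) simp
  obtain N where N: "negligible N" "\<And>t. t \<in> {0..T} - N \<Longrightarrow>
      (K has_vector_derivative k t) (at t within {0..T})"
    using integral_has_vector_derivative_ae[OF set_lebesgue_integral_eq_integral(1)[OF ki]]
    unfolding K_def by blast
  have acK: "absolutely_continuous_on 0 T K" unfolding K_def by (rule absolutely_continuous_on_integral[OF ki])
  have "absolutely_continuous_on 0 T (\<lambda>t. exp (2 * K t))"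
  proof (intro absolutely_continuous_on_exp absolutely_continuous_on_dominated[OF acK acK, where c = 1])
    show "norm (2 * K t - 2 * K s) \<le> 1 * norm (K t - K s) + 1 * norm (K t - K s)" for s t
      by (simp add: abs_if)
  qed
  then have "((\<lambda>s. 2 * k s * exp (2 * K s)) has_integral exp (2 * K T) - exp (2 * K 0)) {0..T}"
  proof (rule absolutely_continuous_has_integral[OF \<open>T \<ge> 0\<close> _ N(1)])
    fix t assume "t \<in> {0..T}" "t \<notin> N"
    then have "(K has_real_derivative k t) (at t within {0..T})"
      using N(2) by (simp add: has_real_derivative_iff_has_vector_derivative)
    then show "((\<lambda>t. exp (2 * K t)) has_vector_derivative 2 * k t * exp (2 * K t)) (at t within {0..T})"
      unfolding has_real_derivative_iff_has_vector_derivative[symmetric]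
      by (auto intro!: derivative_eq_intros)
  qed
  then show ?thesis by (simp add: K_def)
qed

lemma continuous_on_indefinite_integral:
  fixes h :: "real \<Rightarrow> 'a::euclidean_space"
  assumes "locally_integrable h"
  shows "continuous_on UNIV (\<lambda>t. integral {0..t} h)"
proof -
  have "continuous (at t) (\<lambda>t. integral {0..t} h)" for t
  proof -
    have "continuous_on ({..0} \<union> {0..\<bar>t\<bar> + 1}) (\<lambda>t. integral {0..t} h)"
    proof (rule continuous_on_closed_Un)
      have "integral {0..s} h = 0" if "s \<le> 0" for s
        using that by (cases "s = 0") auto
      then show "continuous_on {..0} (\<lambda>t. integral {0..t} h)"
        by (subst continuous_on_cong[OF refl, of _ _ "\<lambda>_. 0"]) auto
      show "continuous_on {0..\<bar>t\<bar> + 1} (\<lambda>t. integral {0..t} h)"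
        by (intro indefinite_integral_continuous_1 locally_integrable_integrable_on[OF assms]) auto
    qed auto
    moreover have "t \<in> interior ({..0} \<union> {0..\<bar>t\<bar> + 1})"
    proof -
      have "{..0} \<union> {0..\<bar>t\<bar> + 1} = {..\<bar>t\<bar> + 1}" by auto
      then show ?thesis by simp
    qed
    ultimately show ?thesis by (rule continuous_on_interior)
  qed
  then show ?thesis by (simp add: continuous_on_eq_continuous_at)
qed

text \<open>
  A solution x is sought in the form x = exp(2K) z with z bounded and continuous, K being the integral
  of k. In the sup norm for z the Picard operator is a contraction with constant 1/2, because the
  integral of k exp(2K) is at most exp(2K)/2. The bound on g(t,0) keeps the operator within bounded
  functions, so a single application of Banach's theorem yields a solution for all times.
\<close>

theorem caratheodory_existence_lipschitz:
  fixes g :: "real \<Rightarrow> 'a::euclidean_space \<Rightarrow> 'a"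
  assumes meas: "\<And>y. continuous_on {0..} y \<Longrightarrow> (\<lambda>t. g t (y t)) \<in> borel_measurable (lebesgue_on {0..})"
    and k: "locally_integrable k" "\<And>t. 0 \<le> k t"
    and N: "negligible N"
    and bd: "\<And>t. t \<in> {0..} - N \<Longrightarrow> norm (g t 0) \<le> k t"
    and lip: "\<And>t y z. t \<in> {0..} - N \<Longrightarrow> norm (g t y - g t z) \<le> k t * norm (y - z)"
  shows "\<exists>x. x 0 = b \<and> solves g x"
proof -
  define K where "K = (\<lambda>t. integral {0..t} k)"
  have contK: "continuous_on UNIV K" unfolding K_def by (rule continuous_on_indefinite_integral[OF k(1)])
  have K0: "K t \<ge> 0" for t
    unfolding K_def using k by (intro Henstock_Kurzweil_Integration.integral_nonneg locally_integrable_integrable_on) auto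
  have growth: "norm (g t y) \<le> k t * (1 + norm y)" if "t \<in> {0..} - N" for t y
    using bd[OF that] lip[OF that, of y 0] norm_triangle_sub[of "g t y" "g t 0"] by (simp add: algebra_simps)
  have loc: "locally_integrable (\<lambda>t. g t (y t))" if y: "continuous_on {0..} y" for y
    unfolding locally_integrable_def
  proof (intro allI impI)
    fix T :: real assume "T \<ge> 0"
    define g' where "g' = (\<lambda>t. if t \<in> N then 0 else g t (y t))"
    have yT: "continuous_on {0..T} y" using y by (rule continuous_on_subset) auto
    have dom: "set_integrable lebesgue {0..T} (\<lambda>t. k t * (1 + norm (y t)))"
      by (intro set_integrable_mult_continuous locally_integrable_set_integrable[OF k(1)] continuous_intros yT) simp
    have m0: "(\<lambda>t. g t (y t)) \<in> borel_measurable (lebesgue_on {0..T})"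
      using meas[OF y] by (rule measurable_restrict_mono) auto
    then have "g' \<in> borel_measurable (lebesgue_on {0..T})"
      by (rule measurable_lebesgue_on_spike[OF _ _ N]) (auto simp: g'_def)
    then have "set_integrable lebesgue {0..T} g'"
    proof (rule measurable_bounded_by_integrable_imp_absolutely_integrable[OF _ _ set_lebesgue_integral_eq_integral(1)[OF dom]])
      show "norm (g' t) \<le> k t * (1 + norm (y t))" if "t \<in> {0..T}" for t
        using growth[of t "y t"] that k(2)[of t] by (auto simp: g'_def)
    qed auto
    then show "set_integrable lebesgue {0..T} (\<lambda>t. g t (y t))"
      by (rule absolutely_integrable_spike[OF _ N]) (auto simp: g'_def)
  qed
  (* Y z is the candidate solution exp(2K) z, and P z the weighted Picard iterate *)
  define Y where "Y = (\<lambda>(z :: real \<Rightarrow>\<^sub>C 'a) s. exp (2 * K s) *\<^sub>R apply_bcontfun z s)"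
  have contY: "continuous_on S (Y z)" for z S
    unfolding Y_def by (intro continuous_intros continuous_on_subset[OF contK] continuous_on_apply_bcontfun) auto
  define P where "P = (\<lambda>z t. exp (- 2 * K t) *\<^sub>R (b + integral {0..t} (\<lambda>s. g s (Y z s))))"
  have weight: "norm (integral {0..t} h) \<le> c * (exp (2 * K t) - 1) / 2"
    if h: "h integrable_on {0..t}" "\<And>s. s \<in> {0..t} - N \<Longrightarrow> norm (h s) \<le> c * (k s * exp (2 * K s))"
      and "c \<ge> 0" for h :: "real \<Rightarrow> 'a" and c t
  proof (cases "t \<ge> 0")
    case True
    have w: "((\<lambda>s. c / 2 * (2 * k s * exp (2 * K s))) has_integral c / 2 * (exp (2 * K t) - 1)) {0..t}"
      using has_integral_exponential_weight[OF k(1) True] unfolding K_def by (rule has_integral_mult_right)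
    have "norm (integral {0..t} h) \<le> integral {0..t} (\<lambda>s. c / 2 * (2 * k s * exp (2 * K s)))"
      by (rule integral_norm_bound_ae[OF h(1) has_integral_integrable[OF w] N]) (use h(2) in auto)
    also have "\<dots> = c * (exp (2 * K t) - 1) / 2" unfolding integral_unique[OF w] by simp
    finally show ?thesis .
  qed (simp add: K_def)
  have gint: "(\<lambda>s. g s (Y z s)) integrable_on {0..t}" for z t
    by (rule locally_integrable_integrable_on[OF loc[OF contY]]) simp
  have Pb: "P z \<in> bcontfun" for z
  proof -
    have "continuous_on UNIV (P z)"
      unfolding P_def by (intro continuous_intros contK continuous_on_indefinite_integral loc contY)
    moreover have "norm (P z t) \<le> norm b + (1 + norm z)" for t
    proof -
      have "norm (integral {0..t} (\<lambda>s. g s (Y z s))) \<le> (1 + norm z) * (exp (2 * K t) - 1) / 2"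
      proof (rule weight[OF gint])
        fix s assume s: "s \<in> {0..t} - N"
        have "norm (g s (Y z s)) \<le> k s * (1 + norm (Y z s))" using growth s by auto
        also have "\<dots> \<le> k s * ((1 + norm z) * exp (2 * K s))"
        proof (rule mult_left_mono[OF _ k(2)])
          have "norm (Y z s) \<le> norm z * exp (2 * K s)"
            unfolding Y_def using norm_bounded[of z s] by (simp add: mult.commute)
          moreover have "1 \<le> exp (2 * K s)" using K0 by simp
          moreover have "(1 + norm z) * exp (2 * K s) = exp (2 * K s) + norm z * exp (2 * K s)"
            by (simp only: distrib_right mult_1)
          ultimately show "1 + norm (Y z s) \<le> (1 + norm z) * exp (2 * K s)" by linarith
        qed
        finally show "norm (g s (Y z s)) \<le> (1 + norm z) * (k s * exp (2 * K s))" by (simp add: algebra_simps)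
      qed simp
      also have "\<dots> \<le> (1 + norm z) * exp (2 * K t)"
      proof -
        have "0 \<le> (1 + norm z) * exp (2 * K t)" by simp
        then show ?thesis by (simp add: algebra_simps)
      qed
      finally have 1: "norm (integral {0..t} (\<lambda>s. g s (Y z s))) \<le> (1 + norm z) * exp (2 * K t)" .
      have 2: "norm b \<le> norm b * exp (2 * K t)"
        using mult_left_mono[of 1 "exp (2 * K t)" "norm b"] K0[of t] by simp
      have "norm (P z t) = exp (- 2 * K t) * norm (b + integral {0..t} (\<lambda>s. g s (Y z s)))"
        by (simp add: P_def)
      also have "\<dots> \<le> exp (- 2 * K t) * (norm b * exp (2 * K t) + (1 + norm z) * exp (2 * K t))"
        using 1 2 by (intro mult_left_mono order_trans[OF norm_triangle_ineq add_mono]) auto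
      also have "\<dots> = norm b + (1 + norm z)"
        by (simp add: exp_minus field_simps)
      finally show ?thesis .
    qed
    ultimately show ?thesis by (rule bcontfun_normI)
  qed
  define \<Phi> where "\<Phi> = (\<lambda>z. Bcontfun (P z))"
  have app: "apply_bcontfun (\<Phi> z) t = P z t" for z t
    unfolding \<Phi>_def by (simp add: Bcontfun_inverse[OF Pb])
  have "dist (\<Phi> z) (\<Phi> w) \<le> 1 / 2 * dist z w" for z w
  proof (rule dist_bound)
    fix t
    have "norm (integral {0..t} (\<lambda>s. g s (Y z s) - g s (Y w s))) \<le> dist z w * (exp (2 * K t) - 1) / 2"
    proof (rule weight)
      show "(\<lambda>s. g s (Y z s) - g s (Y w s)) integrable_on {0..t}" by (intro integrable_diff gint)
      fix s assume "s \<in> {0..t} - N"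
      then have "norm (g s (Y z s) - g s (Y w s)) \<le> k s * norm (Y z s - Y w s)" using lip by auto
      also have "norm (Y z s - Y w s) = exp (2 * K s) * dist (z s) (w s)"
        unfolding Y_def by (simp add: dist_norm flip: scaleR_right_diff_distrib)
      also have "k s * \<dots> \<le> k s * (exp (2 * K s) * dist z w)"
        by (intro mult_left_mono dist_bounded k(2)) auto
      finally show "norm (g s (Y z s) - g s (Y w s)) \<le> dist z w * (k s * exp (2 * K s))"
        by (simp add: algebra_simps)
    qed simp
    also have "\<dots> \<le> dist z w * exp (2 * K t) / 2"
      by (intro divide_right_mono mult_left_mono) auto
    finally have le: "norm (integral {0..t} (\<lambda>s. g s (Y z s) - g s (Y w s))) \<le> dist z w * exp (2 * K t) / 2" .
    have "dist (\<Phi> z t) (\<Phi> w t) = norm (exp (- 2 * K t) *\<^sub>R (integral {0..t} (\<lambda>s. g s (Y z s)) - integral {0..t} (\<lambda>s. g s (Y w s))))"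
      by (simp add: app P_def dist_norm flip: scaleR_right_diff_distrib)
    also have "\<dots> = exp (- 2 * K t) * norm (integral {0..t} (\<lambda>s. g s (Y z s) - g s (Y w s)))"
      using Henstock_Kurzweil_Integration.integral_diff[OF gint gint, of t z w] by simp
    also have "\<dots> \<le> exp (- 2 * K t) * (dist z w * exp (2 * K t) / 2)"
      by (intro mult_left_mono le) simp
    also have "\<dots> = 1 / 2 * dist z w" by (simp add: exp_minus field_simps)
    finally show "dist (\<Phi> z t) (\<Phi> w t) \<le> 1 / 2 * dist z w" .
  qed
  then have "\<exists>!z. \<Phi> z = z" by (intro banach_fix_type[of "1/2"]) auto
  then obtain z where z: "\<Phi> z = z" by blast
  have eq: "Y z t = b + integral {0..t} (\<lambda>s. g s (Y z s))" for t
  proof -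
    have "Y z t = exp (2 * K t) *\<^sub>R P z t" unfolding Y_def using app[of z t] z by simp
    also have "\<dots> = (exp (2 * K t) * exp (- 2 * K t)) *\<^sub>R (b + integral {0..t} (\<lambda>s. g s (Y z s)))"
      by (simp add: P_def)
    also have "exp (2 * K t) * exp (- 2 * K t) = 1" by (simp flip: exp_add)
    finally show ?thesis by simp
  qed
  have Y0: "Y z 0 = b" using eq[of 0] by simp
  have "solves g (Y z)"
    using loc[OF contY[of _ z]] by (rule solvesI_integral_equation) (metis Y0 eq)
  with Y0 show ?thesis by blast
qed

text \<open>
  Lipschitz constants are available on each ball separately. Along a path whose size is controlled by
  a continuous function, choosing the ball as a function of time gives one locally integrable bound.
\<close>

lemma locally_integrable_glue:
  fixes k :: "nat \<Rightarrow> real \<Rightarrow> real" and \<phi> :: "real \<Rightarrow> real"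
  assumes k: "\<And>n. locally_integrable (k n)" "\<And>n t. 0 \<le> k n t" and \<phi>: "continuous_on UNIV \<phi>"
  shows "locally_integrable (\<lambda>t. k (nat \<lceil>\<phi> t\<rceil>) t)"
  unfolding locally_integrable_def
proof (intro allI impI)
  fix T :: real assume "T \<ge> 0"
  have "bounded (\<phi> ` {0..T})"
    by (intro compact_imp_bounded compact_continuous_image continuous_on_subset[OF \<phi>]) auto
  then have "\<exists>B. \<forall>t\<in>{0..T}. \<bar>\<phi> t\<bar> \<le> B" by (auto simp: bounded_iff)
  then obtain B where B: "\<And>t. t \<in> {0..T} \<Longrightarrow> \<bar>\<phi> t\<bar> \<le> B" by blast
  have ki: "k n integrable_on {0..T}" for n by (rule locally_integrable_integrable_on[OF k(1)]) simp
  show "set_integrable lebesgue {0..T} (\<lambda>t. k (nat \<lceil>\<phi> t\<rceil>) t)"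
  proof (rule measurable_bounded_by_integrable_imp_absolutely_integrable)
    show "(\<lambda>t. k (nat \<lceil>\<phi> t\<rceil>) t) \<in> borel_measurable (lebesgue_on {0..T})"
    proof (rule measurable_compose_countable[where f = k])
      show "k n \<in> borel_measurable (lebesgue_on {0..T})" for n by (rule integrable_imp_measurable[OF ki])
      have "\<phi> \<in> borel_measurable borel" using \<phi> by (rule borel_measurable_continuous_onI)
      then have "(\<lambda>t. nat \<lceil>\<phi> t\<rceil>) \<in> measurable borel (count_space UNIV)" by measurable
      then show "(\<lambda>t. nat \<lceil>\<phi> t\<rceil>) \<in> measurable (lebesgue_on {0..T}) (count_space UNIV)"
        by (intro measurable_restrict_space1 measurable_completion) simp
    qed
    show "(\<lambda>t. \<Sum>n\<le>nat \<lceil>B\<rceil>. k n t) integrable_on {0..T}"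
      by (intro integrable_sum ki) auto
    show "norm (k (nat \<lceil>\<phi> t\<rceil>) t) \<le> (\<Sum>n\<le>nat \<lceil>B\<rceil>. k n t)" if "t \<in> {0..T}" for t
    proof -
      have "\<phi> t \<le> real (nat \<lceil>B\<rceil>)" using B[OF that] by linarith
      then have "nat \<lceil>\<phi> t\<rceil> \<in> {..nat \<lceil>B\<rceil>}" by (simp add: ceiling_mono nat_mono)
      then have "k (nat \<lceil>\<phi> t\<rceil>) t \<le> (\<Sum>n\<le>nat \<lceil>B\<rceil>. k n t)"
        by (intro member_le_sum k(2)) auto
      then show ?thesis using k(2) by simp
    qed
  qed auto
qed

text \<open>
  The radial projection onto the ball of radius r. The explicit formula makes it jointly continuous in
  the radius and the point, which is needed for a radius that varies with time.
\<close>

definition clip :: "real \<Rightarrow> 'a::real_normed_vector \<Rightarrow> 'a" where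
  "clip r y = (r / max r (norm y)) *\<^sub>R y"

lemma
  assumes "r > 0"
  shows norm_clip_le_radius: "norm (clip r y) \<le> r" and norm_clip_le: "norm (clip r y) \<le> norm y"
    and clip_eq: "norm y \<le> r \<Longrightarrow> clip r y = y"
    and clip_lipschitz: "norm (clip r y - clip r z) \<le> 2 * norm (y - z)"
proof -
  define s where "s = (\<lambda>y :: 'a. r / max r (norm y))"
  have s: "0 \<le> s y" "s y \<le> 1" "s y * norm y \<le> r" for y
    using assms by (auto simp: s_def max_def divide_simps)
  have nc: "norm (clip r y) = s y * norm y" for y
    using s(1)[of y] by (simp only: clip_def s_def norm_scaleR abs_of_nonneg)
  show "norm (clip r y) \<le> r" using s(3)[of y] by (simp add: nc)
  have "s y * norm y \<le> 1 * norm y" by (intro mult_right_mono s) auto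
  then show "norm (clip r y) \<le> norm y" by (simp add: nc)
  show "clip r y = y" if "norm y \<le> r" using that assms by (simp add: clip_def max_def)
  have "\<bar>s y - s z\<bar> * norm z \<le> norm (y - z)"
  proof -
    have pos: "max r (norm y) > 0" "max r (norm z) > 0" using assms by auto
    have "s y - s z = r * (max r (norm z) - max r (norm y)) / (max r (norm y) * max r (norm z))"
      using pos by (simp add: s_def field_simps)
    then have "\<bar>s y - s z\<bar> * norm z = \<bar>max r (norm z) - max r (norm y)\<bar> * (s y * (norm z / max r (norm z)))"
      using pos assms by (simp add: s_def abs_mult)
    also have "\<dots> \<le> norm (y - z) * (1 * 1)"
    proof (intro mult_mono s)
      have "\<bar>norm z - norm y\<bar> \<le> norm (y - z)" by (metis norm_minus_commute norm_triangle_ineq3)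
      then show "\<bar>max r (norm z) - max r (norm y)\<bar> \<le> norm (y - z)" by (auto simp: max_def abs_if split: if_splits)
      show "norm z / max r (norm z) \<le> 1" using pos by simp
    qed (use s pos in auto)
    finally show ?thesis by simp
  qed
  moreover have "clip r y - clip r z = s y *\<^sub>R (y - z) + (s y - s z) *\<^sub>R z"
    by (simp add: clip_def s_def algebra_simps)
  moreover have "norm (s y *\<^sub>R (y - z)) \<le> norm (y - z)"
    using s(1,2)[of y] mult_right_mono[of "s y" 1 "norm (y - z)"] by simp
  ultimately show "norm (clip r y - clip r z) \<le> 2 * norm (y - z)"
    using norm_triangle_ineq[of "s y *\<^sub>R (y - z)" "(s y - s z) *\<^sub>R z"] by simp
qed

text \<open>
  Linear growth and Gronwall's inequality give an a priori bound M(t) for any solution. Clipping the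
  state at M(t) makes the right-hand side globally Lipschitz with a locally integrable constant, and
  since clipping does not increase norms, the solution of the clipped equation obeys the same bound.
  The clipping is therefore inactive along it.
\<close>

theorem caratheodory_existence:
  fixes g :: "real \<Rightarrow> 'a::euclidean_space \<Rightarrow> 'a"
  assumes meas: "\<And>y. continuous_on {0..} y \<Longrightarrow> (\<lambda>t. g t (y t)) \<in> borel_measurable (lebesgue_on {0..})"
    and L: "locally_integrable L" "\<And>t. 0 \<le> L t" and N: "negligible N"
    and growth: "\<And>t y. t \<in> {0..} - N \<Longrightarrow> norm (g t y) \<le> L t * (1 + norm y)"
    and k: "\<And>n. locally_integrable (k n)" "\<And>n t. 0 \<le> k n t"
    and lip: "\<And>n t y z. \<lbrakk>t \<in> {0..real n} - N; norm y \<le> real n; norm z \<le> real n\<rbrakk> \<Longrightarrow>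
        norm (g t y - g t z) \<le> k n t * norm (y - z)"
  shows "\<exists>x. x 0 = b \<and> solves g x"
proof -
  define \<Lambda> where "\<Lambda> = (\<lambda>t. integral {0..t} L)"
  define M where "M = (\<lambda>t. 1 + (norm b + \<Lambda> t) * exp (\<Lambda> t))"
  have \<Lambda>0: "\<Lambda> t \<ge> 0" for t
    unfolding \<Lambda>_def using L by (intro Henstock_Kurzweil_Integration.integral_nonneg locally_integrable_integrable_on) auto
  have M: "M t > 0" for t using \<Lambda>0[of t] by (simp add: M_def add_pos_nonneg)
  have contM: "continuous_on S M" for S
    unfolding M_def \<Lambda>_def
    by (intro continuous_intros continuous_on_subset[OF continuous_on_indefinite_integral[OF L(1)]]) auto
  (* the constants k n are valid only up to time n and on the ball of radius n *)
  define \<phi> where "\<phi> = (\<lambda>t. max t (M t))"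
  define K where "K = (\<lambda>t. 2 * k (nat \<lceil>\<phi> t\<rceil>) t + L t)"
  have "locally_integrable (\<lambda>t. k (nat \<lceil>\<phi> t\<rceil>) t)"
    by (rule locally_integrable_glue[OF k]) (auto simp: \<phi>_def intro!: continuous_intros contM)
  then have K: "locally_integrable K"
    using L(1) unfolding K_def locally_integrable_def
    by (auto intro!: set_integral_add set_integrable_mult_right)
  define h where "h = (\<lambda>t y. g t (clip (M t) y))"
  have "\<exists>x. x 0 = b \<and> solves h x"
  proof (rule caratheodory_existence_lipschitz[OF _ K _ N])
    fix y :: "real \<Rightarrow> 'a" assume y: "continuous_on {0..} y"
    have "max (M t) (norm (y t)) \<noteq> 0" for t using M[of t] by (auto simp: max_def)
    then have "continuous_on {0..} (\<lambda>t. clip (M t) (y t))"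
      unfolding clip_def by (intro continuous_intros contM y) auto
    then show "(\<lambda>t. h t (y t)) \<in> borel_measurable (lebesgue_on {0..})"
      unfolding h_def by (rule meas)
  next
    show "0 \<le> K t" for t using k(2) L(2) by (simp add: K_def)
  next
    fix t assume t: "t \<in> {0..} - N"
    show "norm (h t 0) \<le> K t" using growth[OF t, of 0] k(2)[of "nat \<lceil>\<phi> t\<rceil>" t] by (simp add: h_def K_def clip_def)
    fix y z :: 'a
    define n where "n = nat \<lceil>\<phi> t\<rceil>"
    have n: "t \<le> real n" "M t \<le> real n" unfolding n_def \<phi>_def by linarith+
    have "norm (h t y - h t z) \<le> k n t * norm (clip (M t) y - clip (M t) z)"
      unfolding h_def using t n norm_clip_le_radius[OF M[of t], of y] norm_clip_le_radius[OF M[of t], of z]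
      by (intro lip) auto
    also have "\<dots> \<le> k n t * (2 * norm (y - z))" by (intro mult_left_mono clip_lipschitz M k)
    also have "\<dots> \<le> K t * norm (y - z)"
      using L(2)[of t] by (simp add: K_def n_def algebra_simps)
    finally show "norm (h t y - h t z) \<le> K t * norm (y - z)" .
  qed
  then obtain x where x0: "x 0 = b" and x: "solves h x" by blast
  have bound: "norm (x t) \<le> M t" if "t \<ge> 0" for t
  proof -
    obtain N' where N': "negligible N'"
      "\<And>s T. \<lbrakk>s \<in> {0..T}; s \<notin> N'\<rbrakk> \<Longrightarrow> (x has_vector_derivative h s (x s)) (at s within {0..T})"
      using solves_derivative[OF x] by blast
    have "norm (x t) \<le> (norm (x 0) + integral {0..t} L) * exp (integral {0..t} L)"
    proof (rule gronwall_differential[OF solves_absolutely_continuous_on[OF x that] L L negligible_Un[OF N N'(1)]])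
      fix s assume s: "s \<in> {0..t}" "s \<notin> N \<union> N'"
      then show "(x has_vector_derivative h s (x s)) (at s within {0..t})" by (intro N'(2)) auto
      have "norm (h s (x s)) \<le> L s * (1 + norm (clip (M s) (x s)))"
        unfolding h_def using s by (intro growth) auto
      also have "\<dots> \<le> L s * (1 + norm (x s))"
        by (intro mult_left_mono add_left_mono norm_clip_le M L)
      finally show "norm (h s (x s)) \<le> L s * norm (x s) + L s" by (simp add: algebra_simps)
    qed (use that in auto)
    then show ?thesis by (simp add: M_def \<Lambda>_def x0)
  qed
  have "solves g x"
    unfolding solves_def
  proof (intro conjI allI impI solves_absolutely_continuous_on[OF x])
    have "AE t in lebesgue_on {0..}. (x has_vector_derivative h t (x t)) (at t within {0..})"
      using x by (simp add: solves_def)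
    then show "AE t in lebesgue_on {0..}. (x has_vector_derivative g t (x t)) (at t within {0..})"
      using AE_space
    proof eventually_elim
      case (elim t)
      then show ?case using clip_eq[OF M bound[of t]] by (simp add: h_def)
    qed
  qed
  with x0 show ?thesis by blast
qed

text \<open>
  The abstract bilinear product covers both the matrix equation A' = D A and the equation B' = - B D
  satisfied by the inverse of A.
\<close>

theorem linear_existence:
  fixes prod :: "'d::euclidean_space \<Rightarrow> 'a::euclidean_space \<Rightarrow> 'a"
  assumes prod: "bounded_bilinear prod"
    and D: "D \<in> borel_measurable (lebesgue_on {0..})"
    and k: "locally_integrable k" "\<And>t. 0 \<le> k t" and N: "negligible N"
    and le: "\<And>t. t \<in> {0..} - N \<Longrightarrow> norm (D t) \<le> k t"
  shows "\<exists>x. x 0 = b \<and> solves (\<lambda>t y. prod (D t) y) x"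
proof -
  interpret bounded_bilinear prod by (rule prod)
  obtain c where c: "c > 0" "\<And>v w. norm (prod v w) \<le> norm v * norm w * c" using pos_bounded by blast
  show ?thesis
  proof (rule caratheodory_existence_lipschitz[where k = "\<lambda>t. c * k t", OF _ _ _ N])
    fix y :: "real \<Rightarrow> 'a" assume "continuous_on {0..} y"
    then have "y \<in> borel_measurable (lebesgue_on {0..})"
      by (rule continuous_imp_measurable_on_sets_lebesgue) auto
    with D show "(\<lambda>t. prod (D t) (y t)) \<in> borel_measurable (lebesgue_on {0..})"
      by (rule borel_measurable_continuous_Pair) (intro continuous_on continuous_intros)
  next
    show "locally_integrable (\<lambda>t. c * k t)"
      using k(1) unfolding locally_integrable_def by (auto intro!: set_integrable_mult_right)
    show "0 \<le> c * k t" for t using c k(2)[of t] by simp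
    show "norm (prod (D t) 0) \<le> c * k t" for t using c k(2)[of t] by (simp add: zero_right)
    fix t :: real and y z :: 'a assume t: "t \<in> {0..} - N"
    have "norm (prod (D t) y - prod (D t) z) = norm (prod (D t) (y - z))" by (simp add: diff_right)
    also have "\<dots> \<le> norm (D t) * norm (y - z) * c" by (rule c)
    also have "\<dots> \<le> k t * norm (y - z) * c" using le[OF t] c by (intro mult_right_mono) auto
    finally show "norm (prod (D t) y - prod (D t) z) \<le> c * k t * norm (y - z)" by (simp add: algebra_simps)
  qed
qed

section \<open>Trajectories of the control system\<close>

lemma bounded_bilinear_matrix_matrix_mult:
  "bounded_bilinear ((**) :: real^'n^'m \<Rightarrow> real^'p^'n \<Rightarrow> real^'p^'m)"
  unfolding bilinear_conv_bounded_bilinear[symmetric] bilinear_def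
  by (auto intro!: linearI simp: matrix_matrix_mult_def vec_eq_iff sum.distrib algebra_simps sum_distrib_left)

lemma bounded_bilinear_matrix_vector_mult:
  "bounded_bilinear ((*v) :: real^'n^'m \<Rightarrow> real^'n \<Rightarrow> real^'m)"
  unfolding bilinear_conv_bounded_bilinear[symmetric] bilinear_def
  by (auto intro!: linearI simp: matrix_vector_mult_def vec_eq_iff sum.distrib algebra_simps sum_distrib_left)

lemma bounded_bilinear_vector_matrix_mult:
  "bounded_bilinear ((v*) :: real^'m \<Rightarrow> real^'n^'m \<Rightarrow> real^'n)"
  unfolding bilinear_conv_bounded_bilinear[symmetric] bilinear_def
  by (auto intro!: linearI simp: vector_matrix_mult_def vec_eq_iff sum.distrib algebra_simps sum_distrib_left)

lemma gradient_has_derivative: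
  fixes g :: "real^'m \<Rightarrow> real"
  assumes "g differentiable (at x)"
  shows "(g has_derivative (\<lambda>h. gradient g x \<bullet> h)) (at x)"
proof -
  define D where "D = frechet_derivative g (at x)"
  have D: "(g has_derivative D) (at x)" using assms unfolding D_def frechet_derivative_works .
  then have lin: "linear D" by (rule has_derivative_linear)
  have "D h = gradient g x \<bullet> h" for h
  proof -
    have "D h = D (\<Sum>i\<in>UNIV. h $ i *\<^sub>R axis i 1)"
      using basis_expansion[of h] by (simp add: scalar_mult_eq_scaleR)
    also have "\<dots> = (\<Sum>i\<in>UNIV. h $ i * D (axis i 1))"
      using lin by (simp add: linear_sum linear_cmul)
    finally show ?thesis by (simp add: gradient_def D_def inner_vec_def mult.commute)
  qed
  then have "D = (\<lambda>h. gradient g x \<bullet> h)" by blast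
  with D show ?thesis by simp
qed

lemma gradient_unique:
  fixes g :: "real^'m \<Rightarrow> real"
  assumes "(g has_derivative (\<lambda>h. v \<bullet> h)) (at x)"
  shows "gradient g x = v"
  using frechet_derivative_at[OF assms, symmetric] by (simp add: gradient_def vec_eq_iff inner_axis)

text \<open>
  A Lipschitz derivative makes the remainder quadratic; the Lipschitz condition is only required
  between the base point and the points of the segment.
\<close>

lemma first_order_remainder:
  fixes F :: "'a::real_normed_vector \<Rightarrow> 'b::real_normed_vector"
  assumes der: "\<And>z. (F has_derivative F' z) (at z)"
    and lip: "\<And>z h. z \<in> closed_segment y x \<Longrightarrow> norm (F' z h - F' y h) \<le> c * norm (z - y) * norm h" and "c \<ge> 0"
  shows "norm (F x - F y - F' y (x - y)) \<le> c * (norm (x - y))\<^sup>2"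
proof -
  have "norm (F x - F y - F' y (x - y)) \<le> norm (x - y) * (c * norm (x - y))"
  proof (rule differentiable_bound_linearization[where S = "closed_segment y x"])
    show "y + t *\<^sub>R (x - y) \<in> closed_segment y x" if "t \<in> {0..1}" for t
      using that unfolding closed_segment_def by (auto intro!: exI[of _ t] simp: algebra_simps)
    show "(F has_derivative F' z) (at z within closed_segment y x)" for z
      using der by (rule has_derivative_at_withinI)
    fix z assume z: "z \<in> closed_segment y x"
    have "onorm (\<lambda>h. F' z h - F' y h) \<le> c * norm (x - y)"
    proof (rule onorm_bound)
      show "0 \<le> c * norm (x - y)" using \<open>c \<ge> 0\<close> by simp
      fix h :: 'a
      have "norm (z - y) \<le> norm (x - y)" using segment_bound(1)[OF z] by simp
      then have "c * norm (z - y) * norm h \<le> c * norm (x - y) * norm h"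
        using \<open>c \<ge> 0\<close> by (intro mult_right_mono mult_left_mono) auto
      with lip[OF z, of h] show "norm (F' z h - F' y h) \<le> c * norm (x - y) * norm h" by simp
    qed
    then show "onorm (F' z - F' y) \<le> c * norm (x - y)" by (simp add: fun_diff_def)
  qed auto
  then show ?thesis by (simp add: power2_eq_square algebra_simps)
qed

text \<open>
  The regularity hypotheses speak of bounded sets of states and control values. Since a control is
  bounded on [0,n], the ball of radius n times its range over [0,n] is such a set, which turns them
  into Caratheodory bounds in time and state alone, with one exceptional null set for all n.
\<close>

lemma locally_integrably_lipschitz_along_control:
  fixes F :: "'x::real_normed_vector \<Rightarrow> 'u::euclidean_space \<Rightarrow> real \<Rightarrow> 'b::real_normed_vector"
  assumes F: "locally_integrably_lipschitz F" and u: "\<And>T. T \<ge> 0 \<Longrightarrow> bounded (u ` {0..T})"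
  obtains k :: "nat \<Rightarrow> real \<Rightarrow> real" and N where "\<And>n. locally_integrable (k n)" "\<And>n t. 0 \<le> k n t" "negligible N"
    "\<And>n t y. \<lbrakk>t \<in> {0..real n} - N; norm y \<le> real n\<rbrakk> \<Longrightarrow> norm (F y (u t) t) \<le> k n t"
    "\<And>n t y z. \<lbrakk>t \<in> {0..real n} - N; norm y \<le> real n; norm z \<le> real n\<rbrakk> \<Longrightarrow>
        norm (F y (u t) t - F z (u t) t) \<le> k n t * norm (y - z)"
proof -
  define bd where "bd = (\<lambda>n k N. locally_integrable k \<and> (\<forall>t. 0 \<le> k t) \<and> negligible N \<and>
      (\<forall>t\<in>{0..real n} - N. \<forall>y. norm y \<le> real n \<longrightarrow> norm (F y (u t) t) \<le> k t \<and>
        (\<forall>z. norm z \<le> real n \<longrightarrow> norm (F y (u t) t - F z (u t) t) \<le> k t * norm (y - z))))"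
  have "\<exists>k N. bd n k N" for n
  proof -
    define B where "B = cball (0::'x) (real n) \<times> (u ` {0..real n})"
    have "bounded B" unfolding B_def using u by (intro bounded_Times) auto
    then obtain k where k: "locally_integrable k" and ae: "AE t in lebesgue_on {0..}.
           (\<forall>(x, v)\<in>B. norm (F x v t) \<le> k t) \<and>
           (\<forall>x y v. (x, v) \<in> B \<longrightarrow> (y, v) \<in> B \<longrightarrow> norm (F x v t - F y v t) \<le> k t * norm (x - y))"
      using F unfolding locally_integrably_lipschitz_def by blast
    from ae obtain N where N: "negligible N" "\<And>t. t \<in> {0..} \<Longrightarrow> t \<notin> N \<Longrightarrow>
           (\<forall>(x, v)\<in>B. norm (F x v t) \<le> k t) \<and>
           (\<forall>x y v. (x, v) \<in> B \<longrightarrow> (y, v) \<in> B \<longrightarrow> norm (F x v t - F y v t) \<le> k t * norm (x - y))"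
      by (subst (asm) AE_lebesgue_on_iff_negligible) auto
    have "locally_integrable (\<lambda>t. \<bar>k t\<bar>)"
      using k unfolding locally_integrable_def by (auto intro: set_integrable_abs)
    moreover have "norm (F y (u t) t) \<le> \<bar>k t\<bar> \<and> (norm z \<le> real n \<longrightarrow> norm (F y (u t) t - F z (u t) t) \<le> \<bar>k t\<bar> * norm (y - z))"
      if t: "t \<in> {0..real n} - N" and y: "norm y \<le> real n" for t y z
    proof -
      have yB: "(y, u t) \<in> B" using t y by (auto simp: B_def)
      have b1: "norm (F y (u t) t) \<le> k t" using N(2)[of t] t yB by auto
      moreover have "norm (F y (u t) t - F z (u t) t) \<le> k t * norm (y - z)" if "norm z \<le> real n"
      proof -
        have "(z, u t) \<in> B" using t that by (auto simp: B_def)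
        then show ?thesis using N(2)[of t] t yB by auto
      qed
      moreover have "0 \<le> k t" using b1 norm_ge_zero order_trans by blast
      ultimately show ?thesis by simp
    qed
    ultimately show ?thesis unfolding bd_def using N(1) by (intro exI[of _ "\<lambda>t. \<bar>k t\<bar>"] exI[of _ N]) auto
  qed
  then obtain k N where kN: "\<And>n. bd n (k n) (N n)" by metis
  note kN = kN[unfolded bd_def]
  show ?thesis
  proof (rule that[of k "\<Union>n. N n"])
    show "negligible (\<Union>n. N n)" using kN by (intro negligible_countable_Union) auto
    show "norm (F y (u t) t) \<le> k n t" if "t \<in> {0..real n} - (\<Union>n. N n)" "norm y \<le> real n" for n t y
      using kN that by blast
    show "norm (F y (u t) t - F z (u t) t) \<le> k n t * norm (y - z)"
      if "t \<in> {0..real n} - (\<Union>n. N n)" "norm y \<le> real n" "norm z \<le> real n" for n t y z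
      using kN that by blast
  qed (use kN in blast)+
qed

context control_problem
begin

lemma D_f_has_derivative:
  assumes "t \<ge> 0"
  shows "((\<lambda>y. f y v t) has_derivative (\<lambda>h. D_f f x v t *v h)) (at x)"
  using f_differentiable[OF assms] unfolding D_f_def jacobian_works by blast

lemma D_f0_has_derivative:
  assumes "t \<ge> 0"
  shows "((\<lambda>y. f0 y v t) has_derivative (\<lambda>h. D_f0 f0 x v t \<bullet> h)) (at x)"
  unfolding D_f0_def by (rule gradient_has_derivative[OF f0_differentiable[OF assms]])

lemma gradient_hamiltonian:
  assumes "t \<ge> 0"
  shows "gradient (\<lambda>y. hamiltonian f f0 y v p lam t) x = p v* D_f f x v t - lam *\<^sub>R D_f0 f0 x v t"
proof (rule gradient_unique)
  have "((\<lambda>y. p \<bullet> f y v t - lam * f0 y v t) has_derivative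
      (\<lambda>h. p \<bullet> (D_f f x v t *v h) - lam * (D_f0 f0 x v t \<bullet> h))) (at x)"
    by (intro has_derivative_diff has_derivative_inner_right has_derivative_mult_right
        D_f_has_derivative D_f0_has_derivative assms)
  then show "((\<lambda>y. hamiltonian f f0 y v p lam t) has_derivative
      (\<lambda>h. (p v* D_f f x v t - lam *\<^sub>R D_f0 f0 x v t) \<bullet> h)) (at x)"
    by (simp add: hamiltonian_def inner_diff_left dot_lmul_matrix)
qed

lemma admissible_bounded: "u \<in> admissible_controls U \<Longrightarrow> T \<ge> 0 \<Longrightarrow> bounded (u ` {0..T})"
  by (simp add: admissible_controls_def)

lemma growth_along_control:
  assumes u: "u \<in> admissible_controls U"
  obtains L N where "locally_integrable L" "\<And>t. 0 \<le> L t" "negligible N"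
    "\<And>t x. t \<in> {0..} - N \<Longrightarrow> norm (f x (u t) t) \<le> L t * (1 + norm x)"
proof -
  obtain L where L: "locally_integrable L"
    and ae: "AE t in lebesgue_on {0..}. \<forall>x. norm (f x (u t) t) \<le> L t * (1 + norm x)"
    using f_growth[OF u] by blast
  from ae obtain N where N: "negligible N"
    "\<And>t. t \<in> {0..} \<Longrightarrow> t \<notin> N \<Longrightarrow> \<forall>x. norm (f x (u t) t) \<le> L t * (1 + norm x)"
    by (subst (asm) AE_lebesgue_on_iff_negligible) auto
  show ?thesis
  proof (rule that[of "\<lambda>t. \<bar>L t\<bar>" N])
    show "locally_integrable (\<lambda>t. \<bar>L t\<bar>)"
      using L unfolding locally_integrable_def by (auto intro: set_integrable_abs)
    fix t :: real and x :: "real^'m" assume "t \<in> {0..} - N"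
    then have "norm (f x (u t) t) \<le> L t * (1 + norm x)" using N(2) by auto
    also have "\<dots> \<le> \<bar>L t\<bar> * (1 + norm x)" by (intro mult_right_mono) auto
    finally show "norm (f x (u t) t) \<le> \<bar>L t\<bar> * (1 + norm x)" .
  qed (use N in auto)
qed

lemma
  assumes u: "u \<in> admissible_controls U"
  shows traj_initial: "traj f b u 0 = b" and traj_solves: "solves (\<lambda>t y. f y (u t) t) (traj f b u)"
proof -
  obtain L N where L: "locally_integrable L" "\<And>t. 0 \<le> L t" "negligible N"
    "\<And>t x. t \<in> {0..} - N \<Longrightarrow> norm (f x (u t) t) \<le> L t * (1 + norm x)"
    using growth_along_control[OF u] by blast
  obtain k N' where k: "\<And>n. locally_integrable (k n)" "\<And>n t. 0 \<le> k n t" "negligible N'"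
    "\<And>n t y z. \<lbrakk>t \<in> {0..real n} - N'; norm y \<le> real n; norm z \<le> real n\<rbrakk> \<Longrightarrow>
        norm (f y (u t) t - f z (u t) t) \<le> k n t * norm (y - z)"
    using locally_integrably_lipschitz_along_control[OF bounds_f admissible_bounded[OF u]] by metis
  have "\<exists>x. x 0 = b \<and> solves (\<lambda>t y. f y (u t) t) x"
  proof (rule caratheodory_existence[OF _ L(1,2) negligible_Un[OF L(3) k(3)] _ k(1,2)])
    show "(\<lambda>t. f (y t) (u t) t) \<in> borel_measurable (lebesgue_on {0..})" if "continuous_on {0..} y" for y
      by (rule caratheodory_composition_measurable[OF carath_f[OF u] that])
    show "norm (f y (u t) t) \<le> L t * (1 + norm y)" if "t \<in> {0..} - (N \<union> N')" for t y
      using that by (intro L) auto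
    show "norm (f y (u t) t - f z (u t) t) \<le> k n t * norm (y - z)"
      if "t \<in> {0..real n} - (N \<union> N')" "norm y \<le> real n" "norm z \<le> real n" for n t y z
      using that by (intro k) auto
  qed
  from someI_ex[OF this] show "traj f b u 0 = b" "solves (\<lambda>t y. f y (u t) t) (traj f b u)"
    unfolding traj_def by auto
qed

lemma solution_lipschitz_estimate:
  assumes u: "u \<in> admissible_controls U" and "T \<ge> 0"
  shows "\<exists>c\<ge>0. \<forall>x y. solves (\<lambda>t y. f y (u t) t) x \<longrightarrow> solves (\<lambda>t y. f y (u t) t) y \<longrightarrow>
      (\<forall>s\<in>{0..T}. norm (x s) \<le> r \<and> norm (y s) \<le> r) \<longrightarrow>
      (\<forall>t\<in>{0..T}. norm (x t - y t) \<le> c * norm (x 0 - y 0))"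
proof -
  obtain k N' where k: "\<And>n. locally_integrable (k n)" "\<And>n t. 0 \<le> k n t" "negligible N'"
    "\<And>n t y z. \<lbrakk>t \<in> {0..real n} - N'; norm y \<le> real n; norm z \<le> real n\<rbrakk> \<Longrightarrow>
        norm (f y (u t) t - f z (u t) t) \<le> k n t * norm (y - z)"
    using locally_integrably_lipschitz_along_control[OF bounds_f admissible_bounded[OF u]] by metis
  obtain n where n: "max T r \<le> real n" using real_arch_simple by blast
  show ?thesis
  proof (intro exI[of _ "exp (integral {0..T} (k n))"] conjI allI impI ballI)
    fix x y t assume x: "solves (\<lambda>t y. f y (u t) t) x" and y: "solves (\<lambda>t y. f y (u t) t) y"
      and t: "t \<in> {0..T}" and bd: "\<forall>s\<in>{0..T}. norm (x s) \<le> r \<and> norm (y s) \<le> r"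
    obtain Nx where Nx: "negligible Nx"
      "\<And>t T. \<lbrakk>t \<in> {0..T}; t \<notin> Nx\<rbrakk> \<Longrightarrow> (x has_vector_derivative f (x t) (u t) t) (at t within {0..T})"
      using solves_derivative[OF x] by blast
    obtain Ny where Ny: "negligible Ny"
      "\<And>t T. \<lbrakk>t \<in> {0..T}; t \<notin> Ny\<rbrakk> \<Longrightarrow> (y has_vector_derivative f (y t) (u t) t) (at t within {0..T})"
      using solves_derivative[OF y] by blast
    have neg: "negligible (N' \<union> Nx \<union> Ny)" using k(3) Nx(1) Ny(1) by (intro negligible_Un)
    have "norm (x t - y t) \<le> (norm (x 0 - y 0) + integral {0..T} (\<lambda>_. 0)) * exp (integral {0..T} (k n))"
    proof (rule gronwall_differential[OF _ k(1,2) _ _ neg])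
      show "absolutely_continuous_on 0 T (\<lambda>t. x t - y t)"
        using x y \<open>T \<ge> 0\<close> by (intro absolutely_continuous_on_diff solves_absolutely_continuous_on)
      fix s assume s: "s \<in> {0..T}" "s \<notin> N' \<union> Nx \<union> Ny"
      show "((\<lambda>t. x t - y t) has_vector_derivative f (x s) (u s) s - f (y s) (u s) s) (at s within {0..T})"
        using s by (intro has_vector_derivative_diff Nx Ny) auto
      have "norm (f (x s) (u s) s - f (y s) (u s) s) \<le> k n s * norm (x s - y s)"
        using s n bd[rule_format, OF s(1)] by (intro k) auto
      then show "norm (f (x s) (u s) s - f (y s) (u s) s) \<le> k n s * norm (x s - y s) + 0" by simp
    qed (use t in \<open>auto simp: locally_integrable_def set_integrable_def\<close>)
    then show "norm (x t - y t) \<le> exp (integral {0..T} (k n)) * norm (x 0 - y 0)"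
      by (simp add: mult.commute)
  qed auto
qed

text \<open>
  Solutions are determined on the half-line only. In particular any solution agrees there with the
  representative selected by \<^const>\<open>traj\<close>.
\<close>

lemma solution_unique:
  assumes u: "u \<in> admissible_controls U"
    and x: "solves (\<lambda>t y. f y (u t) t) x" and y: "solves (\<lambda>t y. f y (u t) t) y"
    and eq: "x 0 = y 0" and "t \<ge> 0"
  shows "x t = y t"
proof -
  obtain B where B: "\<And>s. s \<in> {0..t} \<Longrightarrow> norm (x s) \<le> B"
    using absolutely_continuous_on_bounded[OF solves_absolutely_continuous_on[OF x \<open>t \<ge> 0\<close>]] by blast
  obtain D where D: "\<And>s. s \<in> {0..t} \<Longrightarrow> norm (y s) \<le> D"
    using absolutely_continuous_on_bounded[OF solves_absolutely_continuous_on[OF y \<open>t \<ge> 0\<close>]] by blast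
  have bd: "\<forall>s\<in>{0..t}. norm (x s) \<le> max B D \<and> norm (y s) \<le> max B D"
    using B D by (auto simp: le_max_iff_disj)
  obtain c where "\<forall>x y. solves (\<lambda>t y. f y (u t) t) x \<longrightarrow> solves (\<lambda>t y. f y (u t) t) y \<longrightarrow>
      (\<forall>s\<in>{0..t}. norm (x s) \<le> max B D \<and> norm (y s) \<le> max B D) \<longrightarrow>
      (\<forall>s\<in>{0..t}. norm (x s - y s) \<le> c * norm (x 0 - y 0))"
    using solution_lipschitz_estimate[OF u \<open>t \<ge> 0\<close>, of "max B D"] by blast
  from this[rule_format, OF x y bd[rule_format], of t] \<open>t \<ge> 0\<close> eq show ?thesis by simp
qed

lemma traj_bounded:
  assumes u: "u \<in> admissible_controls U" and "T \<ge> 0"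
  obtains r where "r > 0" "\<And>b t. \<lbrakk>norm b \<le> \<rho>; t \<in> {0..T}\<rbrakk> \<Longrightarrow> norm (traj f b u t) \<le> r"
proof -
  obtain L N where L: "locally_integrable L" "\<And>t. 0 \<le> L t" "negligible N"
    "\<And>t x. t \<in> {0..} - N \<Longrightarrow> norm (f x (u t) t) \<le> L t * (1 + norm x)"
    using growth_along_control[OF u] by blast
  define I where "I = integral {0..T} L"
  have I0: "I \<ge> 0"
    unfolding I_def using L by (intro Henstock_Kurzweil_Integration.integral_nonneg locally_integrable_integrable_on) auto
  show ?thesis
  proof (rule that[of "(\<bar>\<rho>\<bar> + I) * exp I + 1"])
    show "(\<bar>\<rho>\<bar> + I) * exp I + 1 > 0" using I0 by (intro add_nonneg_pos) auto
    fix b :: "real^'m" and t assume b: "norm b \<le> \<rho>" and t: "t \<in> {0..T}"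
    obtain Nx where Nx: "negligible Nx" "\<And>t T. \<lbrakk>t \<in> {0..T}; t \<notin> Nx\<rbrakk> \<Longrightarrow>
        (traj f b u has_vector_derivative f (traj f b u t) (u t) t) (at t within {0..T})"
      using solves_derivative[OF traj_solves[OF u]] by blast
    have "norm (traj f b u t) \<le> (norm (traj f b u 0) + integral {0..T} L) * exp (integral {0..T} L)"
    proof (rule gronwall_differential[OF _ L(1,2) L(1,2) negligible_Un[OF L(3) Nx(1)] Nx(2) _ t])
      show "absolutely_continuous_on 0 T (traj f b u)"
        by (intro solves_absolutely_continuous_on[OF traj_solves[OF u]] \<open>T \<ge> 0\<close>)
      fix s assume s: "s \<in> {0..T}" "s \<notin> N \<union> Nx"
      show "norm (f (traj f b u s) (u s) s) \<le> L s * norm (traj f b u s) + L s"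
        using L(4)[of s "traj f b u s"] s by (simp add: algebra_simps)
    qed auto
    also have "\<dots> = (norm b + I) * exp I" by (simp add: traj_initial[OF u] I_def)
    also have "\<dots> \<le> (\<bar>\<rho>\<bar> + I) * exp I" using b by (intro mult_right_mono) auto
    finally show "norm (traj f b u t) \<le> (\<bar>\<rho>\<bar> + I) * exp I + 1" by simp
  qed
qed

end

section \<open>The fundamental matrix, the adjoint identity and the gradient of the cost\<close>

lemma solves_product_has_integral:
  fixes prod :: "'a::real_normed_vector \<Rightarrow> 'b::real_normed_vector \<Rightarrow> 'c::euclidean_space"
  assumes prod: "bounded_bilinear prod" and x: "solves g x" and y: "solves h y" and "T \<ge> 0"
  shows "((\<lambda>t. prod (x t) (h t (y t)) + prod (g t (x t)) (y t)) has_integral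
      prod (x T) (y T) - prod (x 0) (y 0)) {0..T}"
proof -
  obtain Nx where Nx: "negligible Nx"
    "\<And>t T. \<lbrakk>t \<in> {0..T}; t \<notin> Nx\<rbrakk> \<Longrightarrow> (x has_vector_derivative g t (x t)) (at t within {0..T})"
    using solves_derivative[OF x] by blast
  obtain Ny where Ny: "negligible Ny"
    "\<And>t T. \<lbrakk>t \<in> {0..T}; t \<notin> Ny\<rbrakk> \<Longrightarrow> (y has_vector_derivative h t (y t)) (at t within {0..T})"
    using solves_derivative[OF y] by blast
  show ?thesis
  proof (rule absolutely_continuous_has_integral[OF \<open>T \<ge> 0\<close> _ negligible_Un[OF Nx(1) Ny(1)]])
    show "absolutely_continuous_on 0 T (\<lambda>t. prod (x t) (y t))"
      using x y \<open>T \<ge> 0\<close> by (intro bounded_bilinear.absolutely_continuous_on[OF prod] solves_absolutely_continuous_on)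
    show "((\<lambda>t. prod (x t) (y t)) has_vector_derivative
        prod (x t) (h t (y t)) + prod (g t (x t)) (y t)) (at t within {0..T})"
      if "t \<in> {0..T}" "t \<notin> Nx \<union> Ny" for t
      using that by (intro bounded_bilinear.has_vector_derivative[OF prod] Nx Ny) auto
  qed
qed

text \<open>
  Expanding J at the three pairs formed from b, \<open>\<xi>\<close> and z and adding up, the values of J cancel and
  (G(b) - G(\<open>\<xi>\<close>)) (z - \<open>\<xi>\<close>) is left, bounded by the three quadratic errors. Taking z - \<open>\<xi>\<close> parallel to
  G(b) - G(\<open>\<xi>\<close>) and of length |\<open>\<xi>\<close> - b| isolates the norm. The radius 1/2 keeps z in the unit ball. In this
  way continuity of the gradient comes for free from the expansion of the cost, without an estimate
  for the dependence of the fundamental matrix on the initial state.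
\<close>

lemma quadratic_expansion_gradient_lipschitz:
  fixes J :: "'a::real_inner \<Rightarrow> real"
  assumes J: "\<And>x y. \<lbrakk>x \<in> cball b 1; y \<in> cball b 1\<rbrakk> \<Longrightarrow> \<bar>J x - J y - G y \<bullet> (x - y)\<bar> \<le> \<sigma> * (norm (x - y))\<^sup>2"
    and "\<sigma> \<ge> 0" and \<xi>: "norm (\<xi> - b) \<le> 1 / 2"
  shows "norm (G \<xi> - G b) \<le> 6 * \<sigma> * norm (\<xi> - b)"
proof (cases "G \<xi> = G b \<or> \<xi> = b")
  case False
  define d where "d = G b - G \<xi>"
  define \<delta> where "\<delta> = norm (\<xi> - b)"
  define z where "z = \<xi> + (\<delta> / norm d) *\<^sub>R d"
  have "d \<noteq> 0" "\<delta> > 0" using False by (auto simp: d_def \<delta>_def)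
  have zx: "norm (z - \<xi>) = \<delta>" using \<open>d \<noteq> 0\<close> \<open>\<delta> > 0\<close> by (simp add: z_def)
  have zb: "norm (z - b) \<le> 2 * \<delta>"
    using norm_triangle_ineq[of "z - \<xi>" "\<xi> - b"] zx by (simp add: \<delta>_def)
  have in_ball: "\<xi> \<in> cball b 1" "b \<in> cball b 1" "z \<in> cball b 1"
    using \<xi> zb by (auto simp: dist_norm norm_minus_commute \<delta>_def)
  have "norm d * \<delta> = d \<bullet> (z - \<xi>)"
    using \<open>d \<noteq> 0\<close> by (simp add: z_def power2_norm_eq_inner[symmetric] power2_eq_square)
  also have "\<dots> = (J z - J \<xi> - G \<xi> \<bullet> (z - \<xi>)) + (J \<xi> - J b - G b \<bullet> (\<xi> - b)) - (J z - J b - G b \<bullet> (z - b))"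
    by (simp add: d_def inner_diff_left inner_diff_right)
  also have "\<dots> \<le> \<sigma> * (norm (z - \<xi>))\<^sup>2 + \<sigma> * (norm (\<xi> - b))\<^sup>2 + \<sigma> * (norm (z - b))\<^sup>2"
    using J[OF in_ball(3,1)] J[OF in_ball(1,2)] J[OF in_ball(3,2)] by linarith
  also have "\<dots> \<le> \<sigma> * \<delta>\<^sup>2 + \<sigma> * \<delta>\<^sup>2 + \<sigma> * (2 * \<delta>)\<^sup>2"
    using zx zb \<open>\<sigma> \<ge> 0\<close> by (intro add_mono mult_left_mono power_mono) (auto simp: \<delta>_def)
  also have "\<dots> = (6 * \<sigma> * \<delta>) * \<delta>" by (simp add: power2_eq_square)
  finally have "norm d \<le> 6 * \<sigma> * \<delta>" using \<open>\<delta> > 0\<close> by simp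
  then show ?thesis by (simp add: d_def \<delta>_def norm_minus_commute)
qed (use \<open>\<sigma> \<ge> 0\<close> in auto)

context control_problem
begin

lemma dominated_along_path:
  fixes F :: "real^'m \<Rightarrow> 'u \<Rightarrow> real \<Rightarrow> 'b::euclidean_space"
  assumes u: "u \<in> admissible_controls U" and F: "locally_integrably_lipschitz F"
    and x: "continuous_on {0..} x"
  obtains k N where "locally_integrable k" "\<And>t. 0 \<le> k t" "negligible N"
    "\<And>t. t \<in> {0..} - N \<Longrightarrow> norm (F (x t) (u t) t) \<le> k t"
proof -
  obtain k :: "nat \<Rightarrow> real \<Rightarrow> real" and N where k: "\<And>n. locally_integrable (k n)" "\<And>n t. 0 \<le> k n t" "negligible N"
    "\<And>n t y. \<lbrakk>t \<in> {0..real n} - N; norm y \<le> real n\<rbrakk> \<Longrightarrow> norm (F y (u t) t) \<le> k n t"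
    using locally_integrably_lipschitz_along_control[OF F admissible_bounded[OF u]] by metis
  define \<phi> where "\<phi> = (\<lambda>t. max t (norm (x (max 0 t))))"
  have "continuous_on UNIV (\<lambda>t. x (max 0 t))"
    by (rule continuous_on_compose2[OF x]) (auto intro!: continuous_intros)
  then have \<phi>: "continuous_on UNIV \<phi>" unfolding \<phi>_def by (intro continuous_intros)
  show ?thesis
  proof (rule that[of "\<lambda>t. k (nat \<lceil>\<phi> t\<rceil>) t" N])
    show "locally_integrable (\<lambda>t. k (nat \<lceil>\<phi> t\<rceil>) t)" by (rule locally_integrable_glue[OF k(1,2) \<phi>])
    fix t assume t: "t \<in> {0..} - N"
    define n where "n = nat \<lceil>\<phi> t\<rceil>"
    have "t \<le> real n" "norm (x (max 0 t)) \<le> real n" unfolding n_def \<phi>_def by linarith+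
    then show "norm (F (x t) (u t) t) \<le> k (nat \<lceil>\<phi> t\<rceil>) t"
      using t by (fold n_def, intro k(4)) (auto simp: max_def)
  qed (use k in auto)
qed

lemma locally_integrable_along_path:
  fixes F :: "real^'m \<Rightarrow> 'u \<Rightarrow> real \<Rightarrow> 'b::euclidean_space"
  assumes u: "u \<in> admissible_controls U" and F: "locally_integrably_lipschitz F"
    and car: "caratheodory (\<lambda>x t. F x (u t) t)" and x: "continuous_on {0..} x"
  shows "locally_integrable (\<lambda>t. F (x t) (u t) t)"
  unfolding locally_integrable_def
proof (intro allI impI)
  fix T :: real assume "T \<ge> 0"
  obtain k N where k: "locally_integrable k" "\<And>t. 0 \<le> k t" "negligible N"
    "\<And>t. t \<in> {0..} - N \<Longrightarrow> norm (F (x t) (u t) t) \<le> k t"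
    using dominated_along_path[OF u F x] by blast
  define h where "h = (\<lambda>t. if t \<in> N then 0 else F (x t) (u t) t)"
  have "(\<lambda>t. F (x t) (u t) t) \<in> borel_measurable (lebesgue_on {0..T})"
    by (rule measurable_restrict_mono[OF caratheodory_composition_measurable[OF car x]]) auto
  then have "h \<in> borel_measurable (lebesgue_on {0..T})"
    by (rule measurable_lebesgue_on_spike[OF _ _ k(3)]) (auto simp: h_def)
  then have "set_integrable lebesgue {0..T} h"
    by (rule measurable_bounded_by_integrable_imp_absolutely_integrable[OF _ _ locally_integrable_integrable_on[OF k(1)]])
       (use k(2,4) in \<open>auto simp: h_def\<close>)
  then show "set_integrable lebesgue {0..T} (\<lambda>t. F (x t) (u t) t)"
    by (rule absolutely_integrable_spike[OF _ k(3)]) (auto simp: h_def)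
qed

lemma traj_continuous: "u \<in> admissible_controls U \<Longrightarrow> continuous_on {0..} (traj f b u)"
  by (rule solves_continuous_on[OF traj_solves])

lemma
  assumes u: "u \<in> admissible_controls U"
  shows A_mat_initial: "A_mat f u \<xi> 0 = mat 1"
    and A_mat_solves: "solves (\<lambda>t M. D_f f (traj f \<xi> u t) (u t) t ** M) (A_mat f u \<xi>)"
proof -
  obtain k N where k: "locally_integrable k" "\<And>t. 0 \<le> k t" "negligible N"
    "\<And>t. t \<in> {0..} - N \<Longrightarrow> norm (D_f f (traj f \<xi> u t) (u t) t) \<le> k t"
    using dominated_along_path[OF u bounds_D_f traj_continuous[OF u]] by blast
  have "\<exists>A. A 0 = mat 1 \<and> solves (\<lambda>t M. D_f f (traj f \<xi> u t) (u t) t ** M) A"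
    by (rule linear_existence[OF bounded_bilinear_matrix_matrix_mult
        caratheodory_composition_measurable[OF carath_D_f[OF u] traj_continuous[OF u]] k])
  from someI_ex[OF this] show "A_mat f u \<xi> 0 = mat 1"
      "solves (\<lambda>t M. D_f f (traj f \<xi> u t) (u t) t ** M) (A_mat f u \<xi>)"
    unfolding A_mat_def by auto
qed

text \<open>
  The solution B of B' = - B D with B(0) = 1 satisfies (B A)' = 0 almost everywhere, hence B A = 1.
\<close>

lemma A_mat_invertible:
  assumes u: "u \<in> admissible_controls U" and "T \<ge> 0"
  shows "invertible (A_mat f u \<xi> T)"
proof -
  define D where "D = (\<lambda>t. D_f f (traj f \<xi> u t) (u t) t)"
  obtain k N where k: "locally_integrable k" "\<And>t. 0 \<le> k t" "negligible N"
    "\<And>t. t \<in> {0..} - N \<Longrightarrow> norm (D t) \<le> k t"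
    unfolding D_def using dominated_along_path[OF u bounds_D_f traj_continuous[OF u]] by blast
  have D: "D \<in> borel_measurable (lebesgue_on {0..})"
    unfolding D_def by (rule caratheodory_composition_measurable[OF carath_D_f[OF u] traj_continuous[OF u]])
  have "bounded_bilinear (\<lambda>(D :: real^'m^'m) (B :: real^'m^'m). - (B ** D))"
    unfolding bilinear_conv_bounded_bilinear[symmetric] bilinear_def
    by (auto intro!: linearI simp: matrix_matrix_mult_def vec_eq_iff sum.distrib algebra_simps sum_distrib_left)
  from linear_existence[OF this D k, of "mat 1"]
  obtain B where B: "B 0 = mat 1" "solves (\<lambda>t B. - (B ** D t)) B" by blast
  have A: "solves (\<lambda>t M. D t ** M) (A_mat f u \<xi>)" using A_mat_solves[OF u] by (simp add: D_def)
  have "((\<lambda>t. B t ** (D t ** A_mat f u \<xi> t) + (- (B t ** D t)) ** A_mat f u \<xi> t) has_integral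
      B T ** A_mat f u \<xi> T - B 0 ** A_mat f u \<xi> 0) {0..T}"
    by (rule solves_product_has_integral[OF bounded_bilinear_matrix_matrix_mult B(2) A \<open>T \<ge> 0\<close>])
  moreover have "B t ** (D t ** A_mat f u \<xi> t) + (- (B t ** D t)) ** A_mat f u \<xi> t = 0" for t
    by (simp add: matrix_mul_assoc bounded_bilinear.minus_left[OF bounded_bilinear_matrix_matrix_mult])
  ultimately have "B T ** A_mat f u \<xi> T = mat 1"
    by (simp add: B(1) A_mat_initial[OF u])
  then show ?thesis unfolding invertible_def using matrix_left_right_inverse by blast
qed

lemma locally_integrable_I_integrand:
  assumes u: "u \<in> admissible_controls U"
  shows "locally_integrable (I_integrand f f0 u \<xi>)"
  unfolding locally_integrable_def
proof (intro allI impI)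
  fix T :: real assume "T \<ge> 0"
  have D0: "locally_integrable (\<lambda>t. D_f0 f0 (traj f \<xi> u t) (u t) t)"
    by (rule locally_integrable_along_path[OF u bounds_D_f0 carath_D_f0[OF u] traj_continuous[OF u]])
  have A: "continuous_on {0..T} (A_mat f u \<xi>)"
    by (rule absolutely_continuous_on_imp_continuous_on[OF solves_absolutely_continuous_on[OF A_mat_solves[OF u] \<open>T \<ge> 0\<close>]])
  have "(\<lambda>t. (\<lambda>M v. v v* M) (A_mat f u \<xi> t) (D_f0 f0 (traj f \<xi> u t) (u t) t)) absolutely_integrable_on {0..T}"
  proof (rule absolutely_integrable_bounded_measurable_product[where h = "\<lambda>M v. v v* M"])
    show "bilinear (\<lambda>(M::real^'m^'m) (v::real^'m). v v* M)"
      unfolding bilinear_conv_bounded_bilinear by (rule bounded_bilinear.flip[OF bounded_bilinear_vector_matrix_mult])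
    show "A_mat f u \<xi> \<in> borel_measurable (lebesgue_on {0..T})"
      using A by (rule continuous_imp_measurable_on_sets_lebesgue) auto
    show "bounded (A_mat f u \<xi> ` {0..T})" using A by (intro compact_imp_bounded compact_continuous_image) auto
    show "(\<lambda>t. D_f0 f0 (traj f \<xi> u t) (u t) t) absolutely_integrable_on {0..T}"
      using D0 by (rule locally_integrable_set_integrable) simp
  qed auto
  then show "set_integrable lebesgue {0..T} (I_integrand f f0 u \<xi>)" by (simp add: I_integrand_def[abs_def])
qed

lemma I_vec_has_integral:
  assumes u: "u \<in> admissible_controls U"
  shows "(I_integrand f f0 u \<xi> has_integral I_vec f f0 u \<xi> T) {0..T}"
  unfolding I_vec_def
  by (rule has_integral_set_lebesgue[OF locally_integrable_set_integrable[OF locally_integrable_I_integrand[OF u]]]) simp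

lemma cost_has_integral:
  assumes u: "u \<in> admissible_controls U"
  shows "((\<lambda>t. f0 (traj f b u t) (u t) t) has_integral cost f f0 b u T) {0..T}"
  unfolding cost_def
  by (rule has_integral_set_lebesgue[OF locally_integrable_set_integrable[OF
        locally_integrable_along_path[OF u bounds_f0 carath_f0[OF u] traj_continuous[OF u]]]]) simp

text \<open>
  Differentiating the product of the costate and the fundamental matrix, the terms with the derivative
  of f cancel and only lam times the integrand of I remains.
\<close>

theorem adjoint_identity:
  assumes u: "u \<in> admissible_controls U" and x: "solves (\<lambda>t y. f y (u t) t) x"
    and p: "solves_adjoint f f0 x u p lam" and "T \<ge> 0"
  shows "p T v* A_mat f u (x 0) T = p 0 + lam *\<^sub>R I_vec f f0 u (x 0) T"
proof -
  let ?A = "A_mat f u (x 0)"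
  have xt: "traj f (x 0) u t = x t" if "t \<ge> 0" for t
    by (rule solution_unique[OF u traj_solves[OF u] x traj_initial[OF u] that])
  have "((\<lambda>t. p t v* (D_f f (traj f (x 0) u t) (u t) t ** ?A t)
        + (- gradient (\<lambda>y. hamiltonian f f0 y (u t) (p t) lam t) (x t)) v* ?A t) has_integral
      p T v* ?A T - p 0 v* ?A 0) {0..T}"
    by (rule solves_product_has_integral[OF bounded_bilinear_vector_matrix_mult
          p[unfolded solves_adjoint_def] A_mat_solves[OF u] \<open>T \<ge> 0\<close>])
  then have "((\<lambda>t. lam *\<^sub>R I_integrand f f0 u (x 0) t) has_integral p T v* ?A T - p 0 v* ?A 0) {0..T}"
  proof (rule has_integral_eq[rotated])
    fix t assume t: "t \<in> {0..T}"
    interpret vm: bounded_bilinear "(v*) :: real^'m \<Rightarrow> real^'m^'m \<Rightarrow> real^'m"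
      by (rule bounded_bilinear_vector_matrix_mult)
    show "p t v* (D_f f (traj f (x 0) u t) (u t) t ** ?A t)
        + (- gradient (\<lambda>y. hamiltonian f f0 y (u t) (p t) lam t) (x t)) v* ?A t
        = lam *\<^sub>R I_integrand f f0 u (x 0) t"
      using t by (simp add: xt gradient_hamiltonian I_integrand_def vm.diff_left vm.minus_left
          vm.scaleR_left vector_matrix_mul_assoc)
  qed
  moreover have "((\<lambda>t. lam *\<^sub>R I_integrand f f0 u (x 0) t) has_integral lam *\<^sub>R I_vec f f0 u (x 0) T) {0..T}"
    by (rule has_integral_cmul[OF I_vec_has_integral[OF u]])
  ultimately have "p T v* ?A T - p 0 v* ?A 0 = lam *\<^sub>R I_vec f f0 u (x 0) T"
    by (rule has_integral_unique)
  then show ?thesis by (simp add: A_mat_initial[OF u] algebra_simps)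
qed

text \<open>
  The vector I(y;T) is the gradient of the cost in the initial state, with a quadratic remainder that
  is uniform over the unit ball around b. Let X and Y be the trajectories from \<open>\<xi>\<close> and y, A the fundamental
  matrix along Y and e = X - Y - A (\<open>\<xi>\<close> - y). Gronwall's inequality gives |X - Y| = O(|\<open>\<xi>\<close> - y|). The
  first-order remainder of f along the segment from Y to X is then quadratic, and it is the
  inhomogeneity of the differential inequality for e, which starts at 0; hence e is quadratic. The
  same expansion of the running cost, integrated over [0,T], gives the claim.
\<close>

theorem cost_quadratic_estimate:
  assumes u: "u \<in> admissible_controls U" and "T \<ge> 0"
  shows "\<exists>\<sigma>\<ge>0. \<forall>\<xi>\<in>cball b 1. \<forall>y\<in>cball b 1.
      \<bar>cost f f0 \<xi> u T - cost f f0 y u T - I_vec f f0 u y T \<bullet> (\<xi> - y)\<bar> \<le> \<sigma> * (norm (\<xi> - y))\<^sup>2"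
proof -
  interpret mv: bounded_bilinear "(*v) :: real^'m^'m \<Rightarrow> real^'m \<Rightarrow> real^'m"
    by (rule bounded_bilinear_matrix_vector_mult)
  obtain M where M: "M > 0" "\<And>(A :: real^'m^'m) h. norm (A *v h) \<le> norm A * norm h * M"
    using mv.pos_bounded by blast
  obtain r where r: "r > 0" "\<And>y t. \<lbrakk>norm y \<le> norm b + 1; t \<in> {0..T}\<rbrakk> \<Longrightarrow> norm (traj f y u t) \<le> r"
    using traj_bounded[OF u \<open>T \<ge> 0\<close>] by metis
  obtain c where "c \<ge> 0" and c: "\<forall>x y. solves (\<lambda>t y. f y (u t) t) x \<longrightarrow> solves (\<lambda>t y. f y (u t) t) y \<longrightarrow>
      (\<forall>s\<in>{0..T}. norm (x s) \<le> r \<and> norm (y s) \<le> r) \<longrightarrow>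
      (\<forall>t\<in>{0..T}. norm (x t - y t) \<le> c * norm (x 0 - y 0))"
    using solution_lipschitz_estimate[OF u \<open>T \<ge> 0\<close>, of r] by blast
  obtain n where n: "max T r \<le> real n" using real_arch_simple by blast
  obtain kf :: "nat \<Rightarrow> real \<Rightarrow> real" and Nf where kf: "\<And>n. locally_integrable (kf n)" "\<And>n t. 0 \<le> kf n t" "negligible Nf"
    "\<And>n t y. \<lbrakk>t \<in> {0..real n} - Nf; norm y \<le> real n\<rbrakk> \<Longrightarrow> norm (D_f f y (u t) t) \<le> kf n t"
    "\<And>n t y z. \<lbrakk>t \<in> {0..real n} - Nf; norm y \<le> real n; norm z \<le> real n\<rbrakk> \<Longrightarrow>
        norm (D_f f y (u t) t - D_f f z (u t) t) \<le> kf n t * norm (y - z)"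
    using locally_integrably_lipschitz_along_control[OF bounds_D_f admissible_bounded[OF u]] by metis
  obtain k0 :: "nat \<Rightarrow> real \<Rightarrow> real" and N0 where k0: "\<And>n. locally_integrable (k0 n)" "\<And>n t. 0 \<le> k0 n t" "negligible N0"
    "\<And>n t y. \<lbrakk>t \<in> {0..real n} - N0; norm y \<le> real n\<rbrakk> \<Longrightarrow> norm (D_f0 f0 y (u t) t) \<le> k0 n t"
    "\<And>n t y z. \<lbrakk>t \<in> {0..real n} - N0; norm y \<le> real n; norm z \<le> real n\<rbrakk> \<Longrightarrow>
        norm (D_f0 f0 y (u t) t - D_f0 f0 z (u t) t) \<le> k0 n t * norm (y - z)"
    using locally_integrably_lipschitz_along_control[OF bounds_D_f0 admissible_bounded[OF u]] by metis
  define k where "k = (\<lambda>t. M * kf n t)"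
  have k: "locally_integrable k" "\<And>t. 0 \<le> k t"
    using kf(1)[of n] kf(2) M(1) unfolding k_def locally_integrable_def by (auto intro!: set_integrable_mult_right)
  define C where "C = c\<^sup>2 * integral {0..T} k * exp (integral {0..T} k)"
  have ki: "k integrable_on {0..T}" and k0i: "k0 n integrable_on {0..T}"
    using k(1) k0(1) by (auto intro: locally_integrable_integrable_on)
  have "C \<ge> 0" unfolding C_def using k(2) ki by (intro mult_nonneg_nonneg Henstock_Kurzweil_Integration.integral_nonneg) auto
  define \<sigma> where "\<sigma> = (c\<^sup>2 + C) * integral {0..T} (k0 n)"
  have "\<sigma> \<ge> 0" unfolding \<sigma>_def using \<open>C \<ge> 0\<close> k0(2) k0i
    by (intro mult_nonneg_nonneg Henstock_Kurzweil_Integration.integral_nonneg) auto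
  moreover have "\<bar>cost f f0 \<xi> u T - cost f f0 y u T - I_vec f f0 u y T \<bullet> (\<xi> - y)\<bar> \<le> \<sigma> * (norm (\<xi> - y))\<^sup>2"
    if \<xi>: "\<xi> \<in> cball b 1" and y: "y \<in> cball b 1" for \<xi> y
  proof -
    define X where "X = traj f \<xi> u"
    define Y where "Y = traj f y u"
    define A where "A = A_mat f u y"
    define h where "h = \<xi> - y"
    define e where "e = (\<lambda>t. X t - Y t - A t *v h)"
    have "norm \<xi> \<le> norm b + 1" "norm y \<le> norm b + 1"
      using \<xi> y norm_triangle_sub[of \<xi> b] norm_triangle_sub[of y b] by (auto simp: dist_norm norm_minus_commute)
    then have bX: "norm (X t) \<le> r" and bY: "norm (Y t) \<le> r" if "t \<in> {0..T}" for t
      using r(2) that by (auto simp: X_def Y_def)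
    have X: "solves (\<lambda>t y. f y (u t) t) X" "X 0 = \<xi>" and Y: "solves (\<lambda>t y. f y (u t) t) Y" "Y 0 = y"
      and A: "solves (\<lambda>t M. D_f f (Y t) (u t) t ** M) A" "A 0 = mat 1"
      by (auto simp: X_def Y_def A_def traj_solves[OF u] traj_initial[OF u] A_mat_solves[OF u] A_mat_initial[OF u])
    have XY: "norm (X t - Y t) \<le> c * norm h" if "t \<in> {0..T}" for t
      using c X Y bX bY that by (auto simp: h_def)
    obtain NX where NX: "negligible NX"
      "\<And>t T. \<lbrakk>t \<in> {0..T}; t \<notin> NX\<rbrakk> \<Longrightarrow> (X has_vector_derivative f (X t) (u t) t) (at t within {0..T})"
      using solves_derivative[OF X(1)] by blast
    obtain NY where NY: "negligible NY"
      "\<And>t T. \<lbrakk>t \<in> {0..T}; t \<notin> NY\<rbrakk> \<Longrightarrow> (Y has_vector_derivative f (Y t) (u t) t) (at t within {0..T})"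
      using solves_derivative[OF Y(1)] by blast
    obtain NA where NA: "negligible NA"
      "\<And>t T. \<lbrakk>t \<in> {0..T}; t \<notin> NA\<rbrakk> \<Longrightarrow> (A has_vector_derivative D_f f (Y t) (u t) t ** A t) (at t within {0..T})"
      using solves_derivative[OF A(1)] by blast
    have neg: "negligible (Nf \<union> NX \<union> NY \<union> NA)" using kf(3) NX(1) NY(1) NA(1) by (intro negligible_Un)
    have seg: "norm z \<le> real n" if "t \<in> {0..T}" "z \<in> closed_segment (Y t) (X t)" for t z
    proof -
      have "closed_segment (Y t) (X t) \<subseteq> cball 0 r"
        using bX[OF that(1)] bY[OF that(1)] by (intro closed_segment_subset) auto
      then show ?thesis using that(2) n by auto
    qed
    define r1 where "r1 = (\<lambda>t. f (X t) (u t) t - f (Y t) (u t) t - D_f f (Y t) (u t) t *v (X t - Y t))"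
    have rem: "norm (r1 t) \<le> k t * (c * norm h)\<^sup>2"
      if t: "t \<in> {0..T}" "t \<notin> Nf" for t
    proof -
      have t0: "t \<ge> 0" "t \<in> {0..real n} - Nf" using t n by auto
      have "norm (r1 t) \<le> k t * (norm (X t - Y t))\<^sup>2"
        unfolding r1_def
      proof (rule first_order_remainder[OF D_f_has_derivative[OF t0(1)] _ k(2)])
        fix z h assume z: "z \<in> closed_segment (Y t) (X t)"
        have "norm (D_f f z (u t) t *v h - D_f f (Y t) (u t) t *v h) = norm ((D_f f z (u t) t - D_f f (Y t) (u t) t) *v h)"
          by (simp add: mv.diff_left)
        also have "\<dots> \<le> norm (D_f f z (u t) t - D_f f (Y t) (u t) t) * norm h * M" by (rule M)
        also have "\<dots> \<le> kf n t * norm (z - Y t) * norm h * M"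
          using seg[OF t(1) z] seg[OF t(1), of "Y t"] M(1) t0(2) by (intro mult_right_mono kf(5)) auto
        finally show "norm (D_f f z (u t) t *v h - D_f f (Y t) (u t) t *v h) \<le> k t * norm (z - Y t) * norm h"
          by (simp add: k_def algebra_simps)
      qed
      also have "\<dots> \<le> k t * (c * norm h)\<^sup>2" using XY[OF t(1)] by (intro mult_left_mono power_mono k) auto
      finally show ?thesis .
    qed
    have e_bound: "norm (e t) \<le> C * (norm h)\<^sup>2" if t: "t \<in> {0..T}" for t
    proof -
      have "norm (e t) \<le> (norm (e 0) + integral {0..T} (\<lambda>t. k t * (c * norm h)\<^sup>2)) * exp (integral {0..T} k)"
      proof (rule gronwall_differential[OF _ k _ _ neg _ _ t])
        show "absolutely_continuous_on 0 T e" unfolding e_def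
          using X(1) Y(1) A(1) \<open>T \<ge> 0\<close>
          by (intro absolutely_continuous_on_diff bounded_linear.absolutely_continuous_on[OF mv.bounded_linear_left]
              solves_absolutely_continuous_on)
        show "locally_integrable (\<lambda>t. k t * (c * norm h)\<^sup>2)"
          using k(1) unfolding locally_integrable_def by (auto intro!: set_integrable_mult_left)
        show "0 \<le> k t * (c * norm h)\<^sup>2" for t using k(2)[of t] by simp
        fix s assume s: "s \<in> {0..T}" "s \<notin> Nf \<union> NX \<union> NY \<union> NA"
        let ?d = "f (X s) (u s) s - f (Y s) (u s) s - (D_f f (Y s) (u s) s ** A s) *v h"
        show "(e has_vector_derivative ?d) (at s within {0..T})" unfolding e_def
          using s by (intro has_vector_derivative_diff bounded_linear.has_vector_derivative[OF mv.bounded_linear_left] NX NY NA) auto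
        have "?d = r1 s + D_f f (Y s) (u s) s *v e s"
          by (simp add: r1_def e_def mv.diff_right matrix_vector_mul_assoc)
        also have "norm \<dots> \<le> k s * (c * norm h)\<^sup>2 + k s * norm (e s)"
        proof (rule norm_triangle_mono)
          show "norm (r1 s) \<le> k s * (c * norm h)\<^sup>2"
            using s by (intro rem) auto
          have "norm (D_f f (Y s) (u s) s *v e s) \<le> norm (D_f f (Y s) (u s) s) * norm (e s) * M" by (rule M)
          also have "\<dots> \<le> kf n s * norm (e s) * M"
            using s n M(1) bY[OF s(1)] by (intro mult_right_mono kf(4)) auto
          finally show "norm (D_f f (Y s) (u s) s *v e s) \<le> k s * norm (e s)" by (simp add: k_def algebra_simps)
        qed
        finally show "norm ?d \<le> k s * norm (e s) + k s * (c * norm h)\<^sup>2" by simp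
      qed
      also have "e 0 = 0" by (simp add: e_def X Y A h_def)
      also have "integral {0..T} (\<lambda>t. k t * (c * norm h)\<^sup>2) = integral {0..T} k * (c * norm h)\<^sup>2"
        by (rule integral_mult_left)
      finally show ?thesis by (simp add: C_def power_mult_distrib algebra_simps)
    qed
    have "((\<lambda>t. f0 (X t) (u t) t - f0 (Y t) (u t) t - I_integrand f f0 u y t \<bullet> h) has_integral
        cost f f0 \<xi> u T - cost f f0 y u T - I_vec f f0 u y T \<bullet> h) {0..T}"
      unfolding X_def Y_def
      by (intro has_integral_diff cost_has_integral[OF u]
          has_integral_linear[OF I_vec_has_integral[OF u] bounded_linear_inner_left, unfolded o_def])
    then have int: "(\<lambda>t. f0 (X t) (u t) t - f0 (Y t) (u t) t - I_integrand f f0 u y t \<bullet> h) integrable_on {0..T}"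
      "integral {0..T} (\<lambda>t. f0 (X t) (u t) t - f0 (Y t) (u t) t - I_integrand f f0 u y t \<bullet> h)
        = cost f f0 \<xi> u T - cost f f0 y u T - I_vec f f0 u y T \<bullet> h"
      by (auto simp: integral_unique has_integral_integrable)
    have "norm (integral {0..T} (\<lambda>t. f0 (X t) (u t) t - f0 (Y t) (u t) t - I_integrand f f0 u y t \<bullet> h))
        \<le> integral {0..T} (\<lambda>t. k0 n t * ((c\<^sup>2 + C) * (norm h)\<^sup>2))"
    proof (rule integral_norm_bound_ae[OF int(1) _ k0(3)])
      show "(\<lambda>t. k0 n t * ((c\<^sup>2 + C) * (norm h)\<^sup>2)) integrable_on {0..T}"
        by (rule integrable_on_mult_left[OF k0i])
      fix t assume t: "t \<in> {0..T} - N0"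
      then have t0: "t \<ge> 0" "t \<in> {0..T}" "t \<in> {0..real n} - N0" using n by auto
      let ?D = "D_f0 f0 (Y t) (u t) t"
      have "I_integrand f f0 u y t \<bullet> h = ?D \<bullet> (A t *v h)"
        by (simp add: I_integrand_def Y_def A_def dot_lmul_matrix)
      then have "f0 (X t) (u t) t - f0 (Y t) (u t) t - I_integrand f f0 u y t \<bullet> h
          = (f0 (X t) (u t) t - f0 (Y t) (u t) t - ?D \<bullet> (X t - Y t)) + ?D \<bullet> e t"
        by (simp add: e_def inner_diff_right)
      also have "norm \<dots> \<le> k0 n t * (c * norm h)\<^sup>2 + k0 n t * (C * (norm h)\<^sup>2)"
      proof (rule norm_triangle_mono)
        have "norm (f0 (X t) (u t) t - f0 (Y t) (u t) t - ?D \<bullet> (X t - Y t)) \<le> k0 n t * (norm (X t - Y t))\<^sup>2"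
        proof (rule first_order_remainder[OF D_f0_has_derivative[OF t0(1)] _ k0(2)])
          fix z h assume z: "z \<in> closed_segment (Y t) (X t)"
          have "norm (D_f0 f0 z (u t) t \<bullet> h - ?D \<bullet> h) \<le> norm (D_f0 f0 z (u t) t - ?D) * norm h"
            using Cauchy_Schwarz_ineq2[of "D_f0 f0 z (u t) t - ?D" h] by (simp add: inner_diff_left)
          also have "\<dots> \<le> k0 n t * norm (z - Y t) * norm h"
            using seg[OF t0(2) z] seg[OF t0(2), of "Y t"] t0(3) by (intro mult_right_mono k0(5)) auto
          finally show "norm (D_f0 f0 z (u t) t \<bullet> h - ?D \<bullet> h) \<le> k0 n t * norm (z - Y t) * norm h" .
        qed
        also have "\<dots> \<le> k0 n t * (c * norm h)\<^sup>2" using XY[OF t0(2)] by (intro mult_left_mono power_mono k0) auto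
        finally show "norm (f0 (X t) (u t) t - f0 (Y t) (u t) t - ?D \<bullet> (X t - Y t)) \<le> k0 n t * (c * norm h)\<^sup>2" .
        have "norm (?D \<bullet> e t) \<le> norm ?D * norm (e t)" using Cauchy_Schwarz_ineq2[of ?D "e t"] by simp
        also have "\<dots> \<le> k0 n t * (C * (norm h)\<^sup>2)"
          using n bY[OF t0(2)] e_bound[OF t0(2)] t0(3) by (intro mult_mono k0(4) k0(2)) auto
        finally show "norm (?D \<bullet> e t) \<le> k0 n t * (C * (norm h)\<^sup>2)" .
      qed
      also have "\<dots> = k0 n t * ((c\<^sup>2 + C) * (norm h)\<^sup>2)" by (simp add: algebra_simps power_mult_distrib)
      finally show "norm (f0 (X t) (u t) t - f0 (Y t) (u t) t - I_integrand f f0 u y t \<bullet> h)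
          \<le> k0 n t * ((c\<^sup>2 + C) * (norm h)\<^sup>2)" .
    qed
    also have "\<dots> = integral {0..T} (k0 n) * ((c\<^sup>2 + C) * (norm h)\<^sup>2)" by (rule integral_mult_left)
    finally show ?thesis unfolding int(2) by (simp add: \<sigma>_def h_def algebra_simps)
  qed
  ultimately show ?thesis by blast
qed

lemma I_vec_lipschitz_at:
  assumes u: "u \<in> admissible_controls U" and "T \<ge> 0"
  shows "\<exists>c. \<forall>\<xi>. norm (\<xi> - b) \<le> 1 / 2 \<longrightarrow> norm (I_vec f f0 u \<xi> T - I_vec f f0 u b T) \<le> c * norm (\<xi> - b)"
proof -
  obtain \<sigma> where \<sigma>: "\<sigma> \<ge> 0" "\<And>\<xi> y. \<lbrakk>\<xi> \<in> cball b 1; y \<in> cball b 1\<rbrakk> \<Longrightarrow>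
      \<bar>cost f f0 \<xi> u T - cost f f0 y u T - I_vec f f0 u y T \<bullet> (\<xi> - y)\<bar> \<le> \<sigma> * (norm (\<xi> - y))\<^sup>2"
    using cost_quadratic_estimate[OF assms, of b] by blast
  show ?thesis
    using quadratic_expansion_gradient_lipschitz[where J = "\<lambda>\<xi>. cost f f0 \<xi> u T" and G = "\<lambda>\<xi>. I_vec f f0 u \<xi> T",
        OF \<sigma>(2) \<sigma>(1)] by blast
qed

lemma I_vec_isCont:
  assumes u: "u \<in> admissible_controls U" and "T \<ge> 0"
  shows "isCont (\<lambda>\<xi>. I_vec f f0 u \<xi> T) b"
proof -
  obtain c where c: "\<And>\<xi>. norm (\<xi> - b) \<le> 1 / 2 \<Longrightarrow> norm (I_vec f f0 u \<xi> T - I_vec f f0 u b T) \<le> c * norm (\<xi> - b)"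
    using I_vec_lipschitz_at[OF assms, of b] by blast
  have "((\<lambda>\<xi>. I_vec f f0 u \<xi> T - I_vec f f0 u b T) \<longlongrightarrow> 0) (at b)"
  proof (rule Lim_null_comparison)
    have "\<forall>\<^sub>F \<xi> in at b. dist \<xi> b < 1 / 2" by (auto simp: eventually_at intro!: exI[of _ "1 / 2"])
    then show "\<forall>\<^sub>F \<xi> in at b. norm (I_vec f f0 u \<xi> T - I_vec f f0 u b T) \<le> c * norm (\<xi> - b)"
      by eventually_elim (auto intro!: c simp: dist_norm)
    have "((\<lambda>\<xi>. c * norm (\<xi> - b)) \<longlongrightarrow> c * norm (b - b)) (at b)" by (intro tendsto_intros)
    then show "((\<lambda>\<xi>. c * norm (\<xi> - b)) \<longlongrightarrow> 0) (at b)" by simp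
  qed
  then show ?thesis unfolding isCont_def by (rule LIM_zero_cancel)
qed

end

section \<open>Transversality\<close>

text \<open>
  At distance at least \<open>\<mu>\<close> a linear function is dominated by a multiple of the squared distance, so the
  global inequality defining proximal normals needs to be checked near the base point only.
\<close>

lemma proximal_normal_coneI_local:
  assumes \<sigma>: "\<sigma> \<ge> 0" and "\<mu> > 0"
    and le: "\<And>\<xi>. \<lbrakk>\<xi> \<in> C; norm (\<xi> - b) \<le> \<mu>\<rbrakk> \<Longrightarrow> \<eta> \<bullet> (\<xi> - b) \<le> \<sigma> * (norm (\<xi> - b))\<^sup>2"
  shows "\<eta> \<in> proximal_normal_cone C b"
proof -
  have "\<eta> \<bullet> (\<xi> - b) \<le> (\<sigma> + norm \<eta> / \<mu>) * (norm (\<xi> - b))\<^sup>2" if "\<xi> \<in> C" for \<xi>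
  proof (cases "norm (\<xi> - b) \<le> \<mu>")
    case True
    have "0 \<le> norm \<eta> / \<mu> * (norm (\<xi> - b))\<^sup>2" using \<open>\<mu> > 0\<close> by simp
    with le[OF that True] show ?thesis by (simp add: distrib_right)
  next
    case False
    have "\<eta> \<bullet> (\<xi> - b) \<le> norm \<eta> * norm (\<xi> - b)" by (rule norm_cauchy_schwarz)
    also have "\<dots> \<le> norm \<eta> * ((norm (\<xi> - b))\<^sup>2 / \<mu>)"
    proof (rule mult_left_mono)
      have "\<mu> * norm (\<xi> - b) \<le> norm (\<xi> - b) * norm (\<xi> - b)" using False by (intro mult_right_mono) auto
      then show "norm (\<xi> - b) \<le> (norm (\<xi> - b))\<^sup>2 / \<mu>"
        using \<open>\<mu> > 0\<close> by (simp add: power2_eq_square pos_le_divide_eq mult.commute)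
    qed simp
    also have "\<dots> \<le> (\<sigma> + norm \<eta> / \<mu>) * (norm (\<xi> - b))\<^sup>2" using \<sigma> by (simp add: distrib_right)
    finally show ?thesis .
  qed
  moreover have "\<sigma> + norm \<eta> / \<mu> \<ge> 0" using \<sigma> \<open>\<mu> > 0\<close> by simp
  ultimately show ?thesis unfolding proximal_normal_cone_def by blast
qed

lemma norm_diff_square_expand:
  fixes x y z :: "'a::real_inner"
  shows "(norm (z - y))\<^sup>2 = (norm (x - y))\<^sup>2 + 2 * ((x - y) \<bullet> (z - x)) + (norm (z - x))\<^sup>2"
  by (simp add: power2_norm_eq_inner inner_diff_left inner_diff_right inner_commute)

lemma quadratic_expansion_continuous_on:
  fixes J :: "'a::real_inner \<Rightarrow> real"
  assumes J: "\<And>x y. \<lbrakk>x \<in> S; y \<in> S\<rbrakk> \<Longrightarrow> \<bar>J x - J y - G y \<bullet> (x - y)\<bar> \<le> \<sigma> * (norm (x - y))\<^sup>2"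
  shows "continuous_on S J"
  unfolding continuous_on_def
proof
  fix y assume y: "y \<in> S"
  have "((\<lambda>x. J x - J y - G y \<bullet> (x - y)) \<longlongrightarrow> 0) (at y within S)"
  proof (rule Lim_null_comparison)
    show "\<forall>\<^sub>F x in at y within S. norm (J x - J y - G y \<bullet> (x - y)) \<le> \<sigma> * (norm (x - y))\<^sup>2"
      using J[OF _ y] by (auto simp: eventually_at_filter)
    have "((\<lambda>x. \<sigma> * (norm (x - y))\<^sup>2) \<longlongrightarrow> \<sigma> * (norm (y - y))\<^sup>2) (at y within S)" by (intro tendsto_intros)
    then show "((\<lambda>x. \<sigma> * (norm (x - y))\<^sup>2) \<longlongrightarrow> 0) (at y within S)" by simp
  qed
  moreover have "((\<lambda>x. J y + G y \<bullet> (x - y)) \<longlongrightarrow> J y + G y \<bullet> (y - y)) (at y within S)"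
    by (intro tendsto_intros)
  ultimately have "((\<lambda>x. (J x - J y - G y \<bullet> (x - y)) + (J y + G y \<bullet> (x - y))) \<longlongrightarrow> 0 + (J y + G y \<bullet> (y - y))) (at y within S)"
    by (rule tendsto_add)
  then show "(J \<longlongrightarrow> J y) (at y within S)" by simp
qed

text \<open>
  An approximate Fermat rule for minimising l + J over C. The variable is doubled: the function
  l(x) + J(y) + a |y - b|^2 + k |x - y|^2 is minimised over x near b and y in C near b. The penalty
  with weight a localises y strictly inside its ball, because near-minimality of b leaves at most
  \<open>\<rho>^3\<close> to gain; the penalty with weight k ties x to y. Stationarity in x then yields a proximal
  subgradient of l, and stationarity in y a proximal normal of C, in which the coupling terms cancel
  and the penalty that pulls y towards b contributes at most \<open>4 \<rho>^2\<close>.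
\<close>

theorem approximate_fermat_rule:
  fixes l J :: "'a::euclidean_space \<Rightarrow> real"
  assumes C: "closed C" "b \<in> C" and L: "L-lipschitz_on (cball b R) l" "L > 0"
    and contJ: "continuous_on (cball b R) J"
    and J: "\<And>x y. \<lbrakk>x \<in> cball b R; y \<in> cball b R\<rbrakk> \<Longrightarrow> J x \<le> J y + G y \<bullet> (x - y) + \<sigma> * (norm (x - y))\<^sup>2" "\<sigma> \<ge> 0"
    and \<rho>: "0 < \<rho>" "2 * \<rho> < R"
    and min: "\<And>x. x \<in> C \<Longrightarrow> l b + J b - \<rho> ^ 3 \<le> l x + J x"
  shows "\<exists>x y \<zeta> \<eta>. norm (x - b) \<le> 2 * \<rho> \<and> y \<in> C \<and> norm (y - b) \<le> \<rho> \<and>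
      \<zeta> \<in> proximal_subdifferential l x \<and> \<eta> \<in> proximal_normal_cone C y \<and>
      norm \<zeta> \<le> 2 * L \<and> norm (\<zeta> + \<eta> + G y) \<le> 4 * \<rho>\<^sup>2"
proof -
  (* a \<rho>^2 is twice the gap \<rho>^3; k is large enough for L / k \<le> \<rho> and L^2 / k < \<rho>^3 *)
  define a where "a = 2 * \<rho>"
  define k where "k = 2 * L\<^sup>2 / \<rho> ^ 3 + L / \<rho>"
  have "k > 0" using \<rho> L(2) by (simp add: k_def add_pos_pos)
  have k1: "L / k \<le> \<rho>"
  proof -
    have "L = L / \<rho> * \<rho>" using \<rho> by simp
    also have "\<dots> \<le> k * \<rho>" using \<rho> L(2) by (intro mult_right_mono) (auto simp: k_def)
    finally show ?thesis using \<open>k > 0\<close> by (simp add: pos_divide_le_eq mult.commute)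
  qed
  have k2: "L * (L / k) < \<rho> ^ 3"
  proof -
    have "2 * L\<^sup>2 = 2 * L\<^sup>2 / \<rho> ^ 3 * \<rho> ^ 3" using \<rho> by simp
    also have "\<dots> \<le> k * \<rho> ^ 3" using \<rho> L(2) by (intro mult_right_mono) (auto simp: k_def)
    finally have "2 * L\<^sup>2 \<le> k * \<rho> ^ 3" .
    moreover have "L\<^sup>2 > 0" using L(2) by simp
    ultimately have "L\<^sup>2 < k * \<rho> ^ 3" by linarith
    then show ?thesis using \<open>k > 0\<close> by (simp add: pos_divide_less_eq power2_eq_square mult.commute)
  qed
  define \<Theta> where "\<Theta> = (\<lambda>(x, y). l x + J y + a * (norm (y - b))\<^sup>2 + k * (norm (x - y))\<^sup>2)"
  define S where "S = cball b R \<times> (C \<inter> cball b \<rho>)"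
  have "compact S" unfolding S_def using C(1) by (intro compact_Times closed_Int_compact) auto
  moreover have "S \<noteq> {}" using C(2) \<rho> by (auto simp: S_def)
  moreover have "continuous_on S \<Theta>"
  proof -
    have cl: "continuous_on (cball b R) l" by (rule lipschitz_on_continuous_on[OF L(1)])
    have "continuous_on S (\<lambda>p. l (fst p))"
      by (rule continuous_on_compose2[OF cl]) (auto simp: S_def intro!: continuous_intros)
    moreover have "continuous_on S (\<lambda>p. J (snd p))"
      by (rule continuous_on_compose2[OF contJ]) (use \<rho> in \<open>auto simp: S_def intro!: continuous_intros\<close>)
    ultimately show ?thesis unfolding \<Theta>_def case_prod_unfold by (intro continuous_intros)
  qed
  ultimately have "\<exists>p\<in>S. \<forall>q\<in>S. \<Theta> p \<le> \<Theta> q" by (rule continuous_attains_inf)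
  then obtain p where p: "p \<in> S" "\<And>q. q \<in> S \<Longrightarrow> \<Theta> p \<le> \<Theta> q" by blast
  obtain x y where pxy: "p = (x, y)" by (metis surj_pair)
  have x: "x \<in> cball b R" and y: "y \<in> C" "y \<in> cball b \<rho>" using p(1) by (auto simp: pxy S_def)
  have min': "l x + J y + a * (norm (y - b))\<^sup>2 + k * (norm (x - y))\<^sup>2
      \<le> l x' + J y' + a * (norm (y' - b))\<^sup>2 + k * (norm (x' - y'))\<^sup>2"
    if "x' \<in> cball b R" "y' \<in> C" "y' \<in> cball b \<rho>" for x' y'
    using p(2)[of "(x', y')"] that by (simp add: \<Theta>_def S_def pxy)
  have y1: "y \<in> cball b R" using y(2) \<rho> by auto
  define d where "d = norm (x - y)"
  have lxy: "l y \<le> l x + L * d"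
    using lipschitz_onD[OF L(1) x y1] by (simp add: d_def dist_norm dist_real_def)
  have kd: "k * d \<le> L"
  proof (cases "d = 0")
    case False
    have "k * d\<^sup>2 \<le> L * d" using min'[OF y1 y] lxy by (simp add: d_def)
    moreover have "d > 0" using False by (simp add: d_def)
    ultimately show ?thesis by (simp add: power2_eq_square)
  qed (use L(2) in simp)
  have dk: "d \<le> L / k" using kd \<open>k > 0\<close> by (simp add: pos_le_divide_eq mult.commute)
  have xb: "norm (x - b) \<le> 2 * \<rho>"
    using norm_triangle_ineq[of "x - y" "y - b"] dk k1 y(2) by (simp add: d_def dist_norm norm_minus_commute)
  have yb: "norm (y - b) < \<rho>"
  proof -
    have "l x + J y + a * (norm (y - b))\<^sup>2 + k * d\<^sup>2 \<le> l b + J b"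
      using min'[of b b] C(2) \<rho> by (simp add: d_def)
    also have "\<dots> \<le> l y + J y + \<rho> ^ 3" using min[OF y(1)] by simp
    also have "\<dots> \<le> l x + L * (L / k) + J y + \<rho> ^ 3"
      using lxy mult_left_mono[OF dk, of L] L(2) by simp
    finally have "a * (norm (y - b))\<^sup>2 + k * d\<^sup>2 < 2 * \<rho> ^ 3" using k2 by simp
    moreover have "0 \<le> k * d\<^sup>2" using \<open>k > 0\<close> by simp
    ultimately have "2 * \<rho> * (norm (y - b))\<^sup>2 < 2 * \<rho> * \<rho>\<^sup>2"
      by (simp add: a_def power2_eq_square power3_eq_cube)
    then have "(norm (y - b))\<^sup>2 < \<rho>\<^sup>2" using \<rho> by simp
    then show ?thesis using \<rho> by (simp add: power_less_imp_less_base)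
  qed
  define \<zeta> where "\<zeta> = (2 * k) *\<^sub>R (y - x)"
  define \<eta> where "\<eta> = - G y - (2 * a) *\<^sub>R (y - b) - \<zeta>"
  have "\<zeta> \<in> proximal_subdifferential l x"
    unfolding proximal_subdifferential_def mem_Collect_eq
  proof (intro exI[of _ k] conjI)
    have "x \<in> ball b R" using xb \<rho> by (simp add: dist_norm norm_minus_commute)
    then have "\<forall>\<^sub>F \<xi> in nhds x. \<xi> \<in> ball b R" by (intro eventually_nhds_in_open) auto
    then show "\<forall>\<^sub>F \<xi> in nhds x. l x + \<zeta> \<bullet> (\<xi> - x) - k * (norm (\<xi> - x))\<^sup>2 \<le> l \<xi>"
    proof eventually_elim
      case (elim \<xi>)
      then have "l x + k * (norm (x - y))\<^sup>2 \<le> l \<xi> + k * (norm (\<xi> - y))\<^sup>2"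
        using min'[of \<xi> y] y by auto
      moreover have "\<zeta> \<bullet> (\<xi> - x) = - (2 * k * ((x - y) \<bullet> (\<xi> - x)))"
        by (simp add: \<zeta>_def inner_diff_left algebra_simps)
      ultimately show ?case
        by (simp add: norm_diff_square_expand[of \<xi> y x] distrib_left)
    qed
  qed (use \<open>k > 0\<close> in simp)
  moreover have "\<eta> \<in> proximal_normal_cone C y"
  proof (rule proximal_normal_coneI_local)
    show "\<rho> - norm (y - b) > 0" using yb by simp
    show "\<sigma> + a + k \<ge> 0" using J(2) \<open>k > 0\<close> \<rho> by (simp add: a_def)
    fix \<xi> assume \<xi>: "\<xi> \<in> C" "norm (\<xi> - y) \<le> \<rho> - norm (y - b)"
    have \<xi>b: "\<xi> \<in> cball b \<rho>"
      using \<xi>(2) norm_triangle_ineq[of "\<xi> - y" "y - b"] by (simp add: dist_norm norm_minus_commute)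
    then have \<xi>1: "\<xi> \<in> cball b R" using \<rho> by auto
    have "J y + a * (norm (y - b))\<^sup>2 + k * (norm (y - x))\<^sup>2 \<le> J \<xi> + a * (norm (\<xi> - b))\<^sup>2 + k * (norm (\<xi> - x))\<^sup>2"
      using min'[OF x \<xi>(1) \<xi>b] by (simp add: norm_minus_commute)
    with J(1)[OF \<xi>1 y1]
    have "0 \<le> G y \<bullet> (\<xi> - y) + \<sigma> * (norm (\<xi> - y))\<^sup>2
        + a * (2 * ((y - b) \<bullet> (\<xi> - y)) + (norm (\<xi> - y))\<^sup>2) + k * (2 * ((y - x) \<bullet> (\<xi> - y)) + (norm (\<xi> - y))\<^sup>2)"
      by (simp add: norm_diff_square_expand[of \<xi> b y] norm_diff_square_expand[of \<xi> x y] distrib_left)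
    moreover have "\<eta> \<bullet> (\<xi> - y) = - (G y \<bullet> (\<xi> - y)) - 2 * a * ((y - b) \<bullet> (\<xi> - y)) - 2 * k * ((y - x) \<bullet> (\<xi> - y))"
      unfolding \<eta>_def \<zeta>_def inner_diff_left[of _ _ "\<xi> - y"] inner_minus_left inner_scaleR_left by (simp add: inner_diff_left)
    ultimately show "\<eta> \<bullet> (\<xi> - y) \<le> (\<sigma> + a + k) * (norm (\<xi> - y))\<^sup>2"
      by (simp add: distrib_left distrib_right)
  qed
  moreover have "norm \<zeta> \<le> 2 * L" using kd \<open>k > 0\<close> by (simp add: \<zeta>_def d_def norm_minus_commute)
  moreover have "norm (\<zeta> + \<eta> + G y) \<le> 4 * \<rho>\<^sup>2"
  proof -
    have "norm (\<zeta> + \<eta> + G y) = 4 * \<rho> * norm (y - b)"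
      using \<rho> by (simp add: \<eta>_def a_def)
    also have "\<dots> \<le> 4 * \<rho> * \<rho>" using yb \<rho> by (intro mult_left_mono) auto
    finally show ?thesis by (simp add: power2_eq_square)
  qed
  ultimately show ?thesis using xb yb y(1) less_imp_le by blast
qed

text \<open>
  Only the sum of the two vectors converges by assumption. The bound on the subgradients supplies a
  convergent subsequence, and with it the normals converge as well.
\<close>

lemma limiting_sum_closure:
  fixes l :: "'a::euclidean_space \<Rightarrow> real"
  assumes approx: "\<And>e. e > 0 \<Longrightarrow> \<exists>x y \<zeta> \<eta>. norm (x - b) \<le> e \<and> y \<in> C \<and> norm (y - b) \<le> e \<and>
      \<zeta> \<in> proximal_subdifferential l x \<and> \<eta> \<in> proximal_normal_cone C y \<and>
      norm \<zeta> \<le> B \<and> norm (\<zeta> + \<eta> - v) \<le> e"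
  shows "v \<in> limiting_subdifferential l b + limiting_normal_cone C b"
proof -
  have "\<exists>x y \<zeta> \<eta>. norm (x - b) \<le> inverse (real (Suc n)) \<and> y \<in> C \<and> norm (y - b) \<le> inverse (real (Suc n)) \<and>
      \<zeta> \<in> proximal_subdifferential l x \<and> \<eta> \<in> proximal_normal_cone C y \<and>
      norm \<zeta> \<le> B \<and> norm (\<zeta> + \<eta> - v) \<le> inverse (real (Suc n))" for n
    by (rule approx) simp
  then obtain x y \<zeta> \<eta> where w: "\<And>n. norm (x n - b) \<le> inverse (real (Suc n)) \<and> y n \<in> C \<and>
      norm (y n - b) \<le> inverse (real (Suc n)) \<and>
      \<zeta> n \<in> proximal_subdifferential l (x n) \<and> \<eta> n \<in> proximal_normal_cone C (y n) \<and>
      norm (\<zeta> n) \<le> B \<and> norm (\<zeta> n + \<eta> n - v) \<le> inverse (real (Suc n))"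
    by metis
  have lim: "X \<longlonglongrightarrow> c" if "\<And>n. norm (X n - c) \<le> inverse (real (Suc n))" for X :: "nat \<Rightarrow> 'a" and c
    by (rule LIM_zero_cancel, rule Lim_null_comparison[OF always_eventually LIMSEQ_inverse_real_of_nat])
       (use that in auto)
  have x: "x \<longlonglongrightarrow> b" and y: "y \<longlonglongrightarrow> b" and s: "(\<lambda>n. \<zeta> n + \<eta> n) \<longlonglongrightarrow> v"
    using w by (auto intro!: lim)
  have "\<zeta> n \<in> cball 0 B" for n using w by simp
  then obtain z r where r: "strict_mono r" "(\<zeta> \<circ> r) \<longlonglongrightarrow> z"
    using compact_cball[of "0::'a" B] unfolding compact_def by metis
  have "(\<lambda>n. (\<zeta> (r n) + \<eta> (r n)) - \<zeta> (r n)) \<longlonglongrightarrow> v - z"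
    using LIMSEQ_subseq_LIMSEQ[OF s r(1)] r(2) by (intro tendsto_diff) (auto simp: o_def)
  then have \<eta>: "(\<lambda>n. \<eta> (r n)) \<longlonglongrightarrow> v - z" by simp
  have "z \<in> limiting_subdifferential l b"
    unfolding limiting_subdifferential_def mem_Collect_eq
    using w LIMSEQ_subseq_LIMSEQ[OF x r(1)] r(2)
    by (intro exI[of _ "\<zeta> \<circ> r"] exI[of _ "x \<circ> r"]) auto
  moreover have "v - z \<in> limiting_normal_cone C b"
    unfolding limiting_normal_cone_def mem_Collect_eq
    using w LIMSEQ_subseq_LIMSEQ[OF y r(1)] \<eta>
    by (intro exI[of _ "\<eta> \<circ> r"] exI[of _ "y \<circ> r"]) (auto simp: o_def)
  ultimately have "z + (v - z) \<in> limiting_subdifferential l b + limiting_normal_cone C b"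
    by (rule set_plus_intro)
  then show ?thesis by simp
qed

lemma locally_lipschitz_imp_lipschitz_cball:
  fixes l :: "'a::euclidean_space \<Rightarrow> 'b::metric_space"
  assumes "locally_lipschitz l"
  obtains r L where "0 < r" "0 < L" "L-lipschitz_on (cball b r) l"
proof -
  obtain r L where "r > 0" and L: "L-lipschitz_on (cball b r) l"
    using assms unfolding locally_lipschitz_def by blast
  have "(max L 1)-lipschitz_on (cball b r) l" using L by (rule lipschitz_on_le) simp
  with \<open>r > 0\<close> show ?thesis using that[of r "max L 1"] by simp
qed

text \<open>
  The centre, which the punctured limit leaves out, may occur among the initial states of an
  approximating sequence. Continuity in the second variable fills it in.
\<close>

lemma tendsto_prod_at_imp_nhds:
  fixes I :: "'a::{perfect_space, metric_space} \<Rightarrow> 'c \<Rightarrow> 'b::metric_space"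
  assumes lim: "((\<lambda>(n, \<xi>). I \<xi> n) \<longlongrightarrow> v) (F \<times>\<^sub>F at b)"
    and cont: "\<forall>\<^sub>F n in F. isCont (\<lambda>\<xi>. I \<xi> n) b"
  shows "((\<lambda>(n, \<xi>). I \<xi> n) \<longlongrightarrow> v) (F \<times>\<^sub>F nhds b)"
proof (rule tendstoI)
  fix e :: real assume "e > 0"
  then have "e / 2 > 0" by simp
  from tendstoD[OF lim this] obtain P Q where P: "eventually P F" and Q: "eventually Q (at b)"
    and PQ: "\<And>n \<xi>. P n \<Longrightarrow> Q \<xi> \<Longrightarrow> dist (I \<xi> n) v < e / 2"
    unfolding eventually_prod_filter by auto
  have at_b: "dist (I b n) v < e" if "P n" "isCont (\<lambda>\<xi>. I \<xi> n) b" for n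
  proof -
    have "((\<lambda>\<xi>. dist (I \<xi> n) v) \<longlongrightarrow> dist (I b n) v) (at b)"
      using that(2) by (intro tendsto_intros) (simp add: isCont_def)
    moreover have "\<forall>\<^sub>F \<xi> in at b. dist (I \<xi> n) v \<le> e / 2"
      using Q by eventually_elim (use PQ[OF that(1)] in \<open>auto intro: less_imp_le\<close>)
    ultimately have "dist (I b n) v \<le> e / 2" by (rule tendsto_upperbound) simp
    then show ?thesis using \<open>e > 0\<close> by simp
  qed
  show "\<forall>\<^sub>F z in F \<times>\<^sub>F nhds b. dist (case z of (n, \<xi>) \<Rightarrow> I \<xi> n) v < e"
    unfolding eventually_prod_filter
  proof (intro exI conjI allI impI)
    show "\<forall>\<^sub>F n in F. P n \<and> isCont (\<lambda>\<xi>. I \<xi> n) b" using P cont by eventually_elim simp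
    show "\<forall>\<^sub>F \<xi> in nhds b. \<xi> \<noteq> b \<longrightarrow> Q \<xi>" using Q by (simp add: eventually_at_filter)
    fix n \<xi> assume n: "P n \<and> isCont (\<lambda>\<xi>. I \<xi> n) b" and \<xi>: "\<xi> \<noteq> b \<longrightarrow> Q \<xi>"
    show "dist (case (n, \<xi>) of (n, \<xi>) \<Rightarrow> I \<xi> n) v < e"
    proof (cases "\<xi> = b")
      case True with at_b n show ?thesis by simp
    next
      case False with PQ[of n \<xi>] n \<xi> \<open>e > 0\<close> show ?thesis by simp
    qed
  qed
qed

context control_problem
begin

lemma overtaking_optimal_imp_near_minimal:
  assumes opt: "uniformly_overtaking_optimal C l f f0 U \<tau> bs us" and "\<epsilon> > 0"
  shows "\<forall>\<^sub>F n in sequentially. \<forall>b\<in>C. l bs + cost f f0 bs us (\<tau> n) - \<epsilon> \<le> l b + cost f f0 b us (\<tau> n)"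
proof -
  have us: "us \<in> admissible_controls U" using opt by (simp add: uniformly_overtaking_optimal_def)
  let ?INF = "\<lambda>n. INF (b, u) \<in> C \<times> admissible_controls U. ereal (l b + cost f f0 b u (\<tau> n))"
  have "\<forall>\<^sub>F n in sequentially. ereal (- \<epsilon>) < ?INF n - ereal (l bs + cost f f0 bs us (\<tau> n))"
    using opt \<open>\<epsilon> > 0\<close> unfolding uniformly_overtaking_optimal_def le_Liminf_iff by (auto simp: zero_ereal_def)
  then show ?thesis
  proof eventually_elim
    case (elim n)
    show ?case
    proof
      fix b assume "b \<in> C"
      then have "(b, us) \<in> C \<times> admissible_controls U" using us by simp
      then have "?INF n \<le> (\<lambda>(b, u). ereal (l b + cost f f0 b u (\<tau> n))) (b, us)" by (rule INF_lower)
      then have "?INF n - ereal (l bs + cost f f0 bs us (\<tau> n))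
          \<le> ereal (l b + cost f f0 b us (\<tau> n)) - ereal (l bs + cost f f0 bs us (\<tau> n))"
        by (intro ereal_minus_mono) auto
      from less_le_trans[OF elim this]
      show "l bs + cost f f0 bs us (\<tau> n) - \<epsilon> \<le> l b + cost f f0 b us (\<tau> n)" by simp
    qed
  qed
qed

text \<open>
  With the optimal control kept fixed, bs minimises over C the sum of l and the cost up to \<open>\<tau>\<close> n, with
  an error that vanishes as n grows. The approximate Fermat rule applies with the gradient
  I(y;\<open>\<tau>\<close> n) of the cost, and these gradients converge to Is jointly in n and y.
\<close>

theorem transversality:
  assumes opt: "uniformly_overtaking_optimal C l f f0 U \<tau> bs us" and tau_pos: "\<And>n. \<tau> n > 0"
    and lim: "((\<lambda>(n, \<xi>). I_vec f f0 us \<xi> (\<tau> n)) \<longlongrightarrow> Is) (sequentially \<times>\<^sub>F nhds bs)"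
  shows "- Is \<in> limiting_subdifferential l bs + limiting_normal_cone C bs"
proof -
  have us: "us \<in> admissible_controls U" and bs: "bs \<in> C"
    using opt by (auto simp: uniformly_overtaking_optimal_def)
  obtain R L where R: "0 < R" and L: "0 < L" "L-lipschitz_on (cball bs R) l"
    using locally_lipschitz_imp_lipschitz_cball[OF lipschitz_l] by blast
  show ?thesis
  proof (rule limiting_sum_closure)
    fix e :: real assume "e > 0"
    (* l is Lipschitz on the ball of radius R, the expansion of the cost holds on the unit ball *)
    define r where "r = min R 1"
    have r: "0 < r" "r \<le> R" "r \<le> 1" using R by (auto simp: r_def)
    obtain P Q where P: "eventually P sequentially" and Q: "eventually Q (nhds bs)"
      and PQ: "\<And>n \<xi>. P n \<Longrightarrow> Q \<xi> \<Longrightarrow> dist (I_vec f f0 us \<xi> (\<tau> n)) Is < e / 2"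
      using tendstoD[OF lim, of "e / 2"] \<open>e > 0\<close> unfolding eventually_prod_filter by auto
    obtain \<delta> where \<delta>: "\<delta> > 0" "\<And>\<xi>. dist \<xi> bs < \<delta> \<Longrightarrow> Q \<xi>"
      using Q unfolding eventually_nhds_metric by blast
    define \<rho> where "\<rho> = min (min (r / 4) (e / 8)) (\<delta> / 2)"
    have \<rho>: "0 < \<rho>" "2 * \<rho> < r" "8 * \<rho> \<le> e" "\<rho> < \<delta>" "\<rho> \<le> 1"
      using r \<open>e > 0\<close> \<delta>(1) by (auto simp: \<rho>_def min_def)
    have "\<forall>\<^sub>F n in sequentially. P n \<and> (\<forall>b\<in>C. l bs + cost f f0 bs us (\<tau> n) - \<rho> ^ 3 \<le> l b + cost f f0 b us (\<tau> n))"
      using P overtaking_optimal_imp_near_minimal[OF opt, of "\<rho> ^ 3"] \<rho>(1) by (intro eventually_conj) auto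
    then obtain n where n: "P n" "\<And>b. b \<in> C \<Longrightarrow> l bs + cost f f0 bs us (\<tau> n) - \<rho> ^ 3 \<le> l b + cost f f0 b us (\<tau> n)"
      using eventually_happens'[OF sequentially_bot] by blast
    define J where "J = (\<lambda>b. cost f f0 b us (\<tau> n))"
    define G where "G = (\<lambda>b. I_vec f f0 us b (\<tau> n))"
    obtain \<sigma> where \<sigma>: "\<sigma> \<ge> 0" "\<And>x y. \<lbrakk>x \<in> cball bs 1; y \<in> cball bs 1\<rbrakk> \<Longrightarrow>
        \<bar>J x - J y - G y \<bullet> (x - y)\<bar> \<le> \<sigma> * (norm (x - y))\<^sup>2"
      using cost_quadratic_estimate[OF us, of "\<tau> n" bs] tau_pos[of n] unfolding J_def G_def by auto
    have sub: "cball bs r \<subseteq> cball bs 1" using r by auto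
    have "\<exists>x y \<zeta> \<eta>. norm (x - bs) \<le> 2 * \<rho> \<and> y \<in> C \<and> norm (y - bs) \<le> \<rho> \<and>
      \<zeta> \<in> proximal_subdifferential l x \<and> \<eta> \<in> proximal_normal_cone C y \<and>
      norm \<zeta> \<le> 2 * L \<and> norm (\<zeta> + \<eta> + G y) \<le> 4 * \<rho>\<^sup>2"
    proof (rule approximate_fermat_rule[where R = r and J = J and \<sigma> = \<sigma>])
      show "L-lipschitz_on (cball bs r) l" using L(2) by (rule lipschitz_on_subset) (use r in auto)
      show "continuous_on (cball bs r) J"
        by (rule quadratic_expansion_continuous_on[of _ J G \<sigma>]) (use \<sigma>(2) sub in blast)
      show "J x \<le> J y + G y \<bullet> (x - y) + \<sigma> * (norm (x - y))\<^sup>2"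
        if "x \<in> cball bs r" "y \<in> cball bs r" for x y
        using \<sigma>(2)[OF subsetD[OF sub that(1)] subsetD[OF sub that(2)]] by (simp add: abs_le_iff)
      show "l bs + J bs - \<rho> ^ 3 \<le> l x + J x" if "x \<in> C" for x using n(2)[OF that] by (simp add: J_def)
    qed (use closed_C bs L \<rho> \<sigma> in auto)
    then obtain x y \<zeta> \<eta> where *: "norm (x - bs) \<le> 2 * \<rho>" "y \<in> C" "norm (y - bs) \<le> \<rho>"
      "\<zeta> \<in> proximal_subdifferential l x" "\<eta> \<in> proximal_normal_cone C y"
      "norm \<zeta> \<le> 2 * L" "norm (\<zeta> + \<eta> + G y) \<le> 4 * \<rho>\<^sup>2"
      by blast
    have "norm (\<zeta> + \<eta> - - Is) \<le> norm (\<zeta> + \<eta> + G y) + norm (Is - G y)"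
      using norm_triangle_ineq[of "\<zeta> + \<eta> + G y" "Is - G y"] by (simp add: add.assoc)
    also have "norm (Is - G y) \<le> e / 2"
      using PQ[OF n(1) \<delta>(2), of y] *(3) \<rho>(4) by (simp add: G_def dist_norm norm_minus_commute)
    also have "norm (\<zeta> + \<eta> + G y) \<le> e / 2"
    proof -
      have "\<rho>\<^sup>2 \<le> \<rho>" using \<rho>(1,5) by (simp add: power2_eq_square mult_left_le)
      then show ?thesis using *(7) \<rho>(3) by simp
    qed
    finally have "norm (\<zeta> + \<eta> - - Is) \<le> e" by simp
    moreover have "norm (x - bs) \<le> e" "norm (y - bs) \<le> e" using *(1,3) \<rho>(1,3) by auto
    ultimately show "\<exists>x y \<zeta> \<eta>. norm (x - bs) \<le> e \<and> y \<in> C \<and> norm (y - bs) \<le> e \<and>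
        \<zeta> \<in> proximal_subdifferential l x \<and> \<eta> \<in> proximal_normal_cone C y \<and>
        norm \<zeta> \<le> 2 * L \<and> norm (\<zeta> + \<eta> - - Is) \<le> e"
      using *(2,4,5,6) by blast
  qed
qed

end

section \<open>Limiting solutions\<close>

lemma SUP_ereal_scale:
  fixes h :: "'a \<Rightarrow> real"
  assumes sup: "(SUP v\<in>V. ereal (h v)) = ereal m" and "c > 0"
  shows "(SUP v\<in>V. ereal (c * h v)) = ereal (c * m)"
proof (rule antisym)
  show "(SUP v\<in>V. ereal (c * h v)) \<le> ereal (c * m)"
  proof (rule SUP_least)
    fix v assume "v \<in> V"
    then have "ereal (h v) \<le> ereal m" unfolding sup[symmetric] by (rule SUP_upper)
    then show "ereal (c * h v) \<le> ereal (c * m)" using \<open>c > 0\<close> by simp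
  qed
  show "ereal (c * m) \<le> (SUP v\<in>V. ereal (c * h v))"
    unfolding le_SUP_iff
  proof (intro allI impI)
    fix y assume y: "y < ereal (c * m)"
    have ex: "\<exists>v\<in>V. r < h v" if "r < m" for r
    proof -
      have "ereal r < (SUP v\<in>V. ereal (h v))" using that by (simp add: sup)
      then show ?thesis by (simp add: less_SUP_iff)
    qed
    show "\<exists>v\<in>V. y < ereal (c * h v)"
    proof (cases y)
      case (real r)
      with y have "r / c < m" using \<open>c > 0\<close> by (simp add: pos_divide_less_eq mult.commute)
      with ex obtain v where "v \<in> V" "r / c < h v" by blast
      then show ?thesis using real \<open>c > 0\<close> by (intro bexI[of _ v]) (simp_all add: pos_divide_less_eq mult.commute)
    next
      case PInf with y show ?thesis by simp
    next
      case MInf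
      obtain v where "v \<in> V" using ex[of "m - 1"] by auto
      then show ?thesis using MInf by auto
    qed
  qed
qed

lemma hamiltonian_scale:
  "hamiltonian f f0 x v (c *\<^sub>R p) (c * lam) t = c * hamiltonian f f0 x v p lam t"
  by (simp add: hamiltonian_def algebra_simps)

context control_problem
begin

lemma solves_adjoint_scale:
  assumes "solves_adjoint f f0 x u p lam"
  shows "solves_adjoint f f0 x u (\<lambda>t. c *\<^sub>R p t) (c * lam)"
proof -
  interpret vm: bounded_bilinear "(v*) :: real^'m \<Rightarrow> real^'m^'m \<Rightarrow> real^'m"
    by (rule bounded_bilinear_vector_matrix_mult)
  have p: "solves (\<lambda>t p. - gradient (\<lambda>y. hamiltonian f f0 y (u t) p lam t) (x t)) p"
    using assms by (simp add: solves_adjoint_def)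
  show ?thesis
    unfolding solves_adjoint_def solves_def
  proof (intro conjI allI impI)
    show "absolutely_continuous_on 0 T (\<lambda>t. c *\<^sub>R p t)" if "T \<ge> 0" for T
      by (rule bounded_linear.absolutely_continuous_on[OF bounded_linear_scaleR_right
            solves_absolutely_continuous_on[OF p that]])
    have "AE t in lebesgue_on {0..}. (p has_vector_derivative
        - gradient (\<lambda>y. hamiltonian f f0 y (u t) (p t) lam t) (x t)) (at t within {0..})"
      using p by (simp add: solves_def)
    then show "AE t in lebesgue_on {0..}. ((\<lambda>t. c *\<^sub>R p t) has_vector_derivative
        - gradient (\<lambda>y. hamiltonian f f0 y (u t) (c *\<^sub>R p t) (c * lam) t) (x t)) (at t within {0..})"
      using AE_space
    proof eventually_elim
      case (elim t)
      have "t \<ge> 0" using elim(2) by simp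
      from bounded_linear.has_vector_derivative[OF bounded_linear_scaleR_right elim(1), of c] show ?case
        by (simp add: gradient_hamiltonian[OF \<open>t \<ge> 0\<close>] vm.scaleR_left algebra_simps)
    qed
  qed
qed

lemma limiting_solution_scale:
  assumes lim: "limiting_solution f f0 U \<tau> x u \<psi> lam" and "c > 0"
  shows "limiting_solution f f0 U \<tau> x u (\<lambda>t. c *\<^sub>R \<psi> t) (c * lam)"
proof -
  from lim have pmp: "pmp_solution f f0 U x u \<psi> lam" and nt: "lam \<noteq> 0 \<or> (\<exists>t\<ge>0. \<psi> t \<noteq> 0)"
    by (auto simp: limiting_solution_def)
  from lim obtain r xn p q where r: "strict_mono r"
    and sol: "\<And>n. q n \<ge> 0 \<and> solves (\<lambda>t y. f y (u t) t) (xn n) \<and>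
             solves_adjoint f f0 (xn n) u (p n) (q n) \<and> p n (\<tau> (r n)) = 0"
    and conv: "\<And>t. t \<ge> 0 \<Longrightarrow> (\<lambda>n. xn n t) \<longlonglongrightarrow> x t" "\<And>t. t \<ge> 0 \<Longrightarrow> (\<lambda>n. p n t) \<longlonglongrightarrow> \<psi> t" "q \<longlonglongrightarrow> lam"
    unfolding limiting_solution_def by blast
  have "pmp_solution f f0 U x u (\<lambda>t. c *\<^sub>R \<psi> t) (c * lam)"
    using pmp \<open>c > 0\<close> unfolding pmp_solution_def
    by (auto simp: hamiltonian_scale intro!: solves_adjoint_scale SUP_ereal_scale elim!: AE_mp)
  moreover have "c * lam \<noteq> 0 \<or> (\<exists>t\<ge>0. c *\<^sub>R \<psi> t \<noteq> 0)" using nt \<open>c > 0\<close> by auto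
  moreover have "\<exists>r xn p q. strict_mono r \<and>
        (\<forall>n. q n \<ge> 0 \<and> solves (\<lambda>t y. f y (u t) t) (xn n) \<and>
             solves_adjoint f f0 (xn n) u (p n) (q n) \<and> p n (\<tau> (r n)) = 0) \<and>
        (\<forall>t\<ge>0. (\<lambda>n. xn n t) \<longlonglongrightarrow> x t) \<and>
        (\<forall>t\<ge>0. (\<lambda>n. p n t) \<longlonglongrightarrow> c *\<^sub>R \<psi> t) \<and> q \<longlonglongrightarrow> c * lam"
    using r sol conv \<open>c > 0\<close>
    by (intro exI[of _ r] exI[of _ xn] exI[of _ "\<lambda>n t. c *\<^sub>R p n t"] exI[of _ "\<lambda>n. c * q n"])
       (auto intro!: solves_adjoint_scale tendsto_intros)
  ultimately show ?thesis unfolding limiting_solution_def by blast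
qed

text \<open>
  For the approximating costates the adjoint identity at the horizon, where they vanish, gives their
  initial values as minus the multiplier times I(x n 0;\<open>\<tau>\<close>(r n)); these converge to - lam Is. The adjoint
  identity for the limit itself expresses the costate at all times through its initial value and the
  multiplier. If the multiplier were 0 the costate would vanish too, against nontriviality.
\<close>

theorem limiting_solution_formula:
  assumes us: "us \<in> admissible_controls U" and tau_pos: "\<And>n. \<tau> n > 0"
    and lim: "((\<lambda>(n, \<xi>). I_vec f f0 us \<xi> (\<tau> n)) \<longlongrightarrow> Is) (sequentially \<times>\<^sub>F nhds bs)"
    and sol: "limiting_solution f f0 U \<tau> (traj f bs us) us \<psi> lam"
  shows "lam > 0"
    and "T \<ge> 0 \<Longrightarrow> \<psi> T = lam *\<^sub>R ((- Is + I_vec f f0 us bs T) v* matrix_inv (A_mat f us bs T))"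
    and "\<psi> 0 = - (lam *\<^sub>R Is)"
proof -
  interpret vm: bounded_bilinear "(v*) :: real^'m \<Rightarrow> real^'m^'m \<Rightarrow> real^'m"
    by (rule bounded_bilinear_vector_matrix_mult)
  from sol obtain r x p q where r: "strict_mono r"
    and approx: "\<And>n. q n \<ge> 0 \<and> solves (\<lambda>t y. f y (us t) t) (x n) \<and>
             solves_adjoint f f0 (x n) us (p n) (q n) \<and> p n (\<tau> (r n)) = 0"
    and conv: "\<And>t. t \<ge> 0 \<Longrightarrow> (\<lambda>n. x n t) \<longlonglongrightarrow> traj f bs us t" "\<And>t. t \<ge> 0 \<Longrightarrow> (\<lambda>n. p n t) \<longlonglongrightarrow> \<psi> t" "q \<longlonglongrightarrow> lam"
    unfolding limiting_solution_def by blast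
  have pmp: "lam \<ge> 0" "solves_adjoint f f0 (traj f bs us) us \<psi> lam" and nt: "lam \<noteq> 0 \<or> (\<exists>t\<ge>0. \<psi> t \<noteq> 0)"
    using sol by (auto simp: limiting_solution_def pmp_solution_def)
  have x0: "(\<lambda>n. x n 0) \<longlonglongrightarrow> bs" using conv(1)[of 0] by (simp add: traj_initial[OF us])
  have "(\<lambda>n. (case (r n, x n 0) of (n, \<xi>) \<Rightarrow> I_vec f f0 us \<xi> (\<tau> n))) \<longlonglongrightarrow> Is"
    by (rule filterlim_compose[OF lim filterlim_Pair[OF filterlim_subseq[OF r] x0]])
  then have "(\<lambda>n. - (q n *\<^sub>R I_vec f f0 us (x n 0) (\<tau> (r n)))) \<longlonglongrightarrow> - (lam *\<^sub>R Is)"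
    using conv(3) by (intro tendsto_intros) simp_all
  moreover have "p n 0 = - (q n *\<^sub>R I_vec f f0 us (x n 0) (\<tau> (r n)))" for n
    using adjoint_identity[OF us, of "x n" "p n" "q n" "\<tau> (r n)"] approx[of n] tau_pos[of "r n"]
    by (simp add: vm.zero_left eq_neg_iff_add_eq_0)
  ultimately have "(\<lambda>n. p n 0) \<longlonglongrightarrow> - (lam *\<^sub>R Is)" by simp
  with conv(2)[of 0] show \<psi>0: "\<psi> 0 = - (lam *\<^sub>R Is)" by (simp add: LIMSEQ_unique)
  show formula: "\<psi> T = lam *\<^sub>R ((- Is + I_vec f f0 us bs T) v* matrix_inv (A_mat f us bs T))" if "T \<ge> 0" for T
  proof -
    have "\<psi> T v* A_mat f us bs T = lam *\<^sub>R (- Is + I_vec f f0 us bs T)"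
      using adjoint_identity[OF us traj_solves[OF us] pmp(2) that]
      by (simp add: traj_initial[OF us] \<psi>0 algebra_simps)
    then have "(\<psi> T v* A_mat f us bs T) v* matrix_inv (A_mat f us bs T)
        = lam *\<^sub>R ((- Is + I_vec f f0 us bs T) v* matrix_inv (A_mat f us bs T))"
      by (simp add: vm.scaleR_left)
    moreover have "A_mat f us bs T ** matrix_inv (A_mat f us bs T) = mat 1"
      using A_mat_invertible[OF us that] unfolding invertible_def matrix_inv_def
      by (rule someI_ex[THEN conjunct1])
    ultimately show ?thesis by (simp add: vector_matrix_mul_assoc)
  qed
  show "lam > 0"
  proof (rule ccontr)
    assume "\<not> lam > 0"
    with pmp(1) have "lam = 0" by simp
    with formula nt show False by auto
  qed
qed

lemma set_integral_tail:
  assumes us: "us \<in> admissible_controls U" and "0 \<le> T" "T \<le> S"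
  shows "(LINT t:{T..S}|lebesgue. I_integrand f f0 us b t) = I_vec f f0 us b S - I_vec f f0 us b T"
proof -
  note int = locally_integrable_set_integrable[OF locally_integrable_I_integrand[OF us, of b]]
  have "(LINT t:{T..S}|lebesgue. I_integrand f f0 us b t) = integral {T..S} (I_integrand f f0 us b)"
    by (rule set_lebesgue_integral_eq_integral(2)[OF int[OF \<open>0 \<le> T\<close>]])
  also have "\<dots> = integral {0..S} (I_integrand f f0 us b) - integral {0..T} (I_integrand f f0 us b)"
    by (rule integral_increment[OF set_lebesgue_integral_eq_integral(1)[OF int[of 0 S]], symmetric]) (use assms in auto)
  finally show ?thesis by (simp add: integral_unique[OF I_vec_has_integral[OF us]])
qed

lemma improper_integral_tail:
  assumes us: "us \<in> admissible_controls U" and "T \<ge> 0"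
    and lim: "((\<lambda>(t, \<xi>). I_vec f f0 us \<xi> t) \<longlongrightarrow> Is) (at_top \<times>\<^sub>F nhds bs)"
  shows "has_improper_integral (I_integrand f f0 us bs) T (Is - I_vec f f0 us bs T)"
proof -
  have "((\<lambda>S. case (S, bs) of (t, \<xi>) \<Rightarrow> I_vec f f0 us \<xi> t) \<longlongrightarrow> Is) at_top"
    by (rule filterlim_compose[OF lim filterlim_Pair[OF filterlim_ident tendsto_const]])
  then have "((\<lambda>S. I_vec f f0 us bs S - I_vec f f0 us bs T) \<longlongrightarrow> Is - I_vec f f0 us bs T) at_top"
    by (intro tendsto_intros) simp_all
  moreover have "\<forall>\<^sub>F S in at_top. I_vec f f0 us bs S - I_vec f f0 us bs T = (LINT t:{T..S}|lebesgue. I_integrand f f0 us bs t)"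
    by (rule eventually_mono[OF eventually_ge_at_top[of T]]) (rule set_integral_tail[OF us \<open>T \<ge> 0\<close>, symmetric])
  ultimately show ?thesis unfolding has_improper_integral_def by (rule Lim_transform_eventually)
qed

end

theorem corollary3p2:
  fixes C :: "(real^'m) set"
    and l :: "real^'m \<Rightarrow> real"
    and f :: "real^'m \<Rightarrow> 'u::euclidean_space \<Rightarrow> real \<Rightarrow> real^'m"
    and f0 :: "real^'m \<Rightarrow> 'u \<Rightarrow> real \<Rightarrow> real"
    and U :: "real \<Rightarrow> 'u set"
    and \<tau> :: "nat \<Rightarrow> real"
    and bs :: "real^'m" and us :: "real \<Rightarrow> 'u"
    and \<psi>s :: "real \<Rightarrow> real^'m" and lams :: real
    and Is :: "real^'m"
  assumes problem: "control_problem C l f f0 U"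
    and tau_pos: "\<And>n. \<tau> n > 0"
    and tau_incseq: "incseq \<tau>"
    and tau_unbounded: "filterlim \<tau> at_top sequentially"
    and optimal: "uniformly_overtaking_optimal C l f f0 U \<tau> bs us"
    and limiting: "limiting_solution f f0 U \<tau> (traj f bs us) us \<psi>s lams"
    and limit: "((\<lambda>(n, \<xi>). I_vec f f0 us \<xi> (\<tau> n)) \<longlongrightarrow> Is) (sequentially \<times>\<^sub>F at bs)"
  shows "(\<forall>\<psi> lam. limiting_solution f f0 U \<tau> (traj f bs us) us \<psi> lam \<longrightarrow>
            (\<exists>c>0. lam = c * lams \<and> (\<forall>t\<ge>0. \<psi> t = c *\<^sub>R \<psi>s t))) \<and>
         (\<exists>c>0. \<exists>\<psi> lam. lam = c * lams \<and> \<psi> = (\<lambda>t. c *\<^sub>R \<psi>s t) \<and>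
            limiting_solution f f0 U \<tau> (traj f bs us) us \<psi> lam \<and>
            lam = 1 \<and>
            \<psi> 0 = - Is \<and>
            - Is \<in> limiting_subdifferential l bs + limiting_normal_cone C bs \<and>
            (\<forall>T\<ge>0. \<psi> T =
               (- Is + (LINT t:{0..T}|lebesgue. D_f0 f0 (traj f bs us t) (us t) t v* A_mat f us bs t))
                 v* matrix_inv (A_mat f us bs T)) \<and>
            (((\<lambda>(t, \<xi>). I_vec f f0 us \<xi> t) \<longlongrightarrow> Is) (at_top \<times>\<^sub>F at bs) \<longrightarrow>
               (\<forall>T\<ge>0. \<exists>W. has_improper_integral
                  (\<lambda>t. D_f0 f0 (traj f bs us t) (us t) t v* A_mat f us bs t) T W \<and>
                  \<psi> T = (- W) v* matrix_inv (A_mat f us bs T)) \<and>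
               (\<exists>W. has_improper_integral
                  (\<lambda>t. D_f0 f0 (traj f bs us t) (us t) t v* A_mat f us bs t) 0 W \<and>
                  - W \<in> limiting_subdifferential l bs + limiting_normal_cone C bs)))"
proof -
  interpret control_problem C l f f0 U by (rule problem)
  have us: "us \<in> admissible_controls U" using optimal by (simp add: uniformly_overtaking_optimal_def)
  have lim: "((\<lambda>(n, \<xi>). I_vec f f0 us \<xi> (\<tau> n)) \<longlongrightarrow> Is) (sequentially \<times>\<^sub>F nhds bs)"
    by (rule tendsto_prod_at_imp_nhds[OF limit]) (use tau_pos in \<open>auto intro!: always_eventually I_vec_isCont[OF us] less_imp_le\<close>)
  note formula = limiting_solution_formula[OF us tau_pos lim]
  let ?F = "\<lambda>T. (- Is + I_vec f f0 us bs T) v* matrix_inv (A_mat f us bs T)"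
  have lams: "lams > 0" by (rule formula(1)[OF limiting])
  have \<psi>s: "\<psi>s T = lams *\<^sub>R ?F T" if "T \<ge> 0" for T by (rule formula(2)[OF limiting that])
  have unique: "\<exists>c>0. lam = c * lams \<and> (\<forall>t\<ge>0. \<psi> t = c *\<^sub>R \<psi>s t)"
    if sol: "limiting_solution f f0 U \<tau> (traj f bs us) us \<psi> lam" for \<psi> lam
    using lams formula(1)[OF sol] formula(2)[OF sol] \<psi>s by (intro exI[of _ "lam / lams"]) auto
  define c where "c = 1 / lams"
  define \<psi> where "\<psi> = (\<lambda>t. c *\<^sub>R \<psi>s t)"
  have "c > 0" and clams: "c * lams = 1" using lams by (auto simp: c_def)
  have sol: "limiting_solution f f0 U \<tau> (traj f bs us) us \<psi> 1"
    using limiting_solution_scale[OF limiting \<open>c > 0\<close>] by (simp add: clams \<psi>_def)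
  have \<psi>0: "\<psi> 0 = - Is" using formula(3)[OF sol] by simp
  have \<psi>T: "\<psi> T = ?F T" if "T \<ge> 0" for T using formula(2)[OF sol that] by simp
  have I_eq: "(LINT t:{0..T}|lebesgue. D_f0 f0 (traj f bs us t) (us t) t v* A_mat f us bs t) = I_vec f f0 us bs T" for T
    by (simp add: I_vec_def I_integrand_def)
  have trans: "- Is \<in> limiting_subdifferential l bs + limiting_normal_cone C bs"
    by (rule transversality[OF optimal tau_pos lim])
  have integrand: "(\<lambda>t. D_f0 f0 (traj f bs us t) (us t) t v* A_mat f us bs t) = I_integrand f f0 us bs"
    by (simp add: I_integrand_def[abs_def])
  have improper: "has_improper_integral (I_integrand f f0 us bs) T (Is - I_vec f f0 us bs T)"
    if "((\<lambda>(t, \<xi>). I_vec f f0 us \<xi> t) \<longlongrightarrow> Is) (at_top \<times>\<^sub>F at bs)" "T \<ge> 0" for T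
  proof (rule improper_integral_tail[OF us that(2) tendsto_prod_at_imp_nhds[OF that(1)]])
    show "\<forall>\<^sub>F t in at_top. isCont (\<lambda>\<xi>. I_vec f f0 us \<xi> t) bs"
      by (rule eventually_mono[OF eventually_ge_at_top[of 0]]) (rule I_vec_isCont[OF us])
  qed
  show ?thesis
  proof (rule conjI, goal_cases)
    case 1
    show ?case using unique by blast
  next
    case 2
    show ?case
    proof (rule exI[of _ c], intro conjI exI[of _ \<psi>] exI[of _ "1::real"] allI impI)
      fix T :: real
      assume lim': "((\<lambda>(t, \<xi>). I_vec f f0 us \<xi> t) \<longlongrightarrow> Is) (at_top \<times>\<^sub>F at bs)" and "T \<ge> 0"
      show "\<exists>W. has_improper_integral
                    (\<lambda>t. D_f0 f0 (traj f bs us t) (us t) t v* A_mat f us bs t) T W \<and>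
                    \<psi> T = (- W) v* matrix_inv (A_mat f us bs T)"
        unfolding integrand using improper[OF lim' \<open>T \<ge> 0\<close>] \<psi>T[OF \<open>T \<ge> 0\<close>]
        by (intro exI[of _ "Is - I_vec f f0 us bs T"]) simp
    next
      assume lim': "((\<lambda>(t, \<xi>). I_vec f f0 us \<xi> t) \<longlongrightarrow> Is) (at_top \<times>\<^sub>F at bs)"
      have "I_vec f f0 us bs 0 = 0" using integral_unique[OF I_vec_has_integral[OF us, of bs 0]] by simp
      then show "\<exists>W. has_improper_integral
                    (\<lambda>t. D_f0 f0 (traj f bs us t) (us t) t v* A_mat f us bs t) 0 W \<and>
                    - W \<in> limiting_subdifferential l bs + limiting_normal_cone C bs"
        unfolding integrand using improper[OF lim', of 0] trans by (intro exI[of _ Is]) simp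
    qed (use \<open>c > 0\<close> clams sol \<psi>0 trans \<psi>T I_eq \<psi>_def in \<open>simp_all\<close>)
  qed
qed

end
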